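(* Let $\Bbbk$ be an algebraically closed field, and let $d\in\{2,3,4,5,6,7,9\}$ and $n\ge1$ be integers. Then the general hypersurface of degree $d$ in $\mathbb P^n_\Bbbk$ does not contain any complete intersection of codimension $r<\mathrm{sl.rk}^\circ_{n,d}$ defined by forms of degrees between $1$ and $d-1$. That is, for a general form $f\in\Bbbk[x_0,\dots,x_n]$ of degree $d$, there are no integer $1\le r<\mathrm{sl.rk}^\circ_{n,d}$ and regular sequence of forms $g_1,\ldots,g_r$ with $1\le \deg g_i\le d-1$ such that $f\in(g_1,\ldots,g_r)$.
   Context: Let $\mathcal S=\Bbbk[x_0,\ldots,x_n]=\bigoplus_{d\ge 0}\mathcal S_d$. The slice rank of $f\in\mathcal S_d$ is the smallest $r$ such that $f=\ell_1g_1+\cdots+\ell_rg_r$ with $\ell_i\in\mathcal S_1$, $g_i\in\mathcal S_{d-1}$. The number $\mathrm{sl.rk}^\circ_{n,d}$ is the slice rank of a general form in $\mathcal S_d$; it is given by $$\mathrm{sl.rk}^\circ_{n,d}=\min\left\{r\in\mathbb Z_{\ge (n+1)/2}\;\middle|\; r(n+1-r)\ge\binom{d+n-r}{d}\right\}.$$ "General" means for all $f$ in some nonempty Zariski-open subset of $\mathcal S_d$. Containment of the complete intersection in the hypersurface is meant scheme-theoretically. *)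

theory Defs
  imports "HOL-Library.Poly_Mapping" "HOL-Computational_Algebra.Polynomial"
begin

(* A monomial is its finitely supported exponent vector.  The ambient type has variables
   indexed by all natural numbers; the ring k[x_0, ..., x_n] is the carrier polys n. *)

type_synonym 'a mpoly = "(nat \<Rightarrow>\<^sub>0 nat) \<Rightarrow>\<^sub>0 'a"

definition polys :: "nat \<Rightarrow> 'a::field mpoly set" where
  "polys n = {p. \<forall>m \<in> Poly_Mapping.keys p. Poly_Mapping.keys m \<subseteq> {..n}}"

(* As usual for graded pieces, 0 belongs to forms n d for every d. *)
definition forms :: "nat \<Rightarrow> nat \<Rightarrow> 'a::field mpoly set" where
  "forms n d = {p \<in> polys n. \<forall>m \<in> Poly_Mapping.keys p. (\<Sum>i\<le>n. Poly_Mapping.lookup m i) = d}"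

definition ideal_of :: "nat \<Rightarrow> 'a::field mpoly list \<Rightarrow> 'a mpoly set" where
  "ideal_of n gs = {\<Sum>i<length gs. h i * gs ! i | h. \<forall>i<length gs. h i \<in> polys n}"

definition regular_sequence :: "nat \<Rightarrow> 'a::field mpoly list \<Rightarrow> bool" where
  "regular_sequence n gs \<longleftrightarrow>
     set gs \<subseteq> polys n \<and>
     (\<forall>i<length gs. \<forall>h \<in> polys n.
        h * gs ! i \<in> ideal_of n (take i gs) \<longrightarrow> h \<in> ideal_of n (take i gs)) \<and>
     ideal_of n gs \<noteq> polys n"

(* Meaningful for d > 0 and f in forms n d. *)
definition slice_rank :: "nat \<Rightarrow> nat \<Rightarrow> 'a::field mpoly \<Rightarrow> nat" where
  "slice_rank n d f =
     (LEAST r. \<exists>l g. (\<forall>i<r. l i \<in> forms n 1 \<and> g i \<in> forms n (d - 1)) \<and>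
                     f = (\<Sum>i<r. l i * g i))"

definition poly_eval :: "(('v \<Rightarrow>\<^sub>0 nat) \<Rightarrow>\<^sub>0 'a::field) \<Rightarrow> ('v \<Rightarrow> 'a) \<Rightarrow> 'a" where
  "poly_eval P c =
     (\<Sum>m \<in> Poly_Mapping.keys P.
        Poly_Mapping.lookup P m * (\<Prod>v \<in> Poly_Mapping.keys m. c v ^ Poly_Mapping.lookup m v))"

(* The coordinates on the affine space forms n d are the coefficients of a form, so the
   variables of the defining equations in E are themselves exponent vectors.  Variables that
   are not monomials of degree d in x_0, ..., x_n evaluate to 0 on forms n d. *)
definition zariski_closed :: "nat \<Rightarrow> nat \<Rightarrow> 'a::field mpoly set \<Rightarrow> bool" where
  "zariski_closed n d Z \<longleftrightarrow>
     (\<exists>E :: (((nat \<Rightarrow>\<^sub>0 nat) \<Rightarrow>\<^sub>0 nat) \<Rightarrow>\<^sub>0 'a) set.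
        Z = {f \<in> forms n d. \<forall>P \<in> E. poly_eval P (Poly_Mapping.lookup f) = 0})"

definition zariski_open :: "nat \<Rightarrow> nat \<Rightarrow> 'a::field mpoly set \<Rightarrow> bool" where
  "zariski_open n d U \<longleftrightarrow> U \<subseteq> forms n d \<and> zariski_closed n d (forms n d - U)"

definition general_form :: "nat \<Rightarrow> nat \<Rightarrow> ('a::field mpoly \<Rightarrow> bool) \<Rightarrow> bool" where
  "general_form n d Q \<longleftrightarrow> (\<exists>U. zariski_open n d U \<and> U \<noteq> {} \<and> (\<forall>f \<in> U. Q f))"

(* Over an algebraically closed field, and for n, d > 0, the number r is unique because
   nonempty Zariski-open sets meet, and it exists because {f. slice_rank n d f <= r} is
   Zariski-closed in forms n d for every r. *)
definition generic_slice_rank :: "'a::alg_closed_field itself \<Rightarrow> nat \<Rightarrow> nat \<Rightarrow> nat" where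
  "generic_slice_rank _ n d =
     (THE r. general_form n d (\<lambda>f :: 'a mpoly. slice_rank n d f = r))"

end

theory Submission
  imports Defs "HOL-Computational_Algebra.Formal_Power_Series"
begin

text \<open>
  If a form \<open>f\<close> of degree \<open>d\<close> lies in the ideal of forms
  \<open>g\<^sub>1, \<dots>, g\<^sub>r\<close> of positive degrees less than \<open>d\<close>,
  then \<open>f = g\<^sub>1 h\<^sub>1 + \<dots> + g\<^sub>r h\<^sub>r\<close> with forms
  \<open>h\<^sub>i\<close> of the complementary degrees, and exchanging \<open>g\<^sub>i\<close>
  with \<open>h\<^sub>i\<close> where necessary makes every \<open>e\<^sub>i = deg
  g\<^sub>i\<close> at most \<open>d/2\<close>. Only finitely many types \<open>(e\<^sub>1 \<le>
  \<dots> \<le> e\<^sub>r)\<close> occur, so it is enough to see that for each type the sums of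
  products lie in a proper hypersurface of the space of forms (they are "thin") whenever
  \<open>r\<close> is less than the generic slice rank: \<open>product_type_thin\<close>.

  If all \<open>e\<^sub>i\<close> are 1, the sums of products are the forms of slice rank at most
  \<open>r\<close>. The generic slice rank is the least \<open>r\<close> for which these are dense
  (\<open>generic_slice_rank_eq\<close>); its proof needs that a dense polynomial image contains a
  nonempty open set (\<open>image_contains_open\<close>). This settles \<open>d \<le> 3\<close>.

  Otherwise \<open>d \<ge> 4\<close>. Let \<open>x\<^sub>0, \<dots>, x\<^sub>n\<close> be the
  variables and \<open>c = n + 1 - r\<close>. If \<open>r c \<ge> C(c + d - 1, d)\<close>, then
  forms of slice rank at most \<open>r\<close> are dense (\<open>slice_dense_criterion\<close>):
  modulo the first \<open>r\<close> variables the claim is that \<open>r\<close> general forms of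
  degree \<open>d - 1\<close> in \<open>c\<close> variables span all forms of degree
  \<open>d\<close> when multiplied by the variables, and that follows by counting the parameters
  of a functional that annihilates these products, according to its rank
  (\<open>thin_not_spanning\<close>). A form is then reached to second order from a sum of
  \<open>r\<close> products \<open>x\<^sub>i G\<^sub>i\<close>, which is enough in every
  characteristic (\<open>second_order_variation\<close>). Hence \<open>r c < C(c + d - 1,
  d)\<close> when \<open>r\<close> is less than the generic slice rank.

  Let \<open>H(j)\<close> be the number of monomials of degree \<open>j\<close> whose exponent at
  \<open>x\<^sub>i\<close> is below \<open>e\<^sub>i\<close> for each of the first
  \<open>r\<close> variables. This is the Hilbert function of a complete intersection of type
  \<open>e\<close>, and general generators can be brought to the form \<open>x\<^sub>i^e\<^sub>i -
  (combination of these monomials)\<close> without changing their ideal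
  (\<open>normal_form\<close>). So the ideal has \<open>H(e\<^sub>1) + \<dots> +
  H(e\<^sub>r)\<close> parameters, and its degree \<open>d\<close> part has codimension
  \<open>H(d)\<close>: the sums of products are thin if \<open>H(e\<^sub>1) + \<dots> +
  H(e\<^sub>r) < H(d)\<close> (\<open>thin_sums_of_products\<close>).

  The inequality is derived from \<open>r c < C(c + d - 1, d)\<close> in
  \<open>codimension_ineq\<close>. One splits \<open>H\<close> according to the set
  \<open>T\<close> of those among the first \<open>r\<close> variables that occur in a monomial
  and compares the contributions of each \<open>T\<close> separately. Both sides are coefficients
  of series that are multiplied by \<open>1/(1 - X)\<close> when \<open>c\<close> grows by one, so
  an inequality that holds for all shifted coefficients at the smallest \<open>c\<close> persists
  (\<open>shift_ineq\<close>), and for the degrees in question the smallest case is a finite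
  check. The only type that escapes is that of two quadrics in four variables with \<open>d =
  4\<close>, where \<open>H(2) + H(2) = H(4)\<close>. There \<open>g\<^sub>1, h\<^sub>1,
  g\<^sub>2, h\<^sub>2\<close> play symmetric roles: \<open>f\<close> is a quadratic expression in
  a four-dimensional space of quadrics, which gives \<open>24 + 10 = 34\<close> parameters for the
  35 coefficients of a quartic (\<open>thin_quartic_surface\<close>).
\<close>

section \<open>Polynomial functions and sets inside a hypersurface\<close>

text \<open>Closure under constants, sums and products is all that substitution into a polynomial
function needs; the polynomial functions themselves, the polynomials in one variable and those in
two parameters are the instances below.\<close>

definition fun_alg :: "('x \<Rightarrow> 'a::comm_ring_1) set \<Rightarrow> bool" where
  "fun_alg R \<longleftrightarrow> (\<forall>a. (\<lambda>_. a) \<in> R) \<and> (\<forall>f\<in>R. \<forall>g\<in>R. (\<lambda>x. f x + g x) \<in> R \<and> (\<lambda>x. f x * g x) \<in> R)"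

lemma fun_alg_const: "fun_alg R \<Longrightarrow> (\<lambda>_. a) \<in> R"
  and fun_alg_add: "fun_alg R \<Longrightarrow> f \<in> R \<Longrightarrow> g \<in> R \<Longrightarrow> (\<lambda>x. f x + g x) \<in> R"
  and fun_alg_mult: "fun_alg R \<Longrightarrow> f \<in> R \<Longrightarrow> g \<in> R \<Longrightarrow> (\<lambda>x. f x * g x) \<in> R"
  by (auto simp: fun_alg_def)

lemma fun_alg_minus: "fun_alg R \<Longrightarrow> f \<in> R \<Longrightarrow> (\<lambda>x. - f x) \<in> R"
  using fun_alg_mult[OF _ fun_alg_const, of R f "-1"] by simp

lemma fun_alg_diff: "fun_alg R \<Longrightarrow> f \<in> R \<Longrightarrow> g \<in> R \<Longrightarrow> (\<lambda>x. f x - g x) \<in> R"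
  using fun_alg_add[OF _ _ fun_alg_minus, of R f g] by simp

lemma fun_alg_sum:
  assumes "fun_alg R" "\<And>i. i \<in> I \<Longrightarrow> f i \<in> R"
  shows "(\<lambda>x. \<Sum>i\<in>I. f i x) \<in> R"
  using assms by (induction I rule: infinite_finite_induct) (auto intro!: fun_alg_const fun_alg_add)

lemma fun_alg_prod:
  assumes "fun_alg R" "\<And>i. i \<in> I \<Longrightarrow> f i \<in> R"
  shows "(\<lambda>x. \<Prod>i\<in>I. f i x) \<in> R"
  using assms by (induction I rule: infinite_finite_induct) (auto intro!: fun_alg_const fun_alg_mult)

lemma fun_alg_power: "fun_alg R \<Longrightarrow> f \<in> R \<Longrightarrow> (\<lambda>x. f x ^ k) \<in> R"
  by (induction k) (auto intro!: fun_alg_const fun_alg_mult)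

lemmas fun_alg_intros = fun_alg_const fun_alg_add fun_alg_mult fun_alg_minus fun_alg_diff
  fun_alg_sum fun_alg_prod fun_alg_power

inductive_set polyfun :: "'v set \<Rightarrow> (('v \<Rightarrow> 'a::comm_ring_1) \<Rightarrow> 'a) set" for V where
  polyfun_const: "(\<lambda>_. a) \<in> polyfun V"
| polyfun_var: "v \<in> V \<Longrightarrow> (\<lambda>x. x v) \<in> polyfun V"
| polyfun_add: "f \<in> polyfun V \<Longrightarrow> g \<in> polyfun V \<Longrightarrow> (\<lambda>x. f x + g x) \<in> polyfun V"
| polyfun_mult: "f \<in> polyfun V \<Longrightarrow> g \<in> polyfun V \<Longrightarrow> (\<lambda>x. f x * g x) \<in> polyfun V"

lemma fun_alg_polyfun [simp]: "fun_alg (polyfun V)"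
  by (auto simp: fun_alg_def intro: polyfun.intros)

lemma polyfun_comp:
  assumes P: "P \<in> polyfun M" and R: "fun_alg R" and F: "\<And>m. m \<in> M \<Longrightarrow> (\<lambda>x. F x m) \<in> R"
  shows "(\<lambda>x. P (F x)) \<in> R"
  using P by induction (auto intro: fun_alg_const[OF R] fun_alg_add[OF R] fun_alg_mult[OF R] F)

lemma polyfun_cong:
  assumes "P \<in> polyfun M" "\<And>m. m \<in> M \<Longrightarrow> x m = y m"
  shows "P x = P y"
  using assms by induction auto

lemma fun_alg_poly: "fun_alg (range (poly :: 'a::comm_ring_1 poly \<Rightarrow> _))"
proof (unfold fun_alg_def, intro conjI allI ballI)
  fix a :: 'a
  show "(\<lambda>_. a) \<in> range poly" by (rule range_eqI[of _ _ "[:a:]"]) auto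
next
  fix f g :: "'a \<Rightarrow> 'a" assume "f \<in> range poly" "g \<in> range poly"
  then obtain p q where "f = poly p" "g = poly q" by auto
  then have "(\<lambda>x. f x + g x) = poly (p + q)" "(\<lambda>x. f x * g x) = poly (p * q)"
    by (auto simp: fun_eq_iff)
  then show "(\<lambda>x. f x + g x) \<in> range poly" "(\<lambda>x. f x * g x) \<in> range poly" by auto
qed

lemma poly_line: "(\<lambda>t. a + t * b) \<in> range (poly :: 'a::comm_ring_1 poly \<Rightarrow> _)"
  by (rule range_eqI[of _ _ "[:a, b:]"]) (auto simp: algebra_simps)

text \<open>Restriction to a line reduces statements about open sets to finiteness of the roots of a
polynomial in one variable.\<close>

lemma polyfun_line:
  fixes P :: "('v \<Rightarrow> 'a::comm_ring_1) \<Rightarrow> 'a"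
  assumes "P \<in> polyfun V"
  shows "\<exists>p. \<forall>t. poly p t = P (\<lambda>v. a v + t * b v)"
proof -
  have "(\<lambda>t. P (\<lambda>v. a v + t * b v)) \<in> range poly"
    by (rule polyfun_comp[OF assms fun_alg_poly poly_line])
  then obtain p where "(\<lambda>t. P (\<lambda>v. a v + t * b v)) = poly p" by blast
  thus ?thesis by (metis (no_types))
qed

lemma infinite_UNIV_alg_closed: "infinite (UNIV :: 'a::alg_closed_field set)"
proof
  assume fin: "finite (UNIV :: 'a set)"
  define p where "p = (\<Prod>a\<in>UNIV. [:- a, 1 :: 'a:]) + 1"
  have deg: "degree (\<Prod>a\<in>UNIV. [:- a, 1 :: 'a:]) = card (UNIV :: 'a set)"
    by (subst degree_prod_eq_sum_degree) auto
  have "card (UNIV :: 'a set) > 0" using fin by (simp add: finite_UNIV_card_ge_0)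
  hence "degree p > 0" unfolding p_def using deg by (subst degree_add_eq_left) auto
  then obtain x where "poly p x = 0" using alg_closed_imp_poly_has_root by blast
  moreover have "poly p x = 1" unfolding p_def using fin by (auto simp: poly_prod)
  ultimately show False by simp
qed

lemma poly_cofinite_zero:
  fixes p :: "'a::alg_closed_field poly"
  assumes "finite S" "\<And>t. t \<notin> S \<Longrightarrow> poly p t = 0"
  shows "p = 0"
proof (rule ccontr)
  assume "p \<noteq> 0"
  hence "finite {t. poly p t = 0}" by (rule poly_roots_finite)
  moreover have "UNIV = {t. poly p t = 0} \<union> S" using assms by auto
  ultimately show False using assms(1) infinite_UNIV_alg_closed by (metis finite_UnI)
qed

text \<open>A thin set lies in a proper hypersurface of the affine space with coordinates
\<open>M\<close>, so it is not Zariski dense. A point is a function on the whole index type of which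
only the values on \<open>M\<close> count.\<close>

definition thin :: "'m set \<Rightarrow> ('m \<Rightarrow> 'a::comm_ring_1) set \<Rightarrow> bool" where
  "thin M Z \<longleftrightarrow> (\<exists>P\<in>polyfun M. (\<exists>z. P z \<noteq> 0) \<and> (\<forall>z\<in>Z. P z = 0))"

lemma thin_subset: "thin M Z \<Longrightarrow> Z' \<subseteq> Z \<Longrightarrow> thin M Z'"
  unfolding thin_def by blast

lemma thin_empty: "thin M {}"
  unfolding thin_def by (intro bexI[of _ "\<lambda>_. 1"]) (auto intro: polyfun.intros)

text \<open>Two nonempty open sets meet: on the line through a point of each, either polynomial
vanishes only finitely often, and the field is infinite.\<close>

lemma polyfun_mult_nonzero:
  fixes P Q :: "('m \<Rightarrow> 'a::alg_closed_field) \<Rightarrow> 'a"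
  assumes "P \<in> polyfun M" "Q \<in> polyfun M" "P x \<noteq> 0" "Q y \<noteq> 0"
  shows "\<exists>t. P (\<lambda>v. x v + t * (y v - x v)) \<noteq> 0 \<and> Q (\<lambda>v. x v + t * (y v - x v)) \<noteq> 0"
proof -
  obtain p where p: "\<forall>t. poly p t = P (\<lambda>v. x v + t * (y v - x v))"
    using polyfun_line[OF assms(1), of x "\<lambda>v. y v - x v"] ..
  obtain q where q: "\<forall>t. poly q t = Q (\<lambda>v. x v + t * (y v - x v))"
    using polyfun_line[OF assms(2), of x "\<lambda>v. y v - x v"] ..
  have "poly p 0 \<noteq> 0" "poly q 1 \<noteq> 0" using assms by (auto simp: p q)
  hence "p * q \<noteq> 0" by auto
  then obtain t where "poly (p * q) t \<noteq> 0" using poly_cofinite_zero[of "{}" "p * q"] by auto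
  thus ?thesis using p q by (intro exI[of _ t]) auto
qed

lemma thin_Un:
  fixes Z :: "('m \<Rightarrow> 'a::alg_closed_field) set"
  assumes "thin M Z" "thin M Z'" shows "thin M (Z \<union> Z')"
proof -
  obtain P x Q y where *: "P \<in> polyfun M" "P x \<noteq> 0" "\<forall>z\<in>Z. P z = 0" "Q \<in> polyfun M" "Q y \<noteq> 0"
    "\<forall>z\<in>Z'. Q z = 0" using assms unfolding thin_def by blast
  have "\<exists>t. P (\<lambda>v. x v + t * (y v - x v)) \<noteq> 0 \<and> Q (\<lambda>v. x v + t * (y v - x v)) \<noteq> 0"
    by (rule polyfun_mult_nonzero[of P M Q x y]) fact+
  then obtain t where
    t: "P (\<lambda>v. x v + t * (y v - x v)) \<noteq> 0 \<and> Q (\<lambda>v. x v + t * (y v - x v)) \<noteq> 0" ..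
  let ?w = "\<lambda>v. x v + t * (y v - x v)"
  have "P ?w * Q ?w \<noteq> 0" using t by simp
  hence "\<exists>z. P z * Q z \<noteq> 0" by (rule exI[of _ ?w])
  moreover have "(\<lambda>z. P z * Q z) \<in> polyfun M" using *(1,4) by (rule polyfun_mult)
  moreover have "\<forall>z\<in>Z \<union> Z'. P z * Q z = 0" using *(3,6) by auto
  ultimately show ?thesis unfolding thin_def by (intro bexI[of _ "\<lambda>z. P z * Q z"] conjI)
qed

lemma thin_UN:
  fixes Z :: "'i \<Rightarrow> ('m \<Rightarrow> 'a::alg_closed_field) set"
  assumes "finite I" "\<And>i. i \<in> I \<Longrightarrow> thin M (Z i)" shows "thin M (\<Union>i\<in>I. Z i)"
  using assms by (induction I rule: finite_induct) (auto intro: thin_empty thin_Un)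

definition pmono :: "'v set \<Rightarrow> ('v \<Rightarrow> nat) \<Rightarrow> ('v \<Rightarrow> 'a::comm_ring_1) \<Rightarrow> 'a" where
  "pmono V \<alpha> x = (\<Prod>v\<in>V. x v ^ \<alpha> v)"

text \<open>Bounding the exponent of each variable separately makes the dimension of the space a
power, \<open>(D + 1)^|V|\<close>.\<close>

definition boxpoly :: "'v set \<Rightarrow> nat \<Rightarrow> (('v \<Rightarrow> 'a::comm_ring_1) \<Rightarrow> 'a) set" where
  "boxpoly V D = {\<lambda>x. \<Sum>\<alpha>\<in>Pi\<^sub>E V (\<lambda>_. {..D}). c \<alpha> * pmono V \<alpha> x | c. True}"

lemma pmono_cong: "(\<And>v. v \<in> V \<Longrightarrow> \<alpha> v = \<beta> v) \<Longrightarrow> pmono V \<alpha> x = pmono V \<beta> x"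
  unfolding pmono_def by (rule prod.cong) auto

lemma boxpoly_sum:
  fixes c :: "'i \<Rightarrow> 'a::comm_ring_1" and \<alpha> :: "'i \<Rightarrow> 'v \<Rightarrow> nat"
  assumes "finite V" "finite I" "\<And>i v. i \<in> I \<Longrightarrow> v \<in> V \<Longrightarrow> \<alpha> i v \<le> D"
  shows "(\<lambda>x. \<Sum>i\<in>I. c i * pmono V (\<alpha> i) x) \<in> boxpoly V D"
proof -
  let ?B = "Pi\<^sub>E V (\<lambda>_. {..D})"
  let ?r = "\<lambda>i. restrict (\<alpha> i) V"
  have fin: "finite ?B" using assms by (intro finite_PiE) auto
  have r: "?r i \<in> ?B" if "i \<in> I" for i using assms(3)[OF that] by auto
  have "(\<Sum>i\<in>I. c i * pmono V (\<alpha> i) x) = (\<Sum>\<beta>\<in>?B. (\<Sum>i\<in>{i\<in>I. ?r i = \<beta>}. c i) * pmono V \<beta> x)" for x :: "'v \<Rightarrow> 'a"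
  proof -
    have "(\<Sum>i\<in>I. c i * pmono V (\<alpha> i) x) = (\<Sum>i\<in>I. c i * pmono V (?r i) x)"
      by (intro sum.cong refl arg_cong2[of _ _ _ _ "(*)"] pmono_cong) auto
    also have "\<dots> = (\<Sum>\<beta>\<in>?B. \<Sum>i\<in>{i\<in>I. ?r i = \<beta>}. c i * pmono V (?r i) x)"
      by (rule sum.group[OF assms(2) fin, symmetric]) (use r in blast)
    also have "\<dots> = (\<Sum>\<beta>\<in>?B. (\<Sum>i\<in>{i\<in>I. ?r i = \<beta>}. c i) * pmono V \<beta> x)"
      by (intro sum.cong refl) (auto simp: sum_distrib_right)
    finally show ?thesis .
  qed
  thus ?thesis unfolding boxpoly_def
    by (intro CollectI exI[of _ "\<lambda>\<beta>. \<Sum>i\<in>{i\<in>I. ?r i = \<beta>}. c i"] conjI ext) simp_all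
qed

lemma boxpoly_add:
  assumes "f \<in> boxpoly V D" "g \<in> boxpoly V D"
  shows "(\<lambda>x. f x + g x) \<in> boxpoly V D"
proof -
  obtain c c' where "f = (\<lambda>x. \<Sum>\<alpha>\<in>Pi\<^sub>E V (\<lambda>_. {..D}). c \<alpha> * pmono V \<alpha> x)"
    "g = (\<lambda>x. \<Sum>\<alpha>\<in>Pi\<^sub>E V (\<lambda>_. {..D}). c' \<alpha> * pmono V \<alpha> x)"
    using assms unfolding boxpoly_def by blast
  hence "(\<lambda>x. f x + g x) = (\<lambda>x. \<Sum>\<alpha>\<in>Pi\<^sub>E V (\<lambda>_. {..D}). (c \<alpha> + c' \<alpha>) * pmono V \<alpha> x)"
    by (auto simp: sum.distrib distrib_right)
  thus ?thesis unfolding boxpoly_def by (auto intro!: exI[of _ "\<lambda>\<alpha>. c \<alpha> + c' \<alpha>"])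
qed

lemma boxpoly_mult:
  assumes "finite V" "f \<in> boxpoly V D" "g \<in> boxpoly V E"
  shows "(\<lambda>x. f x * g x) \<in> boxpoly V (D + E)"
proof -
  let ?A = "Pi\<^sub>E V (\<lambda>_. {..D})" and ?B = "Pi\<^sub>E V (\<lambda>_. {..E})"
  obtain c c' where fg: "f = (\<lambda>x. \<Sum>\<alpha>\<in>?A. c \<alpha> * pmono V \<alpha> x)"
    "g = (\<lambda>x. \<Sum>\<alpha>\<in>?B. c' \<alpha> * pmono V \<alpha> x)"
    using assms unfolding boxpoly_def by blast
  have "(\<lambda>x. f x * g x) = (\<lambda>x. \<Sum>i\<in>?A\<times>?B. (c (fst i) * c' (snd i)) * pmono V (\<lambda>v. fst i v + snd i v) x)"
    unfolding fg sum_product sum.cartesian_product pmono_def power_add prod.distrib case_prod_unfold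
    by (simp add: mult_ac)
  moreover have "\<dots> \<in> boxpoly V (D + E)"
    using assms(1) by (intro boxpoly_sum) (auto intro!: finite_PiE add_mono)
  ultimately show ?thesis by simp
qed

lemma boxpoly_mono:
  assumes "finite V" "f \<in> boxpoly V D" "D \<le> E" shows "f \<in> boxpoly V E"
proof -
  obtain c where "f = (\<lambda>x. \<Sum>\<alpha>\<in>Pi\<^sub>E V (\<lambda>_. {..D}). c \<alpha> * pmono V \<alpha> x)"
    using assms unfolding boxpoly_def by blast
  moreover have "\<dots> \<in> boxpoly V E"
    using assms by (intro boxpoly_sum) (auto intro!: finite_PiE order_trans[OF _ assms(3)])
  ultimately show ?thesis by simp
qed

lemma boxpoly_const: assumes "finite V" shows "(\<lambda>_. a) \<in> boxpoly V D"
proof -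
  have "(\<lambda>x. \<Sum>i\<in>{()}. a * pmono V (\<lambda>_. 0) x) \<in> boxpoly V D"
    using assms by (intro boxpoly_sum) auto
  thus ?thesis by (simp add: pmono_def)
qed

lemma polyfun_boxpoly:
  assumes "finite V" "f \<in> polyfun V" shows "\<exists>D. f \<in> boxpoly V D"
  using assms(2)
proof induction
  case (polyfun_const a)
  show ?case using boxpoly_const[OF assms(1)] by blast
next
  case (polyfun_var v)
  have "(\<lambda>x::'a \<Rightarrow> 'b. \<Sum>i\<in>{()}. 1 * pmono V (\<lambda>w. if w = v then 1 else 0) x) \<in> boxpoly V 1"
    using assms(1) by (intro boxpoly_sum) auto
  moreover have "pmono V (\<lambda>w. if w = v then 1 else 0) x = x v" for x :: "'a \<Rightarrow> 'b"
    unfolding pmono_def using assms(1) polyfun_var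
    by (simp add: if_distrib[of "\<lambda>k. _ ^ k"] prod.delta cong: if_cong)
  hence "pmono V (\<lambda>w. if w = v then 1 else 0) = (\<lambda>x::'a \<Rightarrow> 'b. x v)" by (intro ext)
  ultimately have "(\<lambda>x::'a \<Rightarrow> 'b. x v) \<in> boxpoly V 1" by simp
  thus ?case by blast
next
  case (polyfun_add f g)
  then obtain D E where "f \<in> boxpoly V D" "g \<in> boxpoly V E" by blast
  hence "f \<in> boxpoly V (max D E)" "g \<in> boxpoly V (max D E)"
    using boxpoly_mono[OF assms(1)] by (meson max.cobounded1 max.cobounded2)+
  thus ?case using boxpoly_add by blast
next
  case (polyfun_mult f g)
  thus ?case using boxpoly_mult[OF assms(1)] by blast
qed

lemma boxpoly_prod:
  assumes "finite V" "finite I" "\<And>i. i \<in> I \<Longrightarrow> f i \<in> boxpoly V (D i)"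
  shows "(\<lambda>x. \<Prod>i\<in>I. f i x) \<in> boxpoly V (\<Sum>i\<in>I. D i)"
  using assms(2,3)
  by (induction I rule: finite_induct) (auto intro: boxpoly_const[OF assms(1)] boxpoly_mult[OF assms(1)])

lemma boxpoly_power:
  assumes "finite V" "f \<in> boxpoly V D" shows "(\<lambda>x. f x ^ k) \<in> boxpoly V (k * D)"
  using boxpoly_prod[OF assms(1), of "{..<k}" "\<lambda>_. f" "\<lambda>_. D"] assms(2) by simp

lemma polyfun_pmono: "pmono V \<alpha> \<in> polyfun V"
  unfolding pmono_def[abs_def] by (intro fun_alg_intros) (auto intro: polyfun_var)

lemma linear_relation:
  fixes f :: "'i \<Rightarrow> 'j \<Rightarrow> 'a::field"
  assumes "finite I" "finite J" "card J < card I"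
  shows "\<exists>c. (\<exists>i\<in>I. c i \<noteq> 0) \<and> (\<forall>j\<in>J. (\<Sum>i\<in>I. c i * f i j) = 0)"
  using assms(2,1,3)
proof (induction J arbitrary: I f rule: finite_induct)
  case empty
  then obtain i where "i \<in> I" by fastforce
  thus ?case by (intro exI[of _ "\<lambda>_. 1"]) auto
next
  case (insert j J)
  show ?case
  proof (cases "\<forall>i\<in>I. f i j = 0")
    case True
    obtain c where "\<exists>i\<in>I. c i \<noteq> 0" "\<forall>j\<in>J. (\<Sum>i\<in>I. c i * f i j) = 0"
      using insert.IH[of I f] insert.prems insert.hyps by auto
    thus ?thesis using True by (intro exI[of _ c]) auto
  next
    case False
    then obtain p where p: "p \<in> I" "f p j \<noteq> 0" by blast
    define g where "g i k = f i k - f i j / f p j * f p k" for i k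
    obtain c where c: "\<exists>i\<in>I - {p}. c i \<noteq> 0" "\<forall>k\<in>J. (\<Sum>i\<in>I - {p}. c i * g i k) = 0"
    proof -
      have "card J < card (I - {p})" "finite (I - {p})"
        using insert.prems insert.hyps p by (auto simp: card_Diff_singleton)
      from insert.IH[OF this(2,1), of g] show ?thesis using that by blast
    qed
    define c' where "c' i = (if i = p then - (\<Sum>i\<in>I-{p}. c i * f i j / f p j) else c i)" for i
    have eq: "(\<Sum>i\<in>I. c' i * f i k) = (\<Sum>i\<in>I-{p}. c i * g i k)" for k
    proof -
      have "(\<Sum>i\<in>I. c' i * f i k) = c' p * f p k + (\<Sum>i\<in>I-{p}. c' i * f i k)"
        using p insert.prems by (simp add: sum.remove)
      also have "(\<Sum>i\<in>I-{p}. c' i * f i k) = (\<Sum>i\<in>I-{p}. c i * f i k)"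
        by (intro sum.cong) (auto simp: c'_def)
      also have "c' p * f p k = - (\<Sum>i\<in>I-{p}. c i * (f i j / f p j * f p k))"
        by (simp add: c'_def sum_distrib_right mult.assoc)
      finally show ?thesis by (simp add: g_def sum_subtractf algebra_simps)
    qed
    have "(\<Sum>i\<in>I. c' i * f i j) = 0" unfolding eq g_def using p by simp
    hence "\<forall>k\<in>insert j J. (\<Sum>i\<in>I. c' i * f i k) = 0" using c(2) eq by auto
    moreover have "\<exists>i\<in>I. c' i \<noteq> 0" using c(1) by (auto simp: c'_def)
    ultimately show ?thesis by blast
  qed
qed

text \<open>Induction on the number of variables: as a polynomial in the last variable the sum
vanishes identically, so each of its coefficients, a sum of the same kind in fewer variables,
vanishes.\<close>

lemma pmono_relation_trivial:
  fixes c :: "('v \<Rightarrow> nat) \<Rightarrow> 'a::alg_closed_field"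
  assumes "finite V" "\<And>x. (\<Sum>\<alpha>\<in>Pi\<^sub>E V (\<lambda>_. {..k}). c \<alpha> * pmono V \<alpha> x) = 0"
    "\<alpha> \<in> Pi\<^sub>E V (\<lambda>_. {..k})"
  shows "c \<alpha> = 0"
  using assms
proof (induction V arbitrary: c \<alpha> rule: finite_induct)
  case empty
  thus ?case by (simp add: pmono_def)
next
  case (insert v V)
  let ?B = "Pi\<^sub>E V (\<lambda>_. {..k})"
  have fin: "finite ?B" using insert by (intro finite_PiE) auto
  have inj: "inj_on (\<lambda>(y, g). g(v := y)) ({..k} \<times> ?B)"
    by (rule inj_combinator[OF insert.hyps(2)])
  have expand: "(\<Sum>j\<le>k. (\<Sum>\<beta>\<in>?B. c (\<beta>(v := j)) * pmono V \<beta> x) * t ^ j) = 0" for x t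
  proof -
    have "0 = (\<Sum>\<alpha>\<in>Pi\<^sub>E (insert v V) (\<lambda>_. {..k}). c \<alpha> * pmono (insert v V) \<alpha> (x(v := t)))"
      using insert.prems(1) by metis
    also have "\<dots> = (\<Sum>(j,\<beta>)\<in>{..k} \<times> ?B. c (\<beta>(v := j)) * pmono (insert v V) (\<beta>(v := j)) (x(v := t)))"
      unfolding PiE_insert_eq by (subst sum.reindex[OF inj]) (auto simp: case_prod_unfold intro: sum.cong)
    also have "\<dots> = (\<Sum>(j,\<beta>)\<in>{..k} \<times> ?B. c (\<beta>(v := j)) * pmono V \<beta> x * t ^ j)"
    proof (intro sum.cong refl, clarify)
      fix j \<beta>
      have "pmono (insert v V) (\<beta>(v := j)) (x(v := t)) = t ^ j * pmono V \<beta> x"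
        unfolding pmono_def using insert.hyps
        by (simp, intro disjI2 prod.cong) auto
      thus "c (\<beta>(v := j)) * pmono (insert v V) (\<beta>(v := j)) (x(v := t)) = c (\<beta>(v := j)) * pmono V \<beta> x * t ^ j"
        by simp
    qed
    also have "\<dots> = (\<Sum>j\<le>k. (\<Sum>\<beta>\<in>?B. c (\<beta>(v := j)) * pmono V \<beta> x) * t ^ j)"
      by (simp add: sum.cartesian_product[symmetric] sum_distrib_right)
    finally show ?thesis by simp
  qed
  have coeff: "(\<Sum>\<beta>\<in>?B. c (\<beta>(v := j)) * pmono V \<beta> x) = 0" if "j \<le> k" for j x
  proof -
    let ?a = "\<lambda>j. \<Sum>\<beta>\<in>?B. c (\<beta>(v := j)) * pmono V \<beta> x"
    let ?p = "\<Sum>j\<le>k. monom (?a j) j"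
    have "poly ?p t = 0" for t using expand[of x t] by (simp add: poly_sum poly_monom)
    hence "?p = 0" using poly_cofinite_zero[of "{}" ?p] by simp
    hence "coeff ?p j = 0" by simp
    thus ?thesis using that by (simp add: coeff_sum)
  qed
  have "c ((restrict \<alpha> V)(v := \<alpha> v)) = 0"
    by (rule insert.IH[of "\<lambda>\<beta>. c (\<beta>(v := \<alpha> v))"]) (use insert.prems coeff in auto)
  moreover have "(restrict \<alpha> V)(v := \<alpha> v) = \<alpha>"
    using insert.prems(2) by (auto simp: fun_eq_iff PiE_def extensional_def)
  ultimately show ?case by simp
qed

lemma power_growth:
  fixes a b C :: nat
  assumes "a < b" shows "\<exists>k. (C * k + 1) ^ a < (k + 1) ^ b"
proof -
  let ?k = "(C + 1) ^ a"
  have "C * ?k + 1 \<le> (C + 1) * (?k + 1)" by (simp add: algebra_simps)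
  hence "(C * ?k + 1) ^ a \<le> ((C + 1) * (?k + 1)) ^ a" by (rule power_mono) simp
  also have "\<dots> = ?k * (?k + 1) ^ a" by (rule power_mult_distrib)
  also have "\<dots> < (?k + 1) * (?k + 1) ^ a" by simp
  also have "\<dots> \<le> (?k + 1) ^ b" using assms power_increasing[of "Suc a" b "?k + 1"] by simp
  finally show ?thesis by blast
qed

text \<open>A set parametrized by fewer parameters than coordinates is not dense. For large
\<open>k\<close> there are more monomials in the coordinates with exponents at most \<open>k\<close>
than monomials in the parameters that can occur after substitution, so a nontrivial linear relation
holds on the image. The common denominator \<open>g\<close> is cleared by homogenizing each
coordinate to degree \<open>k\<close>. This is the only dimension count used below.\<close>

lemma thin_rational_image:
  fixes F :: "('v \<Rightarrow> 'a::alg_closed_field) \<Rightarrow> 'm \<Rightarrow> 'a"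
  assumes V: "finite V" and M: "finite M" and less: "card V < card M"
    and F: "\<And>m. m \<in> M \<Longrightarrow> (\<lambda>x. F x m) \<in> polyfun V" and g: "g \<in> polyfun V"
    and Z: "\<And>z. z \<in> Z \<Longrightarrow> \<exists>x. g x \<noteq> 0 \<and> (\<forall>m\<in>M. g x * z m = F x m)"
  shows "thin M Z"
proof -
  obtain Dg where Dg: "g \<in> boxpoly V Dg" using polyfun_boxpoly[OF V g] by blast
  obtain D0 where D0: "\<And>m. m \<in> M \<Longrightarrow> (\<lambda>x. F x m) \<in> boxpoly V (D0 m)"
  proof -
    have "\<forall>m\<in>M. \<exists>D. (\<lambda>x. F x m) \<in> boxpoly V D" using polyfun_boxpoly[OF V F] by blast
    from bchoice[OF this] show ?thesis using that by blast
  qed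
  define D where "D = Dg + (\<Sum>m\<in>M. D0 m)"
  have gD: "g \<in> boxpoly V D" using boxpoly_mono[OF V Dg] by (simp add: D_def)
  have FD: "(\<lambda>x. F x m) \<in> boxpoly V D" if "m \<in> M" for m
    using boxpoly_mono[OF V D0[OF that], of D] member_le_sum[OF that, of D0] M by (simp add: D_def)
  obtain k where k: "((card M * D) * k + 1) ^ card V < (k + 1) ^ card M"
    using power_growth[OF less] by blast
  let ?I = "Pi\<^sub>E M (\<lambda>_. {..k})"
  let ?E = "card M * D * k"
  let ?J = "Pi\<^sub>E V (\<lambda>_. {..?E})"
  \<comment> \<open>the monomial with exponents \<open>\<beta>\<close> at the point \<open>F/g\<close>, multiplied by \<open>g ^ (k * card M)\<close>\<close>
  define G where "G \<beta> x = (\<Prod>m\<in>M. F x m ^ \<beta> m * g x ^ (k - \<beta> m))" for \<beta> x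
  have "G \<beta> \<in> boxpoly V ?E" if "\<beta> \<in> ?I" for \<beta>
  proof -
    have "(\<lambda>x. F x m ^ \<beta> m * g x ^ (k - \<beta> m)) \<in> boxpoly V (k * D)" if m: "m \<in> M" for m
    proof -
      have "\<beta> m \<le> k" using \<open>\<beta> \<in> ?I\<close> m by (auto simp: PiE_def Pi_def)
      hence "\<beta> m * D + (k - \<beta> m) * D = k * D" by (metis add_mult_distrib le_add_diff_inverse)
      thus ?thesis
        using boxpoly_mult[OF V boxpoly_power[OF V FD[OF m], of "\<beta> m"] boxpoly_power[OF V gD, of "k - \<beta> m"]]
        by simp
    qed
    hence "(\<lambda>x. \<Prod>m\<in>M. F x m ^ \<beta> m * g x ^ (k - \<beta> m)) \<in> boxpoly V (\<Sum>m\<in>M. k * D)"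
      by (intro boxpoly_prod[OF V M]) auto
    thus ?thesis by (simp add: G_def[abs_def] mult_ac)
  qed
  then obtain f where f: "\<And>\<beta>. \<beta> \<in> ?I \<Longrightarrow> G \<beta> = (\<lambda>x. \<Sum>\<alpha>\<in>?J. f \<beta> \<alpha> * pmono V \<alpha> x)"
  proof -
    have "\<forall>\<beta>\<in>?I. \<exists>c. G \<beta> = (\<lambda>x. \<Sum>\<alpha>\<in>?J. c \<alpha> * pmono V \<alpha> x)"
      using \<open>\<And>\<beta>. \<beta> \<in> ?I \<Longrightarrow> G \<beta> \<in> boxpoly V ?E\<close> unfolding boxpoly_def by blast
    from bchoice[OF this] show ?thesis using that by blast
  qed
  have fin: "finite ?I" "finite ?J" using V M by (auto intro: finite_PiE)
  have "card ?J < card ?I" using k V M by (simp add: card_PiE)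
  from linear_relation[OF fin this, of f] obtain c where
    c: "\<exists>\<beta>\<in>?I. c \<beta> \<noteq> 0" "\<forall>\<alpha>\<in>?J. (\<Sum>\<beta>\<in>?I. c \<beta> * f \<beta> \<alpha>) = 0" by blast
  have rel: "(\<Sum>\<beta>\<in>?I. c \<beta> * G \<beta> x) = 0" for x
  proof -
    have "(\<Sum>\<beta>\<in>?I. c \<beta> * G \<beta> x) = (\<Sum>\<beta>\<in>?I. \<Sum>\<alpha>\<in>?J. c \<beta> * f \<beta> \<alpha> * pmono V \<alpha> x)"
      by (intro sum.cong) (auto simp: f sum_distrib_left mult.assoc)
    also have "\<dots> = (\<Sum>\<alpha>\<in>?J. (\<Sum>\<beta>\<in>?I. c \<beta> * f \<beta> \<alpha>) * pmono V \<alpha> x)"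
      by (subst sum.swap) (simp add: sum_distrib_right)
    also have "\<dots> = 0" using c(2) by simp
    finally show ?thesis .
  qed
  define P where "P z = (\<Sum>\<beta>\<in>?I. c \<beta> * pmono M \<beta> z)" for z
  have "P \<in> polyfun M" unfolding P_def[abs_def]
    by (intro fun_alg_intros polyfun_pmono) (auto intro: polyfun_const)
  moreover have "\<exists>z. P z \<noteq> 0"
    using pmono_relation_trivial[OF M, of c k] c(1) unfolding P_def by blast
  moreover have "P z = 0" if zZ: "z \<in> Z" for z
  proof -
    obtain x where x: "g x \<noteq> 0" "\<forall>m\<in>M. g x * z m = F x m" using Z[OF zZ] by blast
    have "c \<beta> * G \<beta> x = g x ^ (k * card M) * (c \<beta> * pmono M \<beta> z)" if "\<beta> \<in> ?I" for \<beta>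
    proof -
      have "G \<beta> x = (\<Prod>m\<in>M. g x ^ k * z m ^ \<beta> m)"
        unfolding G_def
      proof (intro prod.cong refl)
        fix m assume m: "m \<in> M"
        hence "\<beta> m \<le> k" using \<open>\<beta> \<in> ?I\<close> by (auto simp: PiE_def Pi_def)
        hence "g x ^ \<beta> m * g x ^ (k - \<beta> m) = g x ^ k" by (metis le_add_diff_inverse power_add)
        thus "F x m ^ \<beta> m * g x ^ (k - \<beta> m) = g x ^ k * z m ^ \<beta> m"
        proof -
          have "F x m = g x * z m" using x(2) m by simp
          hence "F x m ^ \<beta> m * g x ^ (k - \<beta> m) = (g x ^ \<beta> m * g x ^ (k - \<beta> m)) * z m ^ \<beta> m"
            by (simp add: power_mult_distrib mult_ac)
          thus ?thesis using \<open>g x ^ \<beta> m * g x ^ (k - \<beta> m) = g x ^ k\<close> by simp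
        qed
      qed
      thus ?thesis by (simp add: prod.distrib pmono_def power_mult)
    qed
    hence "g x ^ (k * card M) * P z = (\<Sum>\<beta>\<in>?I. c \<beta> * G \<beta> x)"
      unfolding P_def sum_distrib_left by (intro sum.cong refl) (simp only:)
    thus ?thesis using rel[of x] x(1) by simp
  qed
  ultimately show ?thesis unfolding thin_def by blast
qed

section \<open>Fraction-free elimination\<close>

text \<open>The linear system with rows \<open>J\<close> and unknowns \<open>F m\<close> is solved
for the pivots \<open>P\<close>, with the denominator \<open>g\<close> left in place. The solved
form is required at every point \<open>x\<close>, also where \<open>g x = 0\<close>; this keeps the
induction free of case distinctions.\<close>

definition eliminates :: "('x \<Rightarrow> 'a::field) set \<Rightarrow> 'j set \<Rightarrow> 'm set \<Rightarrow> ('j \<Rightarrow> 'm \<Rightarrow> 'x \<Rightarrow> 'a)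
    \<Rightarrow> 'm set \<Rightarrow> ('x \<Rightarrow> 'a) \<Rightarrow> ('m \<Rightarrow> 'm \<Rightarrow> 'x \<Rightarrow> 'a) \<Rightarrow> bool" where
  "eliminates R J M a P g p \<longleftrightarrow> P \<subseteq> M \<and> card P = card J \<and> g \<in> R \<and>
     (\<forall>\<mu>\<in>P. \<forall>\<nu>\<in>M - P. p \<mu> \<nu> \<in> R) \<and>
     (\<forall>x F. (\<forall>j\<in>J. (\<Sum>m\<in>M. a j m x * F m) = 0) \<longrightarrow>
        (\<forall>\<mu>\<in>P. g x * F \<mu> = (\<Sum>\<nu>\<in>M - P. p \<mu> \<nu> x * F \<nu>)))"

definition rows_independent :: "'j set \<Rightarrow> 'm set \<Rightarrow> ('j \<Rightarrow> 'm \<Rightarrow> 'a::field) \<Rightarrow> bool" where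
  "rows_independent J M a \<longleftrightarrow>
     (\<forall>c. (\<forall>m\<in>M. (\<Sum>j\<in>J. c j * a j m) = 0) \<longrightarrow> (\<forall>j\<in>J. c j = 0))"

text \<open>One step of elimination with the pivot in row \<open>j\<close> and column
\<open>m0\<close>: the other rows are replaced by the two-by-two minors, which stay in the algebra,
and the solution is substituted back into row \<open>j\<close>.\<close>

lemma eliminates_step:
  fixes a :: "'j \<Rightarrow> 'm \<Rightarrow> 'x \<Rightarrow> 'a::field"
  assumes R: "fun_alg R" and fin: "finite J" "finite M" and j: "j \<notin> J" and m0: "m0 \<in> M"
    and a: "\<And>k m. k \<in> insert j J \<Longrightarrow> m \<in> M \<Longrightarrow> a k m \<in> R"
    and el: "eliminates R J (M - {m0}) (\<lambda>k m x. a j m0 x * a k m x - a k m0 x * a j m x) P g p"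
  shows "eliminates R (insert j J) M a (insert m0 P) (\<lambda>x. g x * a j m0 x)
    (\<lambda>\<mu> \<nu>. if \<mu> = m0 then (\<lambda>x. - (g x * a j \<nu> x) - (\<Sum>\<kappa>\<in>P. a j \<kappa> x * p \<kappa> \<nu> x))
           else (\<lambda>x. a j m0 x * p \<mu> \<nu> x))"
proof -
  let ?N = "M - insert m0 P"
  from el have P: "P \<subseteq> M - {m0}" "card P = card J" "g \<in> R" "\<forall>\<mu>\<in>P. \<forall>\<nu>\<in>M - {m0} - P. p \<mu> \<nu> \<in> R"
    and sol: "\<And>x F. (\<forall>k\<in>J. (\<Sum>m\<in>M - {m0}. (a j m0 x * a k m x - a k m0 x * a j m x) * F m) = 0) \<Longrightarrow>
      (\<forall>\<mu>\<in>P. g x * F \<mu> = (\<Sum>\<nu>\<in>M - {m0} - P. p \<mu> \<nu> x * F \<nu>))"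
    unfolding eliminates_def by blast+
  have N: "M - {m0} - P = ?N" by auto
  have finP: "finite P" using P(1) fin finite_subset by blast
  have m0P: "m0 \<notin> P" using P(1) by auto
  have split: "(\<Sum>m\<in>M - {m0}. h m) = (\<Sum>\<nu>\<in>?N. h \<nu>) + (\<Sum>\<kappa>\<in>P. h \<kappa>)" for h :: "'m \<Rightarrow> 'a"
    using sum.subset_diff[OF P(1), of h] fin N by simp
  have "card (insert m0 P) = card (insert j J)" using P(2) m0P finP fin j by simp
  moreover have "(\<lambda>x. g x * a j m0 x) \<in> R" using R P(3) a m0 by (intro fun_alg_intros) auto
  moreover have "(if \<mu> = m0 then (\<lambda>x. - (g x * a j \<nu> x) - (\<Sum>\<kappa>\<in>P. a j \<kappa> x * p \<kappa> \<nu> x))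
           else (\<lambda>x. a j m0 x * p \<mu> \<nu> x)) \<in> R" if "\<mu> \<in> insert m0 P" "\<nu> \<in> ?N" for \<mu> \<nu>
  proof -
    have "(\<lambda>x. - (g x * a j \<nu> x) - (\<Sum>\<kappa>\<in>P. a j \<kappa> x * p \<kappa> \<nu> x)) \<in> R"
      using R P a that by (intro fun_alg_intros) auto
    moreover have "(\<lambda>x. a j m0 x * p \<mu> \<nu> x) \<in> R" if "\<mu> \<noteq> m0"
      using R P a \<open>\<mu> \<in> insert m0 P\<close> \<open>\<nu> \<in> ?N\<close> m0 that by (intro fun_alg_intros) auto
    ultimately show ?thesis by auto
  qed
  moreover have "g x * a j m0 x * F \<mu> = (\<Sum>\<nu>\<in>?N. (if \<mu> = m0 then (\<lambda>x. - (g x * a j \<nu> x) - (\<Sum>\<kappa>\<in>P. a j \<kappa> x * p \<kappa> \<nu> x))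
           else (\<lambda>x. a j m0 x * p \<mu> \<nu> x)) x * F \<nu>)"
    if F: "\<forall>k\<in>insert j J. (\<Sum>m\<in>M. a k m x * F m) = 0" and \<mu>: "\<mu> \<in> insert m0 P" for x F \<mu>
  proof -
    have Fm0: "(\<Sum>m\<in>M - {m0}. a k m x * F m) = - (a k m0 x * F m0)" if "k \<in> insert j J" for k
    proof -
      have "(\<Sum>m\<in>M. a k m x * F m) = a k m0 x * F m0 + (\<Sum>m\<in>M - {m0}. a k m x * F m)"
        by (rule sum.remove) (use fin m0 in auto)
      moreover have "(\<Sum>m\<in>M. a k m x * F m) = 0" using F that by blast
      ultimately show ?thesis by (simp add: eq_neg_iff_add_eq_0 add.commute)
    qed
    have "(\<Sum>m\<in>M - {m0}. (a j m0 x * a k m x - a k m0 x * a j m x) * F m) = 0" if "k \<in> J" for k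
    proof -
      have "(\<Sum>m\<in>M - {m0}. (a j m0 x * a k m x - a k m0 x * a j m x) * F m)
        = a j m0 x * (\<Sum>m\<in>M - {m0}. a k m x * F m) - a k m0 x * (\<Sum>m\<in>M - {m0}. a j m x * F m)"
        by (simp add: sum_distrib_left sum_subtractf[symmetric] left_diff_distrib mult.assoc)
      thus ?thesis using Fm0 that by simp
    qed
    hence gF: "\<forall>\<mu>\<in>P. g x * F \<mu> = (\<Sum>\<nu>\<in>?N. p \<mu> \<nu> x * F \<nu>)" using sol N by simp
    show ?thesis
    proof (cases "\<mu> = m0")
      case False
      hence "g x * F \<mu> = (\<Sum>\<nu>\<in>?N. p \<mu> \<nu> x * F \<nu>)" using gF \<mu> by auto
      hence "a j m0 x * (g x * F \<mu>) = (\<Sum>\<nu>\<in>?N. a j m0 x * (p \<mu> \<nu> x * F \<nu>))" by (simp add: sum_distrib_left)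
      thus ?thesis using False by (simp add: mult_ac)
    next
      case True
      have "g x * a j m0 x * F m0 = - (g x * (\<Sum>m\<in>M - {m0}. a j m x * F m))" using Fm0 by simp
      also have "\<dots> = - (\<Sum>\<nu>\<in>?N. g x * a j \<nu> x * F \<nu>) - (\<Sum>\<kappa>\<in>P. a j \<kappa> x * (g x * F \<kappa>))"
        unfolding split by (simp add: sum_distrib_left distrib_left mult_ac)
      also have "(\<Sum>\<kappa>\<in>P. a j \<kappa> x * (g x * F \<kappa>)) = (\<Sum>\<kappa>\<in>P. \<Sum>\<nu>\<in>?N. a j \<kappa> x * p \<kappa> \<nu> x * F \<nu>)"
        using gF by (intro sum.cong refl) (simp add: sum_distrib_left mult.assoc)
      also have "\<dots> = (\<Sum>\<nu>\<in>?N. (\<Sum>\<kappa>\<in>P. a j \<kappa> x * p \<kappa> \<nu> x) * F \<nu>)"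
        by (subst sum.swap) (simp add: sum_distrib_right)
      finally show ?thesis using True
        by (simp add: sum_subtractf sum_negf left_diff_distrib)
    qed
  qed
  ultimately show ?thesis using P(1) m0 unfolding eliminates_def by auto
qed

text \<open>Which pivots work depends on the point, but there are only finitely many choices of the
columns. Hence a family of linear systems splits into finitely many pieces on each of which the
solution is a rational function of the parameters.\<close>

lemma elimination:
  fixes a :: "'j \<Rightarrow> 'm \<Rightarrow> 'x \<Rightarrow> 'a::field"
  assumes "fun_alg R" "finite J" "finite M" "\<And>j m. j \<in> J \<Longrightarrow> m \<in> M \<Longrightarrow> a j m \<in> R"
  shows "\<exists>C. finite C \<and> (\<forall>(P, g, p)\<in>C. eliminates R J M a P g p) \<and>
    (\<forall>x. rows_independent J M (\<lambda>j m. a j m x) \<longrightarrow> (\<exists>(P, g, p)\<in>C. g x \<noteq> 0))"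
  using assms(2,3,4)
proof (induction J arbitrary: M a rule: finite_induct)
  case empty
  show ?case
    by (intro exI[of _ "{({}, \<lambda>_. 1, \<lambda>_ _ _. 0)}"])
      (auto simp: eliminates_def intro: fun_alg_const[OF assms(1)])
next
  case (insert j J)
  let ?a = "\<lambda>m0 k m x. a j m0 x * a k m x - a k m0 x * a j m x"
  have "\<forall>m0\<in>M. \<exists>C. finite C \<and> (\<forall>(P, g, p)\<in>C. eliminates R J (M - {m0}) (?a m0) P g p) \<and>
    (\<forall>x. rows_independent J (M - {m0}) (\<lambda>k m. ?a m0 k m x) \<longrightarrow> (\<exists>(P, g, p)\<in>C. g x \<noteq> 0))"
  proof
    fix m0 assume "m0 \<in> M"
    thus "\<exists>C. finite C \<and> (\<forall>(P, g, p)\<in>C. eliminates R J (M - {m0}) (?a m0) P g p) \<and>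
      (\<forall>x. rows_independent J (M - {m0}) (\<lambda>k m. ?a m0 k m x) \<longrightarrow> (\<exists>(P, g, p)\<in>C. g x \<noteq> 0))"
      using insert.prems by (intro insert.IH fun_alg_intros assms(1)) auto
  qed
  from bchoice[OF this] obtain C where C: "\<forall>m0\<in>M. finite (C m0) \<and>
    (\<forall>(P, g, p)\<in>C m0. eliminates R J (M - {m0}) (?a m0) P g p) \<and>
    (\<forall>x. rows_independent J (M - {m0}) (\<lambda>k m. ?a m0 k m x) \<longrightarrow> (\<exists>(P, g, p)\<in>C m0. g x \<noteq> 0))" by blast
  define f where "f m0 = (\<lambda>(P, g, p). (insert m0 P, \<lambda>x. g x * a j m0 x,
     (\<lambda>\<mu> \<nu>. if \<mu> = m0 then (\<lambda>x. - (g x * a j \<nu> x) - (\<Sum>\<kappa>\<in>P. a j \<kappa> x * p \<kappa> \<nu> x))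
           else (\<lambda>x. a j m0 x * p \<mu> \<nu> x))))" for m0
  define D where "D = (\<Union>m0\<in>M. f m0 ` C m0)"
  have "finite D" unfolding D_def using C insert.prems by auto
  moreover have "\<forall>(P, g, p)\<in>D. eliminates R (insert j J) M a P g p"
  proof (clarify)
    fix P g p assume "(P, g, p) \<in> D"
    then obtain m0 P' g' p' where m0: "m0 \<in> M" "(P', g', p') \<in> C m0" "(P, g, p) = f m0 (P', g', p')"
      unfolding D_def by auto
    have "eliminates R J (M - {m0}) (?a m0) P' g' p'" using C m0 by blast
    from eliminates_step[OF assms(1) insert.hyps(1) insert.prems(1) insert.hyps(2) m0(1) insert.prems(2) this]
    show "eliminates R (insert j J) M a P g p" using m0(3) by (simp add: f_def)
  qed
  moreover have "\<exists>(P, g, p)\<in>D. g x \<noteq> 0" if ind: "rows_independent (insert j J) M (\<lambda>j m. a j m x)" for x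
  proof -
    have "\<exists>m0\<in>M. a j m0 x \<noteq> 0"
    proof (rule ccontr)
      assume "\<not> ?thesis"
      hence "\<forall>m\<in>M. (\<Sum>k\<in>insert j J. (if k = j then 1 else 0) * a k m x) = 0"
        using insert.hyps by (auto intro!: sum.neutral)
      thus False using ind unfolding rows_independent_def by force
    qed
    then obtain m0 where m0: "m0 \<in> M" "a j m0 x \<noteq> 0" by blast
    have "rows_independent J (M - {m0}) (\<lambda>k m. ?a m0 k m x)"
      unfolding rows_independent_def
    proof (intro allI impI ballI)
      fix c k assume c: "\<forall>m\<in>M - {m0}. (\<Sum>k\<in>J. c k * ?a m0 k m x) = 0" and k: "k \<in> J"
      define c' where "c' i = (if i = j then - (\<Sum>k\<in>J. c k * a k m0 x) else c i * a j m0 x)" for i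
      have "(\<Sum>i\<in>insert j J. c' i * a i m x) = (\<Sum>k\<in>J. c k * ?a m0 k m x)" for m
      proof -
        have "(\<Sum>i\<in>insert j J. c' i * a i m x) = c' j * a j m x + (\<Sum>i\<in>J. c' i * a i m x)"
          using insert.hyps by simp
        also have "(\<Sum>i\<in>J. c' i * a i m x) = (\<Sum>i\<in>J. c i * a j m0 x * a i m x)"
          using insert.hyps by (intro sum.cong) (auto simp: c'_def)
        also have "c' j * a j m x = - (\<Sum>i\<in>J. c i * a i m0 x * a j m x)" by (simp add: c'_def sum_distrib_right)
        finally show ?thesis by (simp add: right_diff_distrib sum_subtractf mult_ac)
      qed
      moreover have "(\<Sum>k\<in>J. c k * ?a m0 k m x) = 0" if "m \<in> M" for m
        using c that by (cases "m = m0") auto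
      ultimately have "\<forall>i\<in>insert j J. c' i = 0" using ind unfolding rows_independent_def by simp
      thus "c k = 0" using k m0 insert.hyps by (auto simp: c'_def split: if_splits)
    qed
    then obtain P g p where "(P, g, p) \<in> C m0" "g x \<noteq> 0" using C m0 by blast
    hence "f m0 (P, g, p) \<in> D" unfolding D_def using m0 by blast
    moreover have "case f m0 (P, g, p) of (P, g, p) \<Rightarrow> g x \<noteq> 0"
      using \<open>g x \<noteq> 0\<close> m0 by (simp add: f_def)
    ultimately show ?thesis by (rule bexI[rotated])
  qed
  ultimately show ?case by blast
qed

section \<open>Extending homomorphisms to an algebraically closed field\<close>

definition subring_on :: "'r::idom set \<Rightarrow> bool" where
  "subring_on A \<longleftrightarrow> 1 \<in> A \<and> (\<forall>x\<in>A. \<forall>y\<in>A. x - y \<in> A \<and> x * y \<in> A)"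

definition hom_on :: "'r::idom set \<Rightarrow> ('r \<Rightarrow> 'k::field) \<Rightarrow> bool" where
  "hom_on A \<phi> \<longleftrightarrow> \<phi> 1 = 1 \<and> (\<forall>x\<in>A. \<forall>y\<in>A. \<phi> (x + y) = \<phi> x + \<phi> y \<and> \<phi> (x * y) = \<phi> x * \<phi> y)"

definition adjoin :: "'r::idom set \<Rightarrow> 'r \<Rightarrow> 'r set" where
  "adjoin A b = {poly p b | p. \<forall>i. coeff p i \<in> A}"

context
  fixes A :: "'r::idom set"
  assumes A: "subring_on A"
begin

lemma sub1: "1 \<in> A" and sub_diff: "x \<in> A \<Longrightarrow> y \<in> A \<Longrightarrow> x - y \<in> A"
  and sub_mult: "x \<in> A \<Longrightarrow> y \<in> A \<Longrightarrow> x * y \<in> A"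
  using A by (auto simp: subring_on_def)

lemma sub0: "0 \<in> A" using sub_diff[OF sub1 sub1] by simp

lemma sub_minus: "x \<in> A \<Longrightarrow> - x \<in> A" using sub_diff[OF sub0] by fastforce

lemma sub_add: "x \<in> A \<Longrightarrow> y \<in> A \<Longrightarrow> x + y \<in> A" using sub_diff[OF _ sub_minus] by fastforce

lemma sub_sum: "(\<And>i. i \<in> I \<Longrightarrow> f i \<in> A) \<Longrightarrow> sum f I \<in> A"
  by (induction I rule: infinite_finite_induct) (auto intro: sub0 sub_add)

lemma sub_power: "x \<in> A \<Longrightarrow> x ^ k \<in> A" by (induction k) (auto intro: sub1 sub_mult)

definition polys_over :: "'r poly set" where "polys_over = {p. \<forall>i. coeff p i \<in> A}"

lemma po_add: "p \<in> polys_over \<Longrightarrow> q \<in> polys_over \<Longrightarrow> p + q \<in> polys_over"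
  and po_diff: "p \<in> polys_over \<Longrightarrow> q \<in> polys_over \<Longrightarrow> p - q \<in> polys_over"
  and po_mult: "p \<in> polys_over \<Longrightarrow> q \<in> polys_over \<Longrightarrow> p * q \<in> polys_over"
  and po_smult: "a \<in> A \<Longrightarrow> q \<in> polys_over \<Longrightarrow> smult a q \<in> polys_over"
  and po_const: "a \<in> A \<Longrightarrow> [:a:] \<in> polys_over"
  and po_X: "[:0, 1:] \<in> polys_over"
  and po_0: "0 \<in> polys_over"
  by (auto simp: polys_over_def coeff_mult coeff_pCons sub0 sub1 split: nat.splits
      intro!: sub_add sub_diff sub_mult sub_sum)

lemma adjoin_eq: "adjoin A b = (\<lambda>p. poly p b) ` polys_over"
  by (auto simp: adjoin_def polys_over_def)

lemma adjoin_subset: "A \<subseteq> adjoin A b"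
  unfolding adjoin_eq by (auto intro!: image_eqI[of _ _ "[:_:]"] po_const)

lemma adjoin_self: "b \<in> adjoin A b"
  unfolding adjoin_eq by (auto intro!: image_eqI[of _ _ "[:0,1:]"] po_X)

lemma subring_adjoin: "subring_on (adjoin A b)"
  unfolding subring_on_def adjoin_eq
proof (intro conjI ballI)
  show "1 \<in> (\<lambda>p. poly p b) ` polys_over" by (rule image_eqI[of _ _ "[:1:]"]) (auto intro: po_const sub1)
next
  fix x y assume "x \<in> (\<lambda>p. poly p b) ` polys_over" "y \<in> (\<lambda>p. poly p b) ` polys_over"
  then obtain p q where pq: "x = poly p b" "y = poly q b" "p \<in> polys_over" "q \<in> polys_over" by auto
  show "x - y \<in> (\<lambda>p. poly p b) ` polys_over"
    by (rule image_eqI[of _ _ "p - q"]) (auto simp: pq intro: po_diff pq)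
  show "x * y \<in> (\<lambda>p. poly p b) ` polys_over"
    by (rule image_eqI[of _ _ "p * q"]) (auto simp: pq intro: po_mult pq)
qed

text \<open>Division with remainder over a ring, at the cost of a power of the leading
coefficient.\<close>

lemma pseudo_division:
  assumes p: "p \<in> polys_over" "p \<noteq> 0" and w: "w \<in> polys_over"
  shows "\<exists>k s t. s \<in> polys_over \<and> t \<in> polys_over \<and> smult (lead_coeff p ^ k) w = s * p + t \<and>
    (t = 0 \<or> degree t < degree p)"
  using w
proof (induction "degree w" arbitrary: w rule: less_induct)
  case less
  show ?case
  proof (cases "w = 0 \<or> degree w < degree p")
    case True
    thus ?thesis using less.prems by (intro exI[of _ 0] exI[of _ w]) (auto intro: po_0)
  next
    case False
    let ?a = "lead_coeff p"
    define m where "m = monom (lead_coeff w) (degree w - degree p)"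
    have aA: "?a \<in> A" and mp: "m \<in> polys_over" using p less.prems by (auto simp: polys_over_def m_def sub0)
    define w' where "w' = smult ?a w - m * p"
    have w': "w' \<in> polys_over" unfolding w'_def by (intro po_diff po_smult po_mult aA mp p less.prems)
    have deg: "w' = 0 \<or> degree w' < degree w"
    proof (cases "w' = 0")
      case nz: False
      have lw: "lead_coeff w \<noteq> 0" using False by simp
      have dm: "degree (m * p) = degree w"
        using False lw p(2) by (auto simp: m_def degree_mult_eq degree_monom_eq monom_eq_0_iff)
      moreover have "coeff (m * p) (degree w) = lead_coeff w * ?a"
        using lead_coeff_mult[of m p] lw unfolding dm by (simp add: m_def degree_monom_eq)
      moreover have "degree (smult ?a w) = degree w" using p by simp
      ultimately have "degree w' \<le> degree w" "coeff w' (degree w) = 0"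
        unfolding w'_def by (auto intro: degree_diff_le simp: mult.commute)
      thus ?thesis using nz by (metis le_neq_implies_less leading_coeff_0_iff)
    qed simp
    have "\<exists>k s t. s \<in> polys_over \<and> t \<in> polys_over \<and> smult (?a ^ k) w' = s * p + t \<and> (t = 0 \<or> degree t < degree p)"
    proof (cases "w' = 0")
      case True thus ?thesis by (intro exI[of _ 0]) (auto intro: po_0)
    next
      case False thus ?thesis using less.hyps deg w' by blast
    qed
    then obtain k s t where st: "s \<in> polys_over" "t \<in> polys_over" "smult (?a ^ k) w' = s * p + t"
      "t = 0 \<or> degree t < degree p" by blast
    have "smult (?a ^ Suc k) w = (s + smult (?a ^ k) m) * p + t"
    proof -
      have "smult (?a ^ k) (smult ?a w) = smult (?a ^ k) w' + smult (?a ^ k) (m * p)"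
        unfolding w'_def by (simp add: smult_diff_right)
      thus ?thesis using st(3) by (simp add: distrib_left mult.commute)
    qed
    moreover have "s + smult (?a ^ k) m \<in> polys_over" by (intro po_add po_smult st mp sub_power aA)
    ultimately show ?thesis using st by blast
  qed
qed

context
  fixes \<phi> :: "'r \<Rightarrow> 'k::field"
  assumes hom: "hom_on A \<phi>"
begin

lemma h_add: "x \<in> A \<Longrightarrow> y \<in> A \<Longrightarrow> \<phi> (x + y) = \<phi> x + \<phi> y"
  and h_mult: "x \<in> A \<Longrightarrow> y \<in> A \<Longrightarrow> \<phi> (x * y) = \<phi> x * \<phi> y" and h1: "\<phi> 1 = 1"
  using hom by (auto simp: hom_on_def)

lemma h0: "\<phi> 0 = 0" using h_add[OF sub0 sub0] by (metis add.right_neutral add_left_cancel)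

lemma h_sum: "(\<And>i. i \<in> I \<Longrightarrow> f i \<in> A) \<Longrightarrow> \<phi> (sum f I) = (\<Sum>i\<in>I. \<phi> (f i))"
  by (induction I rule: infinite_finite_induct) (auto simp: h0 h_add sub_sum)

lemma h_power: "x \<in> A \<Longrightarrow> \<phi> (x ^ k) = \<phi> x ^ k"
  by (induction k) (auto simp: h1 h_mult sub_power)

lemma mp_add: "p \<in> polys_over \<Longrightarrow> q \<in> polys_over \<Longrightarrow> map_poly \<phi> (p + q) = map_poly \<phi> p + map_poly \<phi> q"
  by (rule poly_eqI) (auto simp: coeff_map_poly h0 polys_over_def h_add)

lemma mp_mult: "p \<in> polys_over \<Longrightarrow> q \<in> polys_over \<Longrightarrow> map_poly \<phi> (p * q) = map_poly \<phi> p * map_poly \<phi> q"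
  by (rule poly_eqI) (auto simp: coeff_map_poly h0 polys_over_def h_mult coeff_mult h_sum sub_mult)

lemma mp_smult: "a \<in> A \<Longrightarrow> q \<in> polys_over \<Longrightarrow> map_poly \<phi> (smult a q) = smult (\<phi> a) (map_poly \<phi> q)"
  by (rule poly_eqI) (auto simp: coeff_map_poly h0 polys_over_def h_mult)

lemma mp_const: "map_poly \<phi> [:a:] = [:\<phi> a:]"
  by (rule poly_eqI) (auto simp: coeff_map_poly h0 coeff_pCons split: nat.splits)

text \<open>The value of \<open>\<psi>\<close> at \<open>poly p b\<close> has to be \<open>poly
(map_poly \<phi> p) \<xi>\<close>; the hypothesis makes this independent of
\<open>p\<close>.\<close>

lemma hom_extend:
  assumes \<xi>: "\<And>p. p \<in> polys_over \<Longrightarrow> poly p b = 0 \<Longrightarrow> poly (map_poly \<phi> p) \<xi> = 0"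
  shows "\<exists>\<psi>. hom_on (adjoin A b) \<psi> \<and> (\<forall>x\<in>A. \<psi> x = \<phi> x) \<and>
    (\<forall>p\<in>polys_over. \<psi> (poly p b) = poly (map_poly \<phi> p) \<xi>)"
proof -
  define \<psi> where "\<psi> y = poly (map_poly \<phi> (SOME p. p \<in> polys_over \<and> poly p b = y)) \<xi>" for y
  have val: "\<psi> (poly p b) = poly (map_poly \<phi> p) \<xi>" if p: "p \<in> polys_over" for p
  proof -
    let ?q = "SOME q. q \<in> polys_over \<and> poly q b = poly p b"
    have q: "?q \<in> polys_over \<and> poly ?q b = poly p b"
      by (rule someI[of "\<lambda>q. q \<in> polys_over \<and> poly q b = poly p b" p]) (use p in auto)
    have "poly (map_poly \<phi> (p - ?q)) \<xi> = 0" using q p by (intro \<xi> po_diff) auto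
    moreover have "map_poly \<phi> p = map_poly \<phi> (p - ?q) + map_poly \<phi> ?q"
      using mp_add[of "p - ?q" ?q] q p po_diff by simp
    ultimately show ?thesis unfolding \<psi>_def by simp
  qed
  have "hom_on (adjoin A b) \<psi>" unfolding hom_on_def adjoin_eq
  proof (intro conjI ballI)
    show "\<psi> 1 = 1" using val[of "[:1:]"] by (simp add: po_const sub1 mp_const h1)
  next
    fix x y assume "x \<in> (\<lambda>p. poly p b) ` polys_over" "y \<in> (\<lambda>p. poly p b) ` polys_over"
    then obtain p q where pq: "x = poly p b" "y = poly q b" "p \<in> polys_over" "q \<in> polys_over" by auto
    show "\<psi> (x + y) = \<psi> x + \<psi> y"
      using val[of "p + q"] val[of p] val[of q] pq by (simp add: po_add mp_add)
    show "\<psi> (x * y) = \<psi> x * \<psi> y"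
      using val[of "p * q"] val[of p] val[of q] pq by (simp add: po_mult mp_mult)
  qed
  moreover have "\<psi> x = \<phi> x" if "x \<in> A" for x using val[of "[:x:]"] that by (simp add: po_const mp_const)
  ultimately show ?thesis using val by blast
qed

end

text \<open>Over the field of fractions the minimal polynomial of \<open>b\<close> is coprime to
\<open>w\<close>, and a Bezout identity gives an inverse of \<open>poly w b\<close>. To stay over
\<open>A\<close>, take an element of least degree among the polynomials whose value at
\<open>b\<close> is a nonzero multiple of \<open>poly w b\<close>: if its degree were positive,
pseudo-division would give a factor of smaller degree of a multiple of the minimal polynomial, still
vanishing at \<open>b\<close>.\<close>

lemma minimal_poly_coprime:
  assumes p: "p \<in> polys_over" "p \<noteq> 0" "poly p b = 0"
    and min: "\<And>q. q \<in> polys_over \<Longrightarrow> q \<noteq> 0 \<Longrightarrow> poly q b = 0 \<Longrightarrow> degree p \<le> degree q"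
    and w: "w \<in> polys_over" "poly w b \<noteq> 0"
  shows "\<exists>s\<in>polys_over. \<exists>u\<in>A. u \<noteq> 0 \<and> u = poly s b * poly w b"
proof -
  \<comment> \<open>the ideal generated by \<open>w\<close> modulo the relations of \<open>b\<close>, without its zero class\<close>
  define E where "E r \<longleftrightarrow> r \<in> polys_over \<and> poly r b \<noteq> 0 \<and> (\<exists>s\<in>polys_over. poly r b = poly s b * poly w b)" for r
  have "E w" unfolding E_def using w by (auto intro!: bexI[of _ "[:1:]"] po_const sub1)
  then obtain r where r: "E r" "\<And>r'. E r' \<Longrightarrow> degree r \<le> degree r'"
    using ex_has_least_nat[of E w degree] by blast
  obtain s where s: "s \<in> polys_over" "poly r b = poly s b * poly w b" using r(1) unfolding E_def by blast
  have rp: "r \<in> polys_over" "r \<noteq> 0" "poly r b \<noteq> 0" using r(1) unfolding E_def by auto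
  have "degree r = 0"
  proof (rule ccontr)
    assume d: "degree r \<noteq> 0"
    have lc: "lead_coeff r \<noteq> 0" using rp by simp
    obtain k q t where qt: "q \<in> polys_over" "t \<in> polys_over" "smult (lead_coeff r ^ k) p = q * r + t"
      "t = 0 \<or> degree t < degree r" using pseudo_division[OF rp(1,2) p(1)] by blast
    have tb: "poly t b = - (poly q b * poly r b)"
      using arg_cong[OF qt(3), of "\<lambda>x. poly x b"] p(3) by (simp add: eq_neg_iff_add_eq_0 add.commute)
    have t0: "poly t b = 0"
    proof (rule ccontr)
      assume nz: "poly t b \<noteq> 0"
      have "poly t b = poly (- (q * s)) b * poly w b" using tb s by simp
      moreover have "- (q * s) \<in> polys_over" using po_diff[OF po_0 po_mult[OF qt(1) s(1)]] by simp
      ultimately have "E t" unfolding E_def using nz qt(2) by blast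
      hence "degree r \<le> degree t" by (rule r(2))
      thus False using qt(4) d nz by auto
    qed
    have degr: "degree r \<le> degree p"
    proof -
      obtain k' q' t' where q': "q' \<in> polys_over" "t' \<in> polys_over" "smult (lead_coeff p ^ k') r = q' * p + t'"
        "t' = 0 \<or> degree t' < degree p" using pseudo_division[OF p(1,2) rp(1)] by blast
      have "poly t' b = lead_coeff p ^ k' * poly r b"
        using arg_cong[OF q'(3), of "\<lambda>x. poly x b"] p(3) by simp
      hence "poly t' b \<noteq> 0" "poly t' b = poly (smult (lead_coeff p ^ k') s) b * poly w b"
        using rp p(2) s by auto
      moreover have "lead_coeff p \<in> A" using p by (auto simp: polys_over_def)
      ultimately have "E t'" unfolding E_def using q'(2) s po_smult sub_power by blast
      hence "degree r \<le> degree t'" by (rule r(2))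
      thus ?thesis using q'(4) \<open>poly t' b \<noteq> 0\<close> by auto
    qed
    have "t = 0"
    proof (rule ccontr)
      assume "t \<noteq> 0"
      hence "degree p \<le> degree t" using min[OF qt(2) _ t0] by blast
      thus False using qt(4) \<open>t \<noteq> 0\<close> degr by auto
    qed
    hence eq: "smult (lead_coeff r ^ k) p = q * r" using qt by simp
    have "q \<noteq> 0" using eq p(2) lc by auto
    have "poly q b = 0" using tb t0 rp(3) by simp
    hence "degree p \<le> degree q" using min[OF qt(1) \<open>q \<noteq> 0\<close>] by blast
    moreover have "degree p = degree q + degree r"
      using arg_cong[OF eq, of degree] lc \<open>q \<noteq> 0\<close> rp(2) by (simp add: degree_mult_eq)
    ultimately show False using d by simp
  qed
  then obtain u where u: "r = [:u:]" by (rule degree_eq_zeroE)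
  have "u \<in> A" using rp(1) u unfolding polys_over_def by (auto dest: spec[of _ 0])
  thus ?thesis using s rp u by (intro bexI[of _ s] bexI[of _ u]) auto
qed

text \<open>If \<open>b\<close> is transcendental over \<open>A\<close>, its image may be any point
at which the image of the polynomial of \<open>v\<close> is nonzero. If \<open>b\<close> is
algebraic, its image must be a root of the image of the minimal polynomial, which exists since the
target is algebraically closed; it has the right degree if the leading coefficient survives, and
\<open>v\<close> survives because it divides an element of \<open>A\<close> that does.\<close>

lemma hom_extension:
  assumes v: "v \<in> adjoin A b" "v \<noteq> 0"
  shows "\<exists>u\<in>A. u \<noteq> 0 \<and> (\<forall>\<phi> :: 'r \<Rightarrow> 'k::alg_closed_field. hom_on A \<phi> \<and> \<phi> u \<noteq> 0 \<longrightarrow>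
    (\<exists>\<psi>. hom_on (adjoin A b) \<psi> \<and> (\<forall>x\<in>A. \<psi> x = \<phi> x) \<and> \<psi> v \<noteq> 0))"
proof -
  obtain w where w: "w \<in> polys_over" "v = poly w b" using v unfolding adjoin_eq by blast
  hence wnz: "w \<noteq> 0" using v by auto
  show ?thesis
  proof (cases "\<exists>p\<in>polys_over. p \<noteq> 0 \<and> poly p b = 0")
    case False
    have "lead_coeff w \<in> A" using w by (auto simp: polys_over_def)
    moreover have "\<exists>\<psi>. hom_on (adjoin A b) \<psi> \<and> (\<forall>x\<in>A. \<psi> x = \<phi> x) \<and> \<psi> v \<noteq> 0"
      if hom: "hom_on A \<phi>" "\<phi> (lead_coeff w) \<noteq> 0" for \<phi> :: "'r \<Rightarrow> 'k"
    proof -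
      have "coeff (map_poly \<phi> w) (degree w) \<noteq> 0" using hom by (simp add: coeff_map_poly h0[OF hom(1)])
      hence "map_poly \<phi> w \<noteq> 0" by auto
      then obtain \<xi> where \<xi>: "poly (map_poly \<phi> w) \<xi> \<noteq> 0" using poly_cofinite_zero[of "{}" "map_poly \<phi> w"] by auto
      have "poly (map_poly \<phi> p) \<xi> = 0" if "p \<in> polys_over" "poly p b = 0" for p
        using False that by (auto)
      from hom_extend[OF hom(1) this] obtain \<psi> where "hom_on (adjoin A b) \<psi>" "\<forall>x\<in>A. \<psi> x = \<phi> x"
        "\<forall>p\<in>polys_over. \<psi> (poly p b) = poly (map_poly \<phi> p) \<xi>" by blast
      thus ?thesis using \<xi> w by auto
    qed
    ultimately show ?thesis using wnz by (intro bexI[of _ "lead_coeff w"]) auto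
  next
    case True
    then obtain p0 where "p0 \<in> polys_over \<and> p0 \<noteq> 0 \<and> poly p0 b = 0" by blast
    then obtain p where "p \<in> polys_over \<and> p \<noteq> 0 \<and> poly p b = 0"
      and min': "\<And>q. q \<in> polys_over \<and> q \<noteq> 0 \<and> poly q b = 0 \<Longrightarrow> degree p \<le> degree q"
      using ex_has_least_nat[of "\<lambda>p. p \<in> polys_over \<and> p \<noteq> 0 \<and> poly p b = 0" p0 degree] by blast
    hence p: "p \<in> polys_over" "p \<noteq> 0" "poly p b = 0" by auto
    obtain s u where su: "s \<in> polys_over" "u \<in> A" "u \<noteq> 0" "u = poly s b * poly w b"
      using minimal_poly_coprime[OF p _ w(1)] min' v w by blast
    let ?a = "lead_coeff p"
    have aA: "?a \<in> A" using p by (auto simp: polys_over_def)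
    have "\<exists>\<psi>. hom_on (adjoin A b) \<psi> \<and> (\<forall>x\<in>A. \<psi> x = \<phi> x) \<and> \<psi> v \<noteq> 0"
      if hom: "hom_on A \<phi>" "\<phi> (?a * u) \<noteq> 0" for \<phi> :: "'r \<Rightarrow> 'k"
    proof -
      have nz: "\<phi> ?a \<noteq> 0" "\<phi> u \<noteq> 0" using hom aA su by (auto simp: h_mult[OF hom(1)])
      have "degree p > 0"
      proof (rule ccontr)
        assume "\<not> ?thesis"
        then obtain c where "p = [:c:]" using degree_eq_zeroE by auto
        thus False using p by auto
      qed
      moreover have "degree p \<le> degree (map_poly \<phi> p)"
        using nz by (intro le_degree) (simp add: coeff_map_poly h0[OF hom(1)])
      ultimately obtain \<xi> where \<xi>: "poly (map_poly \<phi> p) \<xi> = 0"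
        using alg_closed_imp_poly_has_root[of "map_poly \<phi> p"] by auto
      have "poly (map_poly \<phi> q) \<xi> = 0" if q: "q \<in> polys_over" "poly q b = 0" for q
      proof -
        obtain k s t where st: "s \<in> polys_over" "t \<in> polys_over" "smult (?a ^ k) q = s * p + t"
          "t = 0 \<or> degree t < degree p" using pseudo_division[OF p(1,2) q(1)] by blast
        have "poly t b = 0" using arg_cong[OF st(3), of "\<lambda>x. poly x b"] p(3) q(2) by simp
        hence "t = 0" using st min'[of t] by force
        hence "map_poly \<phi> (smult (?a ^ k) q) = map_poly \<phi> (s * p)" using st by simp
        hence "smult (\<phi> ?a ^ k) (map_poly \<phi> q) = map_poly \<phi> s * map_poly \<phi> p"
          unfolding mp_smult[OF hom(1) sub_power[OF aA] q(1)] mp_mult[OF hom(1) st(1) p(1)] h_power[OF hom(1) aA] .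
        hence "\<phi> ?a ^ k * poly (map_poly \<phi> q) \<xi> = 0"
          using arg_cong[of _ _ "\<lambda>x. poly x \<xi>"] \<xi> by (metis mult_zero_right poly_mult poly_smult)
        thus ?thesis using nz by simp
      qed
      from hom_extend[OF hom(1) this] obtain \<psi> where \<psi>: "hom_on (adjoin A b) \<psi>" "\<forall>x\<in>A. \<psi> x = \<phi> x" by blast
      have "\<psi> u = \<psi> (poly s b) * \<psi> v"
        using \<psi>(1) su w unfolding hom_on_def adjoin_eq by auto
      hence "\<psi> v \<noteq> 0" using nz \<psi>(2) su by auto
      thus ?thesis using \<psi> by blast
    qed
    moreover have "?a * u \<in> A" "?a * u \<noteq> 0" using sub_mult[OF aA su(2)] su p by auto
    ultimately show ?thesis by blast
  qed
qed

end

lemma hom_extension_list: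
  fixes A :: "'r::idom set"
  assumes "subring_on A"
  shows "subring_on (foldr (\<lambda>b B. adjoin B b) bs A) \<and> A \<subseteq> foldr (\<lambda>b B. adjoin B b) bs A \<and>
    set bs \<subseteq> foldr (\<lambda>b B. adjoin B b) bs A \<and>
    (\<forall>v\<in>foldr (\<lambda>b B. adjoin B b) bs A. v \<noteq> 0 \<longrightarrow>
    (\<exists>u\<in>A. u \<noteq> 0 \<and> (\<forall>\<phi> :: 'r \<Rightarrow> 'k::alg_closed_field. hom_on A \<phi> \<and> \<phi> u \<noteq> 0 \<longrightarrow>
    (\<exists>\<psi>. hom_on (foldr (\<lambda>b B. adjoin B b) bs A) \<psi> \<and> (\<forall>x\<in>A. \<psi> x = \<phi> x) \<and> \<psi> v \<noteq> 0))))"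
proof (induction bs)
  case Nil
  show ?case using assms by auto
next
  case (Cons b bs)
  let ?B = "foldr (\<lambda>b B. adjoin B b) bs A"
  have B: "subring_on ?B" "A \<subseteq> ?B" "set bs \<subseteq> ?B" using Cons by auto
  show ?case
  proof (simp, intro conjI ballI impI)
    show "subring_on (adjoin ?B b)" by (rule subring_adjoin[OF B(1)])
    show "A \<subseteq> adjoin ?B b" "set bs \<subseteq> adjoin ?B b" using adjoin_subset[OF B(1), of b] B by auto
    show "b \<in> adjoin ?B b" by (rule adjoin_self[OF B(1)])
    fix v assume v: "v \<in> adjoin ?B b" "v \<noteq> 0"
    from hom_extension[OF B(1) v, where 'k = 'k] obtain u where u: "u \<in> ?B" "u \<noteq> 0"
      "\<And>\<phi> :: 'r \<Rightarrow> 'k. hom_on ?B \<phi> \<and> \<phi> u \<noteq> 0 \<Longrightarrow>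
      (\<exists>\<psi>. hom_on (adjoin ?B b) \<psi> \<and> (\<forall>x\<in>?B. \<psi> x = \<phi> x) \<and> \<psi> v \<noteq> 0)" by blast
    obtain u' where u': "u' \<in> A" "u' \<noteq> 0" "\<And>\<phi> :: 'r \<Rightarrow> 'k. hom_on A \<phi> \<and> \<phi> u' \<noteq> 0 \<Longrightarrow>
      (\<exists>\<psi>. hom_on ?B \<psi> \<and> (\<forall>x\<in>A. \<psi> x = \<phi> x) \<and> \<psi> u \<noteq> 0)" using Cons u by blast
    show "\<exists>u\<in>A. u \<noteq> 0 \<and> (\<forall>\<phi> :: 'r \<Rightarrow> 'k. hom_on A \<phi> \<and> \<phi> u \<noteq> 0 \<longrightarrow>
      (\<exists>\<psi>. hom_on (adjoin ?B b) \<psi> \<and> (\<forall>x\<in>A. \<psi> x = \<phi> x) \<and> \<psi> v \<noteq> 0))"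
    proof (intro bexI[of _ u'] conjI allI impI u')
      fix \<phi> :: "'r \<Rightarrow> 'k" assume "hom_on A \<phi> \<and> \<phi> u' \<noteq> 0"
      then obtain \<psi>1 where 1: "hom_on ?B \<psi>1" "\<forall>x\<in>A. \<psi>1 x = \<phi> x" "\<psi>1 u \<noteq> 0" using u'(3) by blast
      then obtain \<psi> where "hom_on (adjoin ?B b) \<psi>" "\<forall>x\<in>?B. \<psi> x = \<psi>1 x" "\<psi> v \<noteq> 0" using u(3) by blast
      thus "\<exists>\<psi>. hom_on (adjoin ?B b) \<psi> \<and> (\<forall>x\<in>A. \<psi> x = \<phi> x) \<and> \<psi> v \<noteq> 0" using 1 B by (intro exI[of _ \<psi>]) auto
    qed
  qed
qed

section \<open>Images of polynomial maps contain open sets\<close>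

lemma poly_mapping_sum_single: "p = (\<Sum>m\<in>Poly_Mapping.keys p. Poly_Mapping.single m (Poly_Mapping.lookup p m))"
proof (rule poly_mapping_eqI)
  fix k
  have "(\<Sum>m\<in>Poly_Mapping.keys p. Poly_Mapping.lookup (Poly_Mapping.single m (Poly_Mapping.lookup p m)) k)
    = (\<Sum>m\<in>Poly_Mapping.keys p. if m = k then Poly_Mapping.lookup p m else 0)"
    by (intro sum.cong) (auto simp: lookup_single when_def)
  also have "\<dots> = Poly_Mapping.lookup p k"
    by (simp add: sum.delta' in_keys_iff)
  finally show "Poly_Mapping.lookup p k =
    Poly_Mapping.lookup (\<Sum>m\<in>Poly_Mapping.keys p. Poly_Mapping.single m (Poly_Mapping.lookup p m)) k"
    by (simp add: lookup_sum)
qed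

lemma lookup_mult_finite:
  assumes "finite S" "finite T" "Poly_Mapping.keys p \<subseteq> S" "Poly_Mapping.keys q \<subseteq> T"
  shows "Poly_Mapping.lookup (p * q) k =
    (\<Sum>l\<in>S. \<Sum>m\<in>T. if l + m = k then Poly_Mapping.lookup p l * Poly_Mapping.lookup q m else 0)"
proof -
  let ?p = "\<lambda>l. Poly_Mapping.single l (Poly_Mapping.lookup p l)"
  let ?q = "\<lambda>l. Poly_Mapping.single l (Poly_Mapping.lookup q l)"
  have z: "Poly_Mapping.single l (0::'b) = 0" for l :: 'a by simp
  have "p = (\<Sum>l\<in>S. ?p l)"
    by (subst poly_mapping_sum_single, rule sum.mono_neutral_left) (use assms in \<open>auto simp: in_keys_iff\<close>)
  moreover have "q = (\<Sum>l\<in>T. ?q l)"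
    by (subst poly_mapping_sum_single, rule sum.mono_neutral_left) (use assms in \<open>auto simp: in_keys_iff\<close>)
  ultimately have "p * q = (\<Sum>l\<in>S. ?p l) * (\<Sum>l\<in>T. ?q l)" by simp
  also have "\<dots> = (\<Sum>l\<in>S. \<Sum>m\<in>T. Poly_Mapping.single (l + m) (Poly_Mapping.lookup p l * Poly_Mapping.lookup q m))"
    by (simp add: sum_product mult_single)
  finally show ?thesis by (simp add: lookup_sum lookup_single when_def)
qed

definition mono_val :: "('v \<Rightarrow>\<^sub>0 nat) \<Rightarrow> ('v \<Rightarrow> 'a::field) \<Rightarrow> 'a" where
  "mono_val m c = (\<Prod>v\<in>Poly_Mapping.keys m. c v ^ Poly_Mapping.lookup m v)"

lemma mono_val_superset:
  assumes "finite S" "Poly_Mapping.keys m \<subseteq> S"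
  shows "mono_val m c = (\<Prod>v\<in>S. c v ^ Poly_Mapping.lookup m v)"
  unfolding mono_val_def by (rule prod.mono_neutral_left) (use assms in \<open>auto simp: in_keys_iff\<close>)

lemma mono_val_add: "mono_val (m + m') c = mono_val m c * mono_val m' c"
proof -
  let ?S = "Poly_Mapping.keys m \<union> Poly_Mapping.keys m'"
  have "Poly_Mapping.keys (m + m') \<subseteq> ?S" by (rule keys_add)
  thus ?thesis
    by (simp add: mono_val_superset[of ?S] lookup_add power_add prod.distrib)
qed

lemma poly_eval_superset:
  assumes "finite S" "Poly_Mapping.keys P \<subseteq> S"
  shows "poly_eval P c = (\<Sum>m\<in>S. Poly_Mapping.lookup P m * mono_val m c)"
  unfolding poly_eval_def mono_val_def[symmetric]
  by (rule sum.mono_neutral_left) (use assms in \<open>auto simp: in_keys_iff\<close>)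

lemma poly_eval_add: "poly_eval (P + Q) c = poly_eval P c + poly_eval Q c"
proof -
  let ?S = "Poly_Mapping.keys P \<union> Poly_Mapping.keys Q"
  have "Poly_Mapping.keys (P + Q) \<subseteq> ?S" by (rule keys_add)
  thus ?thesis by (simp add: poly_eval_superset[of ?S] lookup_add distrib_right sum.distrib)
qed

lemma poly_eval_single: "poly_eval (Poly_Mapping.single m a) c = a * mono_val m c"
  by (subst poly_eval_superset[of "{m}"]) auto

lemma poly_eval_zero: "poly_eval 0 c = 0"
  by (simp add: poly_eval_def)

lemma poly_eval_sum: "poly_eval (\<Sum>i\<in>I. f i) c = (\<Sum>i\<in>I. poly_eval (f i) c)"
  by (induction I rule: infinite_finite_induct) (auto simp: poly_eval_zero poly_eval_add)

lemma poly_eval_mult: "poly_eval (P * Q) c = poly_eval P c * poly_eval Q c"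
proof -
  let ?p = "\<lambda>l. Poly_Mapping.single l (Poly_Mapping.lookup P l)"
  let ?q = "\<lambda>l. Poly_Mapping.single l (Poly_Mapping.lookup Q l)"
  have "poly_eval (P * Q) c = poly_eval ((\<Sum>l\<in>Poly_Mapping.keys P. ?p l) * (\<Sum>l\<in>Poly_Mapping.keys Q. ?q l)) c"
    using poly_mapping_sum_single[of P] poly_mapping_sum_single[of Q] by simp
  also have "\<dots> = (\<Sum>l\<in>Poly_Mapping.keys P. \<Sum>m\<in>Poly_Mapping.keys Q. poly_eval (?p l) c * poly_eval (?q m) c)"
    by (simp add: sum_product mult_single poly_eval_sum poly_eval_single mono_val_add mult_ac)
  also have "\<dots> = poly_eval P c * poly_eval Q c"
    by (simp add: sum_product[symmetric] poly_eval_sum[symmetric] poly_mapping_sum_single[symmetric])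
  finally show ?thesis .
qed

definition cst :: "'a \<Rightarrow> ('v \<Rightarrow>\<^sub>0 nat) \<Rightarrow>\<^sub>0 'a::field" where "cst a = Poly_Mapping.single 0 a"
definition var :: "'v \<Rightarrow> ('v \<Rightarrow>\<^sub>0 nat) \<Rightarrow>\<^sub>0 'a::field" where
  "var v = Poly_Mapping.single (Poly_Mapping.single v 1) 1"

lemma poly_eval_cst [simp]: "poly_eval (cst a) c = a"
  by (simp add: cst_def poly_eval_single mono_val_def)

lemma poly_eval_var [simp]: "poly_eval (var v) c = c v"
  by (simp add: var_def poly_eval_single mono_val_def)

lemma cst_1: "cst 1 = 1" by (simp add: cst_def)

lemma polyfun_imp_poly_eval:
  assumes "P \<in> polyfun M"
  shows "\<exists>E. \<forall>c. poly_eval E c = P c"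
  using assms
proof induction
  case (polyfun_const a) show ?case by (rule exI[of _ "cst a"]) simp
next
  case (polyfun_var v) show ?case by (rule exI[of _ "var v"]) simp
next
  case (polyfun_add f g)
  then obtain E E' where "\<forall>c. poly_eval E c = f c" "\<forall>c. poly_eval E' c = g c" by blast
  thus ?case by (intro exI[of _ "E + E'"]) (simp add: poly_eval_add)
next
  case (polyfun_mult f g)
  then obtain E E' where "\<forall>c. poly_eval E c = f c" "\<forall>c. poly_eval E' c = g c" by blast
  thus ?case by (intro exI[of _ "E * E'"]) (simp add: poly_eval_mult)
qed

lemma poly_eval_polyfun: "(\<lambda>c. poly_eval E (\<lambda>v. if v \<in> M then c v else 0)) \<in> polyfun M"
  unfolding poly_eval_def
proof (intro fun_alg_intros fun_alg_polyfun)
  fix v :: 'a show "(\<lambda>x. if v \<in> M then x v else (0::'b)) \<in> polyfun M"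
    by (cases "v \<in> M") (auto intro: polyfun.intros)
qed

lemma poly_eval_zero_imp_zero:
  fixes P :: "('v \<Rightarrow>\<^sub>0 nat) \<Rightarrow>\<^sub>0 'a::alg_closed_field"
  assumes "\<And>c. poly_eval P c = 0"
  shows "P = 0"
proof (rule poly_mapping_eqI)
  fix m0 :: "'v \<Rightarrow>\<^sub>0 nat"
  define V where "V = Poly_Mapping.keys m0 \<union> (\<Union>m\<in>Poly_Mapping.keys P. Poly_Mapping.keys m)"
  define K where "K = insert m0 (Poly_Mapping.keys P)"
  define k where "k = (\<Sum>m\<in>K. \<Sum>v\<in>V. Poly_Mapping.lookup m v)"
  let ?B = "Pi\<^sub>E V (\<lambda>_. {..k})"
  let ?r = "\<lambda>m. restrict (Poly_Mapping.lookup m) V"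
  have fin: "finite V" "finite K" "finite ?B" by (auto simp: V_def K_def intro: finite_PiE)
  have keysV: "Poly_Mapping.keys m \<subseteq> V" if "m \<in> K" for m using that by (auto simp: V_def K_def)
  have rB: "?r m \<in> ?B" if "m \<in> K" for m
  proof -
    have "Poly_Mapping.lookup m v \<le> k" if "v \<in> V" for v
    proof -
      have "Poly_Mapping.lookup m v \<le> (\<Sum>v\<in>V. Poly_Mapping.lookup m v)" using fin that by (intro member_le_sum) auto
      also have "\<dots> \<le> k" unfolding k_def using fin \<open>m \<in> K\<close>
        by (intro member_le_sum[of m K "\<lambda>m. \<Sum>v\<in>V. Poly_Mapping.lookup m v"]) auto
      finally show ?thesis .
    qed
    thus ?thesis by auto
  qed
  have inj: "inj_on ?r K"
  proof (rule inj_onI, rule poly_mapping_eqI)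
    fix m m' v assume "m \<in> K" "m' \<in> K" "?r m = ?r m'"
    thus "Poly_Mapping.lookup m v = Poly_Mapping.lookup m' v"
      using keysV[of m] keysV[of m'] by (metis in_keys_iff restrict_apply' subsetD)
  qed
  define c where "c \<alpha> = (if \<alpha> \<in> ?r ` K then Poly_Mapping.lookup P (inv_into K ?r \<alpha>) else 0)" for \<alpha>
  have cr: "c (?r m) = Poly_Mapping.lookup P m" if "m \<in> K" for m
    using that inv_into_f_f[OF inj that] by (simp add: c_def)
  have "c (?r m0) = 0"
  proof (rule pmono_relation_trivial[where V = V and k = k and c = c])
    fix x :: "'v \<Rightarrow> 'a"
    have "(\<Sum>\<alpha>\<in>?B. c \<alpha> * pmono V \<alpha> x) = (\<Sum>\<alpha>\<in>?r ` K. c \<alpha> * pmono V \<alpha> x)"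
      using fin(3) by (rule sum.mono_neutral_right) (use rB in blast, simp add: c_def)
    also have "\<dots> = (\<Sum>m\<in>K. Poly_Mapping.lookup P m * mono_val m x)"
      unfolding sum.reindex[OF inj]
    proof (intro sum.cong refl)
      fix m assume m: "m \<in> K"
      have "c (?r m) = Poly_Mapping.lookup P m" using cr[OF m] .
      moreover have "pmono V (?r m) x = mono_val m x"
        unfolding pmono_def by (subst mono_val_superset[OF fin(1) keysV[OF m]]) (auto intro!: prod.cong)
      ultimately show "((\<lambda>\<alpha>. c \<alpha> * pmono V \<alpha> x) \<circ> ?r) m = Poly_Mapping.lookup P m * mono_val m x" by simp
    qed
    also have "\<dots> = 0" using assms[of x] poly_eval_superset[OF fin(2), of P x] by (simp add: K_def subset_insertI)
    finally show "(\<Sum>\<alpha>\<in>?B. c \<alpha> * pmono V \<alpha> x) = 0" .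
  qed (use fin rB[of m0] in \<open>simp_all add: K_def\<close>)
  thus "Poly_Mapping.lookup P m0 = Poly_Mapping.lookup 0 m0" using cr[of m0] by (simp add: K_def)
qed

text \<open>An element of the algebra generated by the \<open>s m\<close> together with a polynomial
expression for it. Since this is a relation, sums and products of expressions need no choice of
representatives; it becomes a function exactly when the \<open>s m\<close> are algebraically
independent.\<close>

inductive matches :: "('m \<Rightarrow> 'r::idom) \<Rightarrow> ('a::field \<Rightarrow> 'r) \<Rightarrow> 'm set \<Rightarrow> 'r \<Rightarrow> (('m \<Rightarrow> 'a) \<Rightarrow> 'a) \<Rightarrow> bool"
  for s :: "'m \<Rightarrow> 'r::idom" and C :: "'a::field \<Rightarrow> 'r" and M where
  matches_const: "matches s C M (C a) (\<lambda>_. a)"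
| matches_var: "m \<in> M \<Longrightarrow> matches s C M (s m) (\<lambda>y. y m)"
| matches_add: "matches s C M a P \<Longrightarrow> matches s C M b Q \<Longrightarrow> matches s C M (a + b) (\<lambda>y. P y + Q y)"
| matches_mult: "matches s C M a P \<Longrightarrow> matches s C M b Q \<Longrightarrow> matches s C M (a * b) (\<lambda>y. P y * Q y)"

lemma matches_polyfun: "matches s C M a P \<Longrightarrow> P \<in> polyfun M"
  by (induction rule: matches.induct) (auto intro: polyfun.intros)

lemma matches_exists: "P \<in> polyfun M \<Longrightarrow> \<exists>a. matches s C M a P"
  by (induction rule: polyfun.induct) (blast intro: matches.intros)+

lemma matches_eval:
  assumes "matches s cst M a P" "\<And>m. m \<in> M \<Longrightarrow> poly_eval (s m) t = y m"
  shows "poly_eval a t = P y"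
  using assms by (induction rule: matches.induct) (auto simp: poly_eval_add poly_eval_mult)

lemma matches_hom:
  assumes "matches s C M a P" "subring_on B" "hom_on B \<psi>" "\<And>a. C a \<in> B" "\<And>a. \<psi> (C a) = a"
    "\<And>m. m \<in> M \<Longrightarrow> s m \<in> B" "\<And>m. m \<in> M \<Longrightarrow> \<psi> (s m) = y m"
  shows "a \<in> B \<and> \<psi> a = P y"
  using assms(1)
  by (induction rule: matches.induct)
    (use assms(2-) in \<open>auto simp: hom_on_def intro: sub_add sub_mult\<close>)

text \<open>The part of Chevalley's theorem that is needed. If the image is not thin, the components
of \<open>F\<close> are algebraically independent, so a point \<open>y\<close> defines a
homomorphism on the subalgebra \<open>A\<close> generated by them. The polynomial ring in the
parameters arises from \<open>A\<close> by adjoining finitely many elements; hence the homomorphism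
extends as soon as one nonzero element \<open>u\<close> of \<open>A\<close> survives, and the
extension is a preimage of \<open>y\<close>.\<close>

lemma image_contains_open:
  fixes F :: "('v \<Rightarrow> 'a::alg_closed_field) \<Rightarrow> 'm \<Rightarrow> 'a"
  assumes V: "finite V" and F: "\<And>m. m \<in> M \<Longrightarrow> (\<lambda>x. F x m) \<in> polyfun V" and nt: "\<not> thin M (range F)"
  shows "\<exists>U\<in>polyfun M. (\<exists>y. U y \<noteq> 0) \<and> (\<forall>y. U y \<noteq> 0 \<longrightarrow> (\<exists>x. \<forall>m\<in>M. F x m = y m))"
proof -
  obtain e :: "'v \<Rightarrow> nat" where e: "inj_on e V"
    using finite_imp_inj_to_nat_seg[OF V] by blast
  define X :: "'v \<Rightarrow> (nat \<Rightarrow>\<^sub>0 nat) \<Rightarrow>\<^sub>0 'a" where "X v = var (e v)" for v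
  have "\<forall>m\<in>M. \<exists>a. matches X cst V a (\<lambda>x. F x m)" using matches_exists[OF F] by blast
  from bchoice[OF this] obtain s where s: "\<forall>m\<in>M. matches X cst V (s m) (\<lambda>x. F x m)" by blast
  have s_eval: "poly_eval (s m) t = F (\<lambda>v. t (e v)) m" if "m \<in> M" for m t
    using matches_eval[of X V "s m" "\<lambda>x. F x m" t "\<lambda>v. t (e v)"] s that by (simp add: X_def)
  \<comment> \<open>the subalgebra generated by the components of \<open>F\<close>\<close>
  define A where "A = {a. \<exists>P. matches s cst M a P}"
  have A: "subring_on A" unfolding subring_on_def
  proof (intro conjI ballI)
    show "1 \<in> A" unfolding A_def using matches_const[of s cst M 1] by (auto simp: cst_1)
    fix a b assume "a \<in> A" "b \<in> A"
    then obtain P Q where PQ: "matches s cst M a P" "matches s cst M b Q" unfolding A_def by blast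
    show "a * b \<in> A" using matches_mult[OF PQ] unfolding A_def by blast
    have "a + cst (-1) * b \<in> A" using matches_add[OF PQ(1) matches_mult[OF matches_const PQ(2)]] unfolding A_def by blast
    moreover have "cst (-1) = (-1 :: (nat \<Rightarrow>\<^sub>0 nat) \<Rightarrow>\<^sub>0 'a)" using single_uminus[of "0 :: nat \<Rightarrow>\<^sub>0 nat" "1 :: 'a"] by (simp add: cst_def)
    ultimately show "a - b \<in> A" by simp
  qed
  have ev: "poly_eval a t = P (F (\<lambda>v. t (e v)))" if "matches s cst M a P" for a P t
    using matches_eval[OF that] s_eval by blast
  have lift: "\<exists>t. \<forall>v\<in>V. t (e v) = x v" for x :: "'v \<Rightarrow> 'a"
    by (rule exI[of _ "\<lambda>i. x (inv_into V e i)"]) (use e in auto)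
  \<comment> \<open>a polynomial relation between the components of \<open>F\<close> would make the image thin\<close>
  have zero: "P = (\<lambda>_. 0)" if m0: "matches s cst M 0 P" for P
  proof (rule ccontr)
    assume "P \<noteq> (\<lambda>_. 0)"
    then obtain y where "P y \<noteq> 0" by auto
    moreover have "P (F x) = 0" for x
    proof -
      obtain t where t: "\<forall>v\<in>V. t (e v) = x v" using lift by blast
      have "F (\<lambda>v. t (e v)) m = F x m" if "m \<in> M" for m
        using polyfun_cong[OF F[OF that], of "\<lambda>v. t (e v)" x] t by simp
      hence "P (F x) = P (F (\<lambda>v. t (e v)))" using polyfun_cong[OF matches_polyfun[OF m0]] by metis
      also have "\<dots> = 0" using ev[OF m0, of t] by (simp add: poly_eval_zero)
      finally show ?thesis .
    qed
    ultimately have "thin M (range F)" unfolding thin_def using matches_polyfun[OF m0] by blast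
    thus False using nt by simp
  qed
  have uniq: "P = Q" if PQ: "matches s cst M a P" "matches s cst M a Q" for a P Q
  proof -
    have "matches s cst M (a + cst (-1) * a) (\<lambda>y. P y + (-1) * Q y)"
      by (intro matches_add matches_mult matches_const PQ)
    moreover have "cst (-1) = (-1 :: (nat \<Rightarrow>\<^sub>0 nat) \<Rightarrow>\<^sub>0 'a)" using single_uminus[of "0 :: nat \<Rightarrow>\<^sub>0 nat" "1 :: 'a"] by (simp add: cst_def)
    ultimately have "matches s cst M 0 (\<lambda>y. P y + (-1) * Q y)" by simp
    from zero[OF this] have "P y + (-1) * Q y = 0" for y by (metis (no_types))
    thus ?thesis by (intro ext) simp
  qed
  define \<phi> where "\<phi> y a = (THE P. matches s cst M a P) y" for y a
  have \<phi>: "\<phi> y a = P y" if "matches s cst M a P" for y a P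
    unfolding \<phi>_def using the_equality[of "matches s cst M a" P] uniq that by metis
  have hom: "hom_on A (\<phi> y)" for y
    unfolding hom_on_def
  proof (intro conjI ballI)
    show "\<phi> y 1 = 1" using \<phi>[OF matches_const[of s cst M 1]] by (simp add: cst_1)
    fix a b assume "a \<in> A" "b \<in> A"
    then obtain P Q where PQ: "matches s cst M a P" "matches s cst M b Q" unfolding A_def by blast
    show "\<phi> y (a + b) = \<phi> y a + \<phi> y b" using \<phi>[OF matches_add[OF PQ]] \<phi>[OF PQ(1)] \<phi>[OF PQ(2)] by simp
    show "\<phi> y (a * b) = \<phi> y a * \<phi> y b" using \<phi>[OF matches_mult[OF PQ]] \<phi>[OF PQ(1)] \<phi>[OF PQ(2)] by simp
  qed
  obtain vs where vs: "set vs = V" using V finite_list by blast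
  define B where "B = foldr (\<lambda>b B. adjoin B b) (map X vs) A"
  have B: "subring_on B" "A \<subseteq> B" "X ` V \<subseteq> B"
    and ext: "\<And>v. v \<in> B \<Longrightarrow> v \<noteq> 0 \<Longrightarrow>
    (\<exists>u\<in>A. u \<noteq> 0 \<and> (\<forall>\<phi> :: _ \<Rightarrow> 'a. hom_on A \<phi> \<and> \<phi> u \<noteq> 0 \<longrightarrow>
    (\<exists>\<psi>. hom_on B \<psi> \<and> (\<forall>x\<in>A. \<psi> x = \<phi> x) \<and> \<psi> v \<noteq> 0)))"
    using hom_extension_list[OF A, of "map X vs", where 'k = 'a] vs unfolding B_def by auto
  \<comment> \<open>nothing but the existence of an extension is wanted, so the element to be kept alive is 1\<close>
  from ext[of 1] B(1) obtain u where u: "u \<in> A" "u \<noteq> 0" "\<And>\<phi> :: _ \<Rightarrow> 'a. hom_on A \<phi> \<and> \<phi> u \<noteq> 0 \<Longrightarrow>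
    (\<exists>\<psi>. hom_on B \<psi> \<and> (\<forall>x\<in>A. \<psi> x = \<phi> x) \<and> \<psi> 1 \<noteq> 0)"
    by (auto simp: subring_on_def)
  obtain U where U: "matches s cst M u U" using u unfolding A_def by blast
  show ?thesis
  proof (intro bexI[of _ U] conjI allI impI)
    show "U \<in> polyfun M" by (rule matches_polyfun[OF U])
    show "\<exists>y. U y \<noteq> 0"
    proof (rule ccontr)
      assume "\<not> ?thesis"
      hence "poly_eval u t = 0" for t using ev[OF U] by simp
      thus False using poly_eval_zero_imp_zero u(2) by blast
    qed
    fix y assume y: "U y \<noteq> 0"
    then obtain \<psi> where \<psi>: "hom_on B \<psi>" "\<forall>x\<in>A. \<psi> x = \<phi> y x" using u(3)[of "\<phi> y"] hom \<phi>[OF U] by auto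
    have c: "cst a \<in> A" for a unfolding A_def using matches_const by blast
    have \<psi>c: "\<psi> (cst a) = a" for a using \<psi>(2) c \<phi>[OF matches_const] by simp
    show "\<exists>x. \<forall>m\<in>M. F x m = y m"
    proof (intro exI[of _ "\<lambda>v. \<psi> (X v)"] ballI)
      fix m assume m: "m \<in> M"
      have "\<psi> (s m) = F (\<lambda>v. \<psi> (X v)) m"
        using matches_hom[OF s[rule_format, OF m] B(1) \<psi>(1), of "\<lambda>v. \<psi> (X v)"] c B \<psi>c by blast
      moreover have "s m \<in> A" unfolding A_def using matches_var[OF m] by blast
      hence "\<psi> (s m) = y m" using \<psi>(2) \<phi>[OF matches_var[OF m]] by simp
      ultimately show "F (\<lambda>v. \<psi> (X v)) m = y m" by simp
    qed
  qed
qed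

section \<open>Forms, products of forms and the generic slice rank\<close>

definition mons :: "nat set \<Rightarrow> nat \<Rightarrow> (nat \<Rightarrow>\<^sub>0 nat) set" where
  "mons Y d = {m. Poly_Mapping.keys m \<subseteq> Y \<and> (\<Sum>i\<in>Y. Poly_Mapping.lookup m i) = d}"

abbreviation lkp where "lkp \<equiv> Poly_Mapping.lookup"
abbreviation supp where "supp \<equiv> Poly_Mapping.keys"

lemma forms_iff: "f \<in> forms n d \<longleftrightarrow> supp f \<subseteq> mons {..n} d"
  by (auto simp: forms_def polys_def mons_def)

lemma finite_mons: assumes "finite Y" shows "finite (mons Y d)"
proof -
  have "lkp ` mons Y d \<subseteq> {f. (\<forall>i\<in>Y. f i \<in> {..d}) \<and> (\<forall>i. i \<notin> Y \<longrightarrow> f i = 0)}"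
  proof (clarify, intro conjI ballI allI impI)
    fix m i assume m: "m \<in> mons Y d"
    { assume "i \<in> Y"
      hence "lkp m i \<le> (\<Sum>i\<in>Y. lkp m i)" using assms by (intro member_le_sum) auto
      thus "lkp m i \<in> {..d}" using m by (simp add: mons_def) }
    { assume "i \<notin> Y" thus "lkp m i = 0" using m by (auto simp: mons_def in_keys_iff) }
  qed
  moreover have "finite {f :: nat \<Rightarrow> nat. (\<forall>i\<in>Y. f i \<in> {..d}) \<and> (\<forall>i. i \<notin> Y \<longrightarrow> f i = 0)}"
    using finite_set_of_finite_funs[OF assms, of "{..d}" 0] by (rule finite_subset[rotated]) auto
  ultimately have "finite (lkp ` mons Y d)" by (rule finite_subset)
  thus ?thesis by (rule finite_imageD) (auto intro: inj_onI poly_mapping_eqI)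
qed

lemma mons_add: "a \<in> mons Y d \<Longrightarrow> b \<in> mons Y e \<Longrightarrow> a + b \<in> mons Y (d + e)"
  using keys_add[of a b] by (auto simp: mons_def lookup_add sum.distrib)

definition of_coords :: "'m set \<Rightarrow> ('m \<Rightarrow> 'a) \<Rightarrow> 'm \<Rightarrow>\<^sub>0 'a::comm_monoid_add" where
  "of_coords M y = (\<Sum>m\<in>M. Poly_Mapping.single m (y m))"

lemma lookup_of_coords: "finite M \<Longrightarrow> lkp (of_coords M y) m = (if m \<in> M then y m else 0)"
  by (simp add: of_coords_def lookup_sum lookup_single when_def sum.delta)

lemma keys_of_coords: "finite M \<Longrightarrow> supp (of_coords M y) \<subseteq> M"
  by (auto simp: in_keys_iff lookup_of_coords split: if_splits)

lemma of_coords_forms: "of_coords (mons {..n} d) y \<in> forms n d"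
  using keys_of_coords[OF finite_mons, of "{..n}"] by (simp add: forms_iff)

lemma of_coords_lookup: "finite M \<Longrightarrow> supp f \<subseteq> M \<Longrightarrow> of_coords M (lkp f) = f"
  by (rule poly_mapping_eqI) (auto simp: lookup_of_coords in_keys_iff)

lemma forms_sum: "(\<And>i. i \<in> I \<Longrightarrow> f i \<in> forms n d) \<Longrightarrow> (\<Sum>i\<in>I. f i) \<in> forms n d"
  using keys_sum[of f I] by (auto simp: forms_iff dest!: subsetD)

lemma forms_mult: "f \<in> forms n d \<Longrightarrow> g \<in> forms n e \<Longrightarrow> f * g \<in> forms n (d + e)"
  using keys_mult[of f g] mons_add[of _ "{..n}" d _ e] by (auto simp: forms_iff) blast

lemma forms_zero: "0 \<in> forms n d" by (simp add: forms_iff)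

definition sums_of_products :: "nat \<Rightarrow> nat \<Rightarrow> nat \<Rightarrow> (nat \<Rightarrow> nat) \<Rightarrow> 'a::field mpoly set" where
  "sums_of_products n d r e = {\<Sum>i<r. g i * h i | g h.
     (\<forall>i<r. g i \<in> forms n (e i) \<and> h i \<in> forms n (d - e i))}"

lemma sums_of_productsI:
  assumes "f = (\<Sum>i<r. g i * h i)" "\<And>i. i < r \<Longrightarrow> g i \<in> forms n (e i)" "\<And>i. i < r \<Longrightarrow> h i \<in> forms n (d - e i)"
  shows "f \<in> sums_of_products n d r e"
  unfolding sums_of_products_def using assms by (intro CollectI exI[of _ g] exI[of _ h]) auto

text \<open>The coefficient at \<open>m\<close> of the sum of \<open>g\<^sub>i h\<^sub>i\<close>,
where the flag \<open>True\<close> marks a coefficient of \<open>g\<^sub>i\<close> and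
\<open>False\<close> one of \<open>h\<^sub>i\<close>.\<close>

definition product_coords :: "nat \<Rightarrow> nat \<Rightarrow> nat \<Rightarrow> (nat \<Rightarrow> nat) \<Rightarrow>
    (nat \<times> bool \<times> (nat \<Rightarrow>\<^sub>0 nat) \<Rightarrow> 'a::field) \<Rightarrow> (nat \<Rightarrow>\<^sub>0 nat) \<Rightarrow> 'a" where
  "product_coords n d r e x m = (\<Sum>i<r. \<Sum>a\<in>mons {..n} (e i). \<Sum>b\<in>mons {..n} (d - e i).
     if a + b = m then x (i, True, a) * x (i, False, b) else 0)"

lemma lookup_sum_of_products:
  assumes "\<And>i. i < r \<Longrightarrow> g i \<in> forms n (e i)" "\<And>i. i < r \<Longrightarrow> h i \<in> forms n (d - e i)"
    "\<And>i a. i < r \<Longrightarrow> a \<in> mons {..n} (e i) \<Longrightarrow> lkp (g i) a = x (i, True, a)"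
    "\<And>i a. i < r \<Longrightarrow> a \<in> mons {..n} (d - e i) \<Longrightarrow> lkp (h i) a = x (i, False, a)"
  shows "lkp (\<Sum>i<r. g i * h i) m = product_coords n d r e x m"
  unfolding lookup_sum product_coords_def
proof (intro sum.cong refl)
  fix i assume "i \<in> {..<r}"
  hence i: "i < r" by simp
  have "lkp (g i * h i) m = (\<Sum>a\<in>mons {..n} (e i). \<Sum>b\<in>mons {..n} (d - e i).
      if a + b = m then lkp (g i) a * lkp (h i) b else 0)"
    by (rule lookup_mult_finite) (use assms(1,2)[OF i] in \<open>auto simp: finite_mons forms_iff\<close>)
  also have "\<dots> = (\<Sum>a\<in>mons {..n} (e i). \<Sum>b\<in>mons {..n} (d - e i).
      if a + b = m then x (i, True, a) * x (i, False, b) else 0)"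
    using assms(3,4)[OF i] by (intro sum.cong refl) auto
  finally show "lkp (g i * h i) m = \<dots>" .
qed

lemma sums_of_products_coords:
  assumes "f \<in> sums_of_products n d r e"
  shows "\<exists>x. lkp f = product_coords n d r e x"
proof -
  obtain g h where gh: "f = (\<Sum>i<r. g i * h i)" "\<forall>i<r. g i \<in> forms n (e i) \<and> h i \<in> forms n (d - e i)"
    using assms unfolding sums_of_products_def by blast
  have "lkp f m = product_coords n d r e (\<lambda>(i, t, a). if t then lkp (g i) a else lkp (h i) a) m" for m
    unfolding gh(1) by (rule lookup_sum_of_products) (use gh in auto)
  thus ?thesis by (intro exI) (rule ext)
qed

lemma product_coords_realized:
  "\<exists>f\<in>sums_of_products n d r e. lkp f = product_coords n d r e x"
proof -
  define g where "g i = of_coords (mons {..n} (e i)) (\<lambda>a. x (i, True, a))" for i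
  define h where "h i = of_coords (mons {..n} (d - e i)) (\<lambda>a. x (i, False, a))" for i
  have "lkp (\<Sum>i<r. g i * h i) m = product_coords n d r e x m" for m
    by (rule lookup_sum_of_products)
      (auto simp: g_def h_def of_coords_forms lookup_of_coords finite_mons)
  moreover have "(\<Sum>i<r. g i * h i) \<in> sums_of_products n d r e"
    by (rule sums_of_productsI[OF refl]) (simp_all add: g_def h_def of_coords_forms)
  ultimately show ?thesis by (intro bexI[of _ "\<Sum>i<r. g i * h i"] ext)
qed

definition product_params :: "nat \<Rightarrow> nat \<Rightarrow> nat \<Rightarrow> (nat \<Rightarrow> nat) \<Rightarrow> (nat \<times> bool \<times> (nat \<Rightarrow>\<^sub>0 nat)) set" where
  "product_params n d r e = (\<Union>i<r. (\<lambda>a. (i, True, a)) ` mons {..n} (e i) \<union> (\<lambda>a. (i, False, a)) ` mons {..n} (d - e i))"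

lemma product_coords_polyfun: "(\<lambda>x. product_coords n d r e x m) \<in> polyfun (product_params n d r e)"
  unfolding product_coords_def
proof (intro fun_alg_sum fun_alg_polyfun)
  fix i a b assume "i \<in> {..<r}" "a \<in> mons {..n} (e i)" "b \<in> mons {..n} (d - e i)"
  hence "(i, True, a) \<in> product_params n d r e" "(i, False, b) \<in> product_params n d r e"
    by (auto simp: product_params_def)
  thus "(\<lambda>x. if a + b = m then x (i, True, a) * x (i, False, b) else 0) \<in> polyfun (product_params n d r e)"
    by (cases "a + b = m") (auto intro: polyfun.intros)
qed

lemma finite_product_params: "finite (product_params n d r e)"
  by (auto simp: product_params_def finite_mons)

lemma sums_of_products_forms:
  assumes "\<And>i. i < r \<Longrightarrow> e i \<le> d" shows "sums_of_products n d r e \<subseteq> forms n d"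
proof
  fix f assume "f \<in> sums_of_products n d r e"
  then obtain g h where gh: "f = (\<Sum>i<r. g i * h i)" "\<forall>i<r. g i \<in> forms n (e i) \<and> h i \<in> forms n (d - e i)"
    unfolding sums_of_products_def by blast
  show "f \<in> forms n d" unfolding gh(1)
  proof (rule forms_sum)
    fix i assume "i \<in> {..<r}"
    thus "g i * h i \<in> forms n d" using forms_mult[of "g i" n "e i" "h i" "d - e i"] gh(2) assms[of i] by simp
  qed
qed

text \<open>A nonempty open set contains a nonempty basic one, given by a single polynomial in the
coefficients.\<close>

lemma general_form_iff:
  fixes Q :: "'a::alg_closed_field mpoly \<Rightarrow> bool"
  shows "general_form n d Q \<longleftrightarrow> (\<exists>P\<in>polyfun (mons {..n} d). (\<exists>z. P z \<noteq> 0) \<and>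
    (\<forall>f\<in>forms n d. P (lkp f) \<noteq> 0 \<longrightarrow> Q f))"
proof
  let ?M = "mons {..n} d"
  have lk: "(\<lambda>v. if v \<in> ?M then lkp f v else 0) = lkp f" if "f \<in> forms n d" for f :: "'a mpoly"
    using that by (auto simp: forms_iff fun_eq_iff in_keys_iff)
  { assume "general_form n d Q"
    then obtain U where U0: "zariski_open n d U" "U \<noteq> {}" "\<forall>f\<in>U. Q f"
      unfolding general_form_def by blast
    from U0(1) obtain E where U: "U \<subseteq> forms n d"
      "forms n d - U = {f \<in> forms n d. \<forall>P \<in> E. poly_eval P (lkp f) = 0}"
      unfolding zariski_open_def zariski_closed_def by (elim conjE exE)
    from U0(2) obtain f0 where f0: "f0 \<in> U" by blast
    hence "f0 \<notin> {f \<in> forms n d. \<forall>P \<in> E. poly_eval P (lkp f) = 0}" "f0 \<in> forms n d" using U by blast+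
    then obtain P where P: "P \<in> E" "poly_eval P (lkp f0) \<noteq> 0" by blast
    let ?P = "\<lambda>c. poly_eval P (\<lambda>v. if v \<in> ?M then c v else 0)"
    have "?P (lkp f) = poly_eval P (lkp f)" if "f \<in> forms n d" for f :: "'a mpoly" using lk[OF that] by simp
    moreover have "f \<in> U" if "f \<in> forms n d" "poly_eval P (lkp f) \<noteq> 0" for f
      using that P(1) U(2) by blast
    ultimately have "?P (lkp f0) \<noteq> 0" "\<forall>f\<in>forms n d. ?P (lkp f) \<noteq> 0 \<longrightarrow> Q f"
      using P(2) \<open>f0 \<in> forms n d\<close> U0(3) by simp_all
    thus "\<exists>P\<in>polyfun ?M. (\<exists>z. P z \<noteq> 0) \<and> (\<forall>f\<in>forms n d. P (lkp f) \<noteq> 0 \<longrightarrow> Q f)"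
      by (intro bexI[of _ ?P] conjI exI[of _ "lkp f0"] poly_eval_polyfun) }
  { assume "\<exists>P\<in>polyfun ?M. (\<exists>z. P z \<noteq> 0) \<and> (\<forall>f\<in>forms n d. P (lkp f) \<noteq> 0 \<longrightarrow> Q f)"
    then obtain P z where P: "P \<in> polyfun ?M" "P z \<noteq> 0" "\<forall>f\<in>forms n d. P (lkp f) \<noteq> 0 \<longrightarrow> Q f" by blast
    obtain E where E: "\<forall>c. poly_eval E c = P c" using polyfun_imp_poly_eval[OF P(1)] by blast
    let ?U = "{f \<in> forms n d. P (lkp f) \<noteq> 0}"
    have "P (lkp (of_coords ?M z)) = P z"
      by (rule polyfun_cong[OF P(1)]) (simp add: lookup_of_coords finite_mons)
    hence "of_coords ?M z \<in> ?U" using P(2) of_coords_forms by simp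
    moreover have "zariski_open n d ?U" unfolding zariski_open_def zariski_closed_def
      by (intro conjI exI[of _ "{E}"]) (auto simp: E)
    ultimately show "general_form n d Q" unfolding general_form_def using P(3) by blast }
qed

lemma general_form_thin:
  fixes Q :: "'a::alg_closed_field mpoly \<Rightarrow> bool"
  assumes "thin (mons {..n} d) (lkp ` {f \<in> forms n d. \<not> Q f})"
  shows "general_form n d Q"
proof -
  obtain P where "P \<in> polyfun (mons {..n} d)" "\<exists>z. P z \<noteq> 0" "\<forall>f\<in>{f \<in> forms n d. \<not> Q f}. P (lkp f) = 0"
    using assms unfolding thin_def by blast
  thus ?thesis unfolding general_form_iff by (intro bexI[of _ P]) auto
qed

lemma sums_of_products_mono:
  assumes "r \<le> s" shows "sums_of_products n d r e \<subseteq> sums_of_products n d s e"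
proof
  fix f assume "f \<in> sums_of_products n d r e"
  then obtain g h where gh: "f = (\<Sum>i<r. g i * h i)" "\<forall>i<r. g i \<in> forms n (e i) \<and> h i \<in> forms n (d - e i)"
    unfolding sums_of_products_def by blast
  let ?g = "\<lambda>i. if i < r then g i else 0" and ?h = "\<lambda>i. if i < r then h i else 0"
  have "(\<Sum>i<s. ?g i * ?h i) = (\<Sum>i<r. ?g i * ?h i)"
    by (rule sum.mono_neutral_right) (use assms in auto)
  also have "\<dots> = f" unfolding gh(1) by (intro sum.cong) auto
  finally have "f = (\<Sum>i<s. ?g i * ?h i)" by simp
  moreover have "\<forall>i<s. ?g i \<in> forms n (e i) \<and> ?h i \<in> forms n (d - e i)" using gh(2) by (simp add: forms_zero)
  ultimately show "f \<in> sums_of_products n d s e" by (intro sums_of_productsI[of f ?g ?h]) blast+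
qed

text \<open>Each monomial is assigned to one of the first \<open>r\<close> variables that divides
it.\<close>

lemma sliced_by_variables:
  fixes f :: "'a::field mpoly"
  assumes r: "r \<le> Suc n" and f: "f \<in> forms n d" and ex: "\<And>m. m \<in> supp f \<Longrightarrow> \<exists>i<r. i \<in> supp m"
  shows "\<exists>h. (\<forall>i. h i \<in> forms n (d - 1)) \<and> f = (\<Sum>i<r. var i * h i)"
proof -
  let ?K = "supp f"
  have KM: "?K \<subseteq> mons {..n} d" using f by (simp add: forms_iff)
  define s where "s m = (SOME i. i < r \<and> i \<in> supp m)" for m :: "nat \<Rightarrow>\<^sub>0 nat"
  have s: "s m < r" "s m \<in> supp m" if "m \<in> ?K" for m
    using someI_ex[of "\<lambda>i. i < r \<and> i \<in> supp m"] ex[OF that] unfolding s_def by auto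
  let ?x = "\<lambda>i. Poly_Mapping.single i (1::nat)"
  have div: "m = ?x (s m) + (m - ?x (s m))" if "m \<in> ?K" for m
  proof (rule poly_mapping_eqI)
    fix i show "lkp m i = lkp (?x (s m) + (m - ?x (s m))) i"
      using s[OF that] by (auto simp: lookup_add lookup_minus lookup_single when_def in_keys_iff)
  qed
  define h where "h i = (\<Sum>m\<in>{m\<in>?K. s m = i}. Poly_Mapping.single (m - ?x (s m)) (lkp f m))" for i
  have h: "h i \<in> forms n (d - 1)" for i unfolding h_def
  proof (rule forms_sum)
    fix m assume "m \<in> {m\<in>?K. s m = i}"
    hence m: "m \<in> ?K" by simp
    have "(\<Sum>i\<le>n. lkp m i) = (\<Sum>i\<le>n. lkp (?x (s m)) i) + (\<Sum>i\<le>n. lkp (m - ?x (s m)) i)"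
      by (subst div[OF m]) (simp add: lookup_add sum.distrib)
    moreover have "(\<Sum>i\<le>n. lkp (?x (s m)) i) = 1"
      using s(1)[OF m] r by (simp add: lookup_single when_def sum.delta')
    moreover have "supp (m - ?x (s m)) \<subseteq> supp m" by (auto simp: in_keys_iff lookup_minus)
    ultimately have "m - ?x (s m) \<in> mons {..n} (d - 1)"
      using m KM by (auto simp: mons_def)
    thus "Poly_Mapping.single (m - ?x (s m)) (lkp f m) \<in> forms n (d - 1)" by (auto simp: forms_iff)
  qed
  have "f = (\<Sum>m\<in>?K. Poly_Mapping.single m (lkp f m))" by (rule poly_mapping_sum_single)
  also have "\<dots> = (\<Sum>i<r. \<Sum>m\<in>{m\<in>?K. s m = i}. Poly_Mapping.single m (lkp f m))"
    by (rule sum.group[symmetric]) (use s in auto)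
  also have "\<dots> = (\<Sum>i<r. var i * h i)"
  proof (intro sum.cong refl)
    fix i assume "i \<in> {..<r}"
    show "(\<Sum>m\<in>{m\<in>?K. s m = i}. Poly_Mapping.single m (lkp f m)) = var i * h i"
      unfolding var_def h_def sum_distrib_left
    proof (intro sum.cong refl)
      fix m assume "m \<in> {m\<in>?K. s m = i}"
      thus "Poly_Mapping.single m (lkp f m) = Poly_Mapping.single (?x i) 1 * Poly_Mapping.single (m - ?x (s m)) (lkp f m)"
        using div[of m] by (simp add: mult_single)
    qed
  qed
  finally show ?thesis using h by blast
qed

lemma var_form: "i \<le> n \<Longrightarrow> var i \<in> forms n 1"
  by (auto simp: forms_iff var_def mons_def lookup_single when_def sum.delta')

lemma forms_all_sliced:
  fixes f :: "'a::field mpoly"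
  assumes "d \<ge> 1" "f \<in> forms n d"
  shows "f \<in> sums_of_products n d (Suc n) (\<lambda>_. 1)"
proof -
  have "\<exists>i<Suc n. i \<in> supp m" if "m \<in> supp f" for m
  proof (rule ccontr)
    assume no: "\<not> ?thesis"
    have m: "m \<in> mons {..n} d" using assms(2) that by (auto simp: forms_iff)
    hence "\<forall>i\<le>n. lkp m i = 0" using no by (auto simp: in_keys_iff less_Suc_eq_le)
    thus False using m assms(1) by (simp add: mons_def)
  qed
  from sliced_by_variables[OF order_refl assms(2) this] obtain h where
    h: "\<forall>i. h i \<in> forms n (d - 1)" "f = (\<Sum>i<Suc n. var i * h i)" by blast
  have "var i \<in> (forms n 1 :: 'a mpoly set)" if "i < Suc n" for i using that by (intro var_form) simp
  thus ?thesis using h by (intro sums_of_productsI[of f var h]) blast+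
qed

lemma slice_rank_eq: "slice_rank n d f = (LEAST r. f \<in> sums_of_products n d r (\<lambda>_. 1))"
  unfolding slice_rank_def sums_of_products_def by (intro arg_cong[of _ _ Least] ext) auto

definition slice_dense :: "'a::field itself \<Rightarrow> nat \<Rightarrow> nat \<Rightarrow> nat \<Rightarrow> bool" where
  "slice_dense _ n d r \<longleftrightarrow> \<not> thin (mons {..n} d) (lkp ` (sums_of_products n d r (\<lambda>_. 1) :: 'a mpoly set))"

text \<open>Let \<open>r\<close> be least with \<open>slice_dense\<close>. Slice rank at most
\<open>r\<close> then holds on a nonempty open set, because a dense image contains one; slice rank
less than \<open>r\<close> fails on a nonempty open set by minimality. So \<open>r\<close> is the
slice rank on a nonempty open set, and no other number is, since two such sets meet.\<close>

lemma generic_slice_rank_eq: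
  assumes d: "d \<ge> 1"
  shows "generic_slice_rank TYPE('a::alg_closed_field) n d = (LEAST r. slice_dense TYPE('a) n d r) \<and>
    slice_dense TYPE('a) n d (LEAST r. slice_dense TYPE('a) n d r) \<and>
    (LEAST r. slice_dense TYPE('a) n d r) \<le> n + 1"
proof -
  let ?M = "mons {..n} d"
  let ?W = "\<lambda>r. sums_of_products n d r (\<lambda>_. 1) :: 'a mpoly set"
  have ex: "slice_dense TYPE('a) n d (Suc n)"
  proof (unfold slice_dense_def, rule notI)
    assume "thin ?M (lkp ` ?W (Suc n))"
    then obtain P z where P: "P \<in> polyfun ?M" "P z \<noteq> 0" "\<forall>f\<in>?W (Suc n). P (lkp f) = 0" unfolding thin_def by blast
    have "P (lkp (of_coords ?M z)) = P z"
      by (rule polyfun_cong[OF P(1)]) (simp add: lookup_of_coords finite_mons)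
    moreover have "of_coords ?M z \<in> ?W (Suc n)" by (intro forms_all_sliced d of_coords_forms)
    ultimately show False using P by auto
  qed
  define r where "r = (LEAST r. slice_dense TYPE('a) n d r)"
  have r: "slice_dense TYPE('a) n d r" unfolding r_def using ex by (rule LeastI)
  have le: "r \<le> Suc n" unfolding r_def using ex by (rule Least_le)
  have lt: "thin ?M (lkp ` ?W s)" if "s < r" for s
    using not_less_Least[of s "slice_dense TYPE('a) n d"] that unfolding r_def slice_dense_def by blast
  let ?F = "product_coords n d r (\<lambda>_. 1) :: (nat \<times> bool \<times> (nat \<Rightarrow>\<^sub>0 nat) \<Rightarrow> 'a) \<Rightarrow> _"
  have "\<not> thin ?M (range ?F)"
  proof
    assume "thin ?M (range ?F)"
    moreover have "lkp ` ?W r \<subseteq> range ?F"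
    proof
      fix y assume "y \<in> lkp ` ?W r"
      then obtain f where f: "f \<in> ?W r" "y = lkp f" by blast
      obtain x where "lkp f = ?F x" using sums_of_products_coords[OF f(1)] by blast
      thus "y \<in> range ?F" using f(2) by simp
    qed
    ultimately show False using r thin_subset unfolding slice_dense_def by blast
  qed
  \<comment> \<open>an open set of forms of slice rank at most \<open>r\<close>\<close>
  from image_contains_open[OF finite_product_params product_coords_polyfun this]
  obtain U where "U\<in>polyfun ?M" "\<exists>y. U y \<noteq> 0" and Uim: "\<forall>y. U y \<noteq> 0 \<longrightarrow> (\<exists>x. \<forall>m\<in>?M. ?F x m = y m)" by blast
  then obtain y where U: "U \<in> polyfun ?M" "U y \<noteq> 0" by blast
  have Ur: "f \<in> ?W r" if f: "f \<in> forms n d" "U (lkp f) \<noteq> 0" for f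
  proof -
    obtain x where x: "\<forall>m\<in>?M. ?F x m = lkp f m" using Uim f(2) by blast
    obtain f' where f': "f' \<in> ?W r" "lkp f' = ?F x" using product_coords_realized[of n d r "\<lambda>_. 1" x] by blast
    have "?W r \<subseteq> forms n d" by (rule sums_of_products_forms) (use d in auto)
    hence f'F: "f' \<in> forms n d" using f'(1) by blast
    have "f' = f"
    proof (rule poly_mapping_eqI)
      fix m show "lkp f' m = lkp f m"
      proof (cases "m \<in> ?M")
        case True thus ?thesis using x f' by simp
      next
        case False
        hence "m \<notin> supp f" "m \<notin> supp f'" using f f'F by (auto simp: forms_iff)
        thus ?thesis by (simp add: in_keys_iff)
      qed
    qed
    thus ?thesis using f' by simp
  qed
  \<comment> \<open>an open set of forms of slice rank at least \<open>r\<close>\<close>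
  have "\<exists>P\<in>polyfun ?M. (\<exists>z. P z \<noteq> 0) \<and> (\<forall>s<r. \<forall>f\<in>?W s. P (lkp f) = 0)"
  proof (cases "r = 0")
    case True
    thus ?thesis by (intro bexI[of _ "\<lambda>_. 1"]) (auto intro: polyfun.intros)
  next
    case False
    then obtain P where "P\<in>polyfun ?M" "\<exists>z. P z \<noteq> 0" "\<forall>f\<in>?W (r - 1). P (lkp f) = 0"
      using lt[of "r - 1"] unfolding thin_def by auto
    moreover have "?W s \<subseteq> ?W (r - 1)" if "s < r" for s using that by (intro sums_of_products_mono) simp
    ultimately show ?thesis by blast
  qed
  then obtain P z where P: "P \<in> polyfun ?M" "P z \<noteq> 0" "\<forall>s<r. \<forall>f\<in>?W s. P (lkp f) = 0" by blast
  have "\<exists>t. U (\<lambda>v. y v + t * (z v - y v)) \<noteq> 0 \<and> P (\<lambda>v. y v + t * (z v - y v)) \<noteq> 0"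
    by (rule polyfun_mult_nonzero[of U ?M P y z]) (fact U P)+
  then obtain t where t: "U (\<lambda>v. y v + t * (z v - y v)) \<noteq> 0 \<and> P (\<lambda>v. y v + t * (z v - y v)) \<noteq> 0" ..
  define w where "w = (\<lambda>v. y v + t * (z v - y v))"
  have UP: "(\<lambda>x. U x * P x) \<in> polyfun ?M" "U w * P w \<noteq> 0" using U P t by (auto intro: polyfun_mult simp: w_def)
  have rank: "slice_rank n d f = r" if f: "f \<in> forms n d" "U (lkp f) * P (lkp f) \<noteq> 0" for f
    unfolding slice_rank_eq
  proof (rule Least_equality)
    show "f \<in> ?W r" using Ur f by simp
    fix s assume "f \<in> ?W s"
    thus "r \<le> s" using P(3) f(2) by (metis mult_zero_right not_le)
  qed
  have gen: "general_form n d (\<lambda>f :: 'a mpoly. slice_rank n d f = r)"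
    unfolding general_form_iff using UP rank by (intro bexI[of _ "\<lambda>x. U x * P x"] conjI exI[of _ w]) auto
  have "generic_slice_rank TYPE('a) n d = r"
    unfolding generic_slice_rank_def
  proof (rule the_equality)
    show "general_form n d (\<lambda>f :: 'a mpoly. slice_rank n d f = r)" by (rule gen)
    fix s assume "general_form n d (\<lambda>f :: 'a mpoly. slice_rank n d f = s)"
    then obtain Q q where Q: "Q \<in> polyfun ?M" "Q q \<noteq> 0"
      "\<forall>f\<in>forms n d. Q (lkp f) \<noteq> 0 \<longrightarrow> slice_rank n d (f :: 'a mpoly) = s"
      unfolding general_form_iff by blast
    let ?UP = "\<lambda>x. U x * P x"
    have "\<exists>t. ?UP (\<lambda>v. w v + t * (q v - w v)) \<noteq> 0 \<and> Q (\<lambda>v. w v + t * (q v - w v)) \<noteq> 0"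
      by (rule polyfun_mult_nonzero[of ?UP ?M Q w q]) (fact UP Q)+
    then obtain t where t: "?UP (\<lambda>v. w v + t * (q v - w v)) \<noteq> 0 \<and> Q (\<lambda>v. w v + t * (q v - w v)) \<noteq> 0" ..
    define c where "c = (\<lambda>v. w v + t * (q v - w v))"
    have c: "U c * P c \<noteq> 0" "Q c \<noteq> 0" using t by (auto simp: c_def)
    define f where "f = of_coords ?M c"
    have f: "f \<in> forms n d" unfolding f_def by (rule of_coords_forms)
    have co: "lkp f m = c m" if "m \<in> ?M" for m using that by (simp add: f_def lookup_of_coords finite_mons)
    have "U (lkp f) * P (lkp f) = U c * P c"
      by (rule polyfun_cong[OF UP(1)]) (rule co)
    moreover have "Q (lkp f) = Q c" by (rule polyfun_cong[OF Q(1)]) (rule co)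
    ultimately show "s = r" using rank[OF f] Q(3) f c by simp
  qed
  thus ?thesis using r le unfolding r_def by simp
qed

section \<open>Counting monomials\<close>

definition ind_fps :: "nat set \<Rightarrow> nat fps" where "ind_fps A = Abs_fps (\<lambda>j. if j \<in> A then 1 else 0)"

definition boxed :: "nat set \<Rightarrow> (nat \<Rightarrow> nat set) \<Rightarrow> nat \<Rightarrow> (nat \<Rightarrow>\<^sub>0 nat) set" where
  "boxed Y A d = {m \<in> mons Y d. \<forall>i\<in>Y. lkp m i \<in> A i}"

text \<open>The generating function of monomials with restricted exponents is the product of the
generating functions of the single exponents.\<close>

lemma card_boxed:
  assumes "finite Y"
  shows "card (boxed Y A d) = fps_nth (\<Prod>i\<in>Y. ind_fps (A i)) d"
  using assms
proof (induction Y arbitrary: d rule: finite_induct)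
  case empty
  have "boxed {} A d = (if d = 0 then {0} else {})" by (auto simp: boxed_def mons_def)
  thus ?case by simp
next
  case (insert y Y)
  let ?f = "\<lambda>j (m :: nat \<Rightarrow>\<^sub>0 nat). m + Poly_Mapping.single y j"
  have eq: "boxed (insert y Y) A d = (\<Union>j\<in>{j\<in>{..d}. j \<in> A y}. ?f j ` boxed Y A (d - j))"
  proof (intro equalityI subsetI)
    fix m assume m: "m \<in> boxed (insert y Y) A d"
    let ?m = "m - Poly_Mapping.single y (lkp m y)"
    have lk: "lkp ?m i = (if i = y then 0 else lkp m i)" for i by (auto simp: lookup_minus lookup_single when_def)
    have "m = ?f (lkp m y) ?m" by (rule poly_mapping_eqI) (auto simp: lookup_add lk lookup_single when_def)
    moreover have "lkp m y \<le> d" "lkp m y \<in> A y" using m insert.hyps by (auto simp: boxed_def mons_def)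
    moreover have "?m \<in> boxed Y A (d - lkp m y)"
    proof -
      have "(\<Sum>i\<in>Y. lkp ?m i) = (\<Sum>i\<in>Y. lkp m i)" using insert.hyps by (intro sum.cong) (auto simp: lk)
      also have "\<dots> = d - lkp m y" using m insert.hyps by (auto simp: boxed_def mons_def)
      finally have "(\<Sum>i\<in>Y. lkp ?m i) = d - lkp m y" .
      moreover have "supp ?m \<subseteq> Y"
      proof
        fix i assume "i \<in> supp ?m"
        hence "i \<in> supp m" "i \<noteq> y" by (auto simp: in_keys_iff lk split: if_splits)
        thus "i \<in> Y" using m by (auto simp: boxed_def mons_def)
      qed
      moreover have "\<forall>i\<in>Y. lkp ?m i \<in> A i" using m insert.hyps by (auto simp: boxed_def lk)
      ultimately show ?thesis by (auto simp: boxed_def mons_def)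
    qed
    ultimately show "m \<in> (\<Union>j\<in>{j\<in>{..d}. j \<in> A y}. ?f j ` boxed Y A (d - j))" by blast
  next
    fix m assume "m \<in> (\<Union>j\<in>{j\<in>{..d}. j \<in> A y}. ?f j ` boxed Y A (d - j))"
    then obtain j m' where j: "j \<le> d" "j \<in> A y" "m' \<in> boxed Y A (d - j)" "m = ?f j m'" by blast
    have y0: "lkp m' y = 0" using j insert.hyps by (auto simp: boxed_def mons_def in_keys_iff)
    have lk: "lkp m i = (if i = y then j else lkp m' i)" for i using y0 j by (auto simp: lookup_add lookup_single when_def)
    have "(\<Sum>i\<in>Y. lkp m i) = (\<Sum>i\<in>Y. lkp m' i)" using insert.hyps by (intro sum.cong) (auto simp: lk)
    also have "\<dots> = d - j" using j by (auto simp: boxed_def mons_def)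
    finally have "(\<Sum>i\<in>insert y Y. lkp m i) = d" using insert.hyps j(1) lk[of y] by simp
    moreover have "supp m \<subseteq> insert y Y"
    proof
      fix i assume "i \<in> supp m"
      hence "i \<in> supp m' \<or> i = y" by (auto simp: in_keys_iff lk split: if_splits)
      thus "i \<in> insert y Y" using j by (auto simp: boxed_def mons_def)
    qed
    moreover have "\<forall>i\<in>insert y Y. lkp m i \<in> A i" unfolding lk using j by (auto simp: boxed_def)
    ultimately show "m \<in> boxed (insert y Y) A d" by (auto simp: boxed_def mons_def)
  qed
  have fin: "finite (boxed Y A k)" for k using finite_mons[OF insert.hyps(1)] by (auto simp: boxed_def intro: rev_finite_subset)
  have inj: "inj_on (?f j) B" for j B by (rule inj_onI) simp
  have disj: "?f j ` boxed Y A (d - j) \<inter> ?f k ` boxed Y A (d - k) = {}" if "j \<noteq> k" for j k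
  proof -
    have y0: "lkp m y = 0" if "m \<in> boxed Y A l" for m l using that insert.hyps by (auto simp: boxed_def mons_def in_keys_iff)
    have "lkp (?f j m) y = j" if "m \<in> boxed Y A l" for m j l using y0[OF that] by (simp add: lookup_add)
    thus ?thesis using that by (metis (no_types, lifting) disjoint_iff imageE)
  qed
  have "card (boxed (insert y Y) A d) = (\<Sum>j\<in>{j\<in>{..d}. j \<in> A y}. card (?f j ` boxed Y A (d - j)))"
    unfolding eq by (rule card_UN_disjoint) (use fin disj in auto)
  also have "\<dots> = (\<Sum>j\<in>{j\<in>{..d}. j \<in> A y}. fps_nth (\<Prod>i\<in>Y. ind_fps (A i)) (d - j))"
    by (intro sum.cong refl) (simp add: card_image[OF inj] insert.IH)
  also have "\<dots> = (\<Sum>j\<in>{0..d}. fps_nth (ind_fps (A y)) j * fps_nth (\<Prod>i\<in>Y. ind_fps (A i)) (d - j))"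
    by (rule sum.mono_neutral_cong_left) (auto simp: ind_fps_def)
  finally show ?case using insert.hyps by (simp add: fps_mult_nth)
qed

text \<open>The series \<open>1/(1 - X)\<close>. Coefficients in the natural numbers keep all
comparisons below free of subtraction and division.\<close>

definition geo :: "nat fps" where "geo = ind_fps UNIV"

lemma geo_mult: "fps_nth (f * geo) m = (\<Sum>j\<le>m. fps_nth f j)"
  by (simp add: fps_mult_nth geo_def ind_fps_def atMost_atLeast0)

lemma geo_power: "fps_nth (geo ^ c) d = (c + d - 1) choose d"
proof (induction c arbitrary: d)
  case 0 show ?case by (cases d) auto
next
  case (Suc c)
  have "fps_nth (geo ^ Suc c) d = (\<Sum>j\<le>d. (c + j - 1) choose j)"
    using geo_mult[of "geo ^ c" d] Suc by (simp add: mult.commute)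
  also have "\<dots> = (c + d) choose d"
  proof (cases c)
    case 0
    have "(\<Sum>j\<le>d. (j - 1) choose j) = (\<Sum>j\<le>d. if j = 0 then 1 else 0::nat)" by (intro sum.cong) auto
    thus ?thesis using 0 by simp
  next
    case (Suc c')
    thus ?thesis using sum_choose_lower[of c' d] by simp
  qed
  finally show ?case by simp
qed

lemma card_mons: assumes "finite Y" shows "card (mons Y d) = (card Y + d - 1) choose d"
proof -
  have "mons Y d = boxed Y (\<lambda>_. UNIV) d" by (auto simp: boxed_def)
  thus ?thesis using card_boxed[OF assms, of "\<lambda>_. UNIV" d] by (simp add: geo_def[symmetric] geo_power)
qed

text \<open>The series \<open>X + X^2 + \<dots> + X^(k - 1)\<close> counts the admissible exponents
of a variable that does occur, when its \<open>k\<close>-th power is excluded.\<close>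

definition blk :: "nat \<Rightarrow> nat fps" where "blk k = ind_fps {1..<k}"

lemma box_eq: "k \<ge> 1 \<Longrightarrow> ind_fps {..<k} = blk k + 1"
  by (rule fps_ext) (auto simp: blk_def ind_fps_def)

text \<open>The coefficient of \<open>X^(m - k)\<close> with a genuine difference: it is 0 when
\<open>k\<close> exceeds \<open>m\<close>.\<close>

definition shifted :: "nat fps \<Rightarrow> nat \<Rightarrow> nat \<Rightarrow> nat" where
  "shifted f m k = (if k \<le> m then fps_nth f (m - k) else 0)"

lemma shifted_geo: assumes "m \<le> d" shows "shifted (f * geo) m k = (\<Sum>j=k..d. shifted f m j)"
proof (cases "k \<le> m")
  case True
  have "shifted (f * geo) m k = (\<Sum>i\<le>m - k. fps_nth f i)" using True by (simp add: shifted_def geo_mult)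
  also have "\<dots> = (\<Sum>j=k..m. fps_nth f (m - j))"
    by (rule sum.reindex_bij_witness[of _ "\<lambda>j. m - j" "\<lambda>j. m - j"]) (use True in auto)
  also have "\<dots> = (\<Sum>j=k..d. shifted f m j)"
    by (rule sum.mono_neutral_cong_left) (use assms in \<open>auto simp: shifted_def\<close>)
  finally show ?thesis .
next
  case False
  thus ?thesis by (simp add: shifted_def)
qed

text \<open>A coefficient of \<open>f * geo\<close> is the sum of the coefficients of
\<open>f\<close> up to that index, that is, of all shifts of the original coefficient. Summing an
inequality that is known for all shifts therefore gives it for one more factor \<open>geo\<close>,
again for all shifts.\<close>

lemma shift_ineq:
  fixes f g :: "'c \<Rightarrow> nat fps"
  assumes initial: "\<And>k. (\<Sum>t\<in>I. shifted (f t * geo ^ c0) (m t) k) \<le> (\<Sum>t\<in>J. shifted (g t * geo ^ c0) (m' t) k)"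
    and m: "\<And>t. t \<in> I \<Longrightarrow> m t \<le> d" "\<And>t. t \<in> J \<Longrightarrow> m' t \<le> d" and c: "c0 \<le> c"
  shows "(\<Sum>t\<in>I. shifted (f t * geo ^ c) (m t) k) \<le> (\<Sum>t\<in>J. shifted (g t * geo ^ c) (m' t) k)"
  using c
proof (induction c arbitrary: k rule: dec_induct)
  case base thus ?case by (rule assms(1))
next
  case (step c)
  have e: "(\<Sum>t\<in>I. shifted (f t * geo ^ Suc c) (m t) k) = (\<Sum>j=k..d. \<Sum>t\<in>I. shifted (f t * geo ^ c) (m t) j)"
    if "\<And>t. t \<in> I \<Longrightarrow> m t \<le> d" for I :: "'c set" and f :: "'c \<Rightarrow> nat fps" and m :: "'c \<Rightarrow> nat"
  proof -
    have "(\<Sum>t\<in>I. shifted (f t * geo ^ Suc c) (m t) k) = (\<Sum>t\<in>I. \<Sum>j=k..d. shifted (f t * geo ^ c) (m t) j)"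
    proof (intro sum.cong refl)
      fix t assume "t \<in> I"
      have "f t * geo ^ Suc c = f t * geo ^ c * geo" by (simp add: mult_ac)
      thus "shifted (f t * geo ^ Suc c) (m t) k = (\<Sum>j=k..d. shifted (f t * geo ^ c) (m t) j)"
        using shifted_geo[OF that[OF \<open>t \<in> I\<close>]] by simp
    qed
    thus ?thesis by (simp add: sum.swap[of _ I])
  qed
  have "(\<Sum>j=k..d. \<Sum>t\<in>I. shifted (f t * geo ^ c) (m t) j) \<le> (\<Sum>j=k..d. \<Sum>t\<in>J. shifted (g t * geo ^ c) (m' t) j)"
    by (rule sum_mono) (rule step.IH)
  thus ?case using e[of I m f] e[of J m' g] m by simp
qed

text \<open>Ten coefficients suffice because degrees up to 9 occur.\<close>

definition tabulates :: "nat fps \<Rightarrow> int list \<Rightarrow> bool" where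
  "tabulates f L \<longleftrightarrow> length L = 10 \<and> (\<forall>j<10. L ! j = int (fps_nth f j))"

text \<open>\<open>step2\<close>, \<open>step3\<close> and \<open>step4\<close> multiply a table by
\<open>blk 2\<close>, \<open>blk 3\<close> and \<open>blk 4\<close>, carrying along the last one,
two or three entries; starting values are 0.\<close>

fun step2 :: "int \<Rightarrow> int list \<Rightarrow> int list" where
  "step2 q [] = []" | "step2 q (x # xs) = q # step2 x xs"
fun step3 :: "int \<Rightarrow> int \<Rightarrow> int list \<Rightarrow> int list" where
  "step3 p q [] = []" | "step3 p q (x # xs) = (p + q) # step3 q x xs"
fun step4 :: "int \<Rightarrow> int \<Rightarrow> int \<Rightarrow> int list \<Rightarrow> int list" where
  "step4 l p q [] = []" | "step4 l p q (x # xs) = (l + p + q) # step4 p q x xs"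

lemma length_step [simp]: "length (step2 q L) = length L" "length (step3 p q L) = length L" "length (step4 l p q L) = length L"
  by (induction L arbitrary: l p q) auto

lemma step2_nth: "j < length L \<Longrightarrow> step2 q L ! j = (q # L) ! j"
  by (induction L arbitrary: q j) (auto simp: nth_Cons split: nat.splits)

lemma step3_nth: "j < length L \<Longrightarrow> step3 p q L ! j = (p # q # L) ! j + (q # L) ! j"
  by (induction L arbitrary: p q j) (auto simp: nth_Cons split: nat.splits)

lemma step4_nth: "j < length L \<Longrightarrow> step4 l p q L ! j = (l # p # q # L) ! j + (p # q # L) ! j + (q # L) ! j"
  by (induction L arbitrary: l p q j) (auto simp: nth_Cons split: nat.splits)

lemma blk_mult_nth:
  "fps_nth (blk 2 * f) j = (if j < 1 then 0 else fps_nth f (j - 1))"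
  "fps_nth (blk 3 * f) j = (if j < 2 then 0 else fps_nth f (j - 2)) + (if j < 1 then 0 else fps_nth f (j - 1))"
  "fps_nth (blk 4 * f) j = (if j < 3 then 0 else fps_nth f (j - 3)) + (if j < 2 then 0 else fps_nth f (j - 2)) +
     (if j < 1 then 0 else fps_nth f (j - 1))"
proof -
  have "blk 2 = fps_X ^ 1" "blk 3 = fps_X ^ 2 + fps_X ^ 1" "blk 4 = fps_X ^ 3 + fps_X ^ 2 + fps_X ^ 1"
    by (rule fps_ext; auto simp: blk_def ind_fps_def fps_X_power_nth simp del: power_one_right)+
  thus "fps_nth (blk 2 * f) j = (if j < 1 then 0 else fps_nth f (j - 1))"
    "fps_nth (blk 3 * f) j = (if j < 2 then 0 else fps_nth f (j - 2)) + (if j < 1 then 0 else fps_nth f (j - 1))"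
    "fps_nth (blk 4 * f) j = (if j < 3 then 0 else fps_nth f (j - 3)) + (if j < 2 then 0 else fps_nth f (j - 2)) +
     (if j < 1 then 0 else fps_nth f (j - 1))"
    by (simp_all only: distrib_right fps_add_nth fps_X_power_mult_nth)
qed

lemma tabulates_blk: assumes "tabulates f L" shows "tabulates (blk 2 * f) (step2 0 L)" "tabulates (blk 3 * f) (step3 0 0 L)" "tabulates (blk 4 * f) (step4 0 0 0 L)"
  using assms unfolding tabulates_def blk_mult_nth
  by (auto simp: step2_nth step3_nth step4_nth nth_Cons numeral_2_eq_2 numeral_3_eq_3 split: nat.splits)

fun times2 :: "nat \<Rightarrow> int list \<Rightarrow> int list" where "times2 0 L = L" | "times2 (Suc k) L = times2 k (step2 0 L)"
fun times3 :: "nat \<Rightarrow> int list \<Rightarrow> int list" where "times3 0 L = L" | "times3 (Suc k) L = times3 k (step3 0 0 L)"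
fun times4 :: "nat \<Rightarrow> int list \<Rightarrow> int list" where "times4 0 L = L" | "times4 (Suc k) L = times4 k (step4 0 0 0 L)"

lemma times_numeral: "times2 (numeral v) L = times2 (pred_numeral v) (step2 0 L)"
  "times3 (numeral v) L = times3 (pred_numeral v) (step3 0 0 L)"
  "times4 (numeral v) L = times4 (pred_numeral v) (step4 0 0 0 L)"
  by (simp_all add: numeral_eq_Suc)

definition table :: "int list \<Rightarrow> nat \<Rightarrow> nat \<Rightarrow> nat \<Rightarrow> int list" where
  "table L a b w = times2 a (times3 b (times4 w L))"

lemma tabulates_table: assumes "tabulates f L" shows "tabulates (blk 2 ^ a * blk 3 ^ b * blk 4 ^ w * f) (table L a b w)"
proof -
  have 4: "tabulates (blk 4 ^ w * f) (times4 w L)" if "tabulates f L" for f L using that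
    by (induction w arbitrary: f L) (auto simp: power_Suc2 mult.assoc simp del: power_Suc dest: tabulates_blk(3))
  have 3: "tabulates (blk 3 ^ b * f) (times3 b L)" if "tabulates f L" for f L using that
    by (induction b arbitrary: f L) (auto simp: power_Suc2 mult.assoc simp del: power_Suc dest: tabulates_blk(2))
  have 2: "tabulates (blk 2 ^ a * f) (times2 a L)" if "tabulates f L" for f L using that
    by (induction a arbitrary: f L) (auto simp: power_Suc2 mult.assoc simp del: power_Suc dest: tabulates_blk(1))
  show ?thesis unfolding table_def mult.assoc by (intro 2 3 4 assms)
qed

definition tcoeff :: "int list \<Rightarrow> nat \<Rightarrow> nat \<Rightarrow> int" where "tcoeff L m k = (if k \<le> m then L ! (m - k) else 0)"

lemma tabulates_coeff: "tabulates f L \<Longrightarrow> m < 10 \<Longrightarrow> int (shifted f m k) = tcoeff L m k"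
  by (auto simp: tabulates_def shifted_def tcoeff_def)

text \<open>The comparison for a set \<open>T\<close> with \<open>a\<close>, \<open>b\<close>,
\<open>w\<close> elements of degree 2, 3, 4, by tables: \<open>h\<close> belongs to
\<open>T\<close>, and \<open>ha\<close>, \<open>hb\<close>, \<open>hw\<close> to \<open>T\<close>
with one element of degree 2, 3, 4 removed. Shifts beyond 4 are trivial, since the degrees on the
left are at most 4.\<close>

definition support_test :: "nat \<Rightarrow> nat \<Rightarrow> nat \<Rightarrow> nat \<Rightarrow> int list \<Rightarrow> int list \<Rightarrow> int list \<Rightarrow> int list \<Rightarrow> bool" where
  "support_test d a b w h ha hb hw \<longleftrightarrow> list_all (\<lambda>k.
     int a * (tcoeff h 2 k + tcoeff ha 2 k) + int b * (tcoeff h 3 k + tcoeff hb 3 k) + int w * (tcoeff h 4 k + tcoeff hw 4 k)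
       \<le> tcoeff h d k + (if a + b + w = 2 \<and> k = 0 then 2 else 0)) [0,1,2,3,4]"

text \<open>For \<open>|T| > 5\<close> the left side vanishes, because each element of \<open>T -
{i}\<close> contributes at least 1 to the degree and the degrees are at most 4. Since
\<open>e\<^sub>i \<le> d/2\<close>, the value 3 needs \<open>d \<ge> 6\<close>, and the value 4
occurs only for \<open>d = 9\<close>, as \<open>d\<close> is one of 4, 5, 6, 7, 9.\<close>

definition support_check_at :: "nat \<Rightarrow> int list \<Rightarrow> nat \<Rightarrow> nat \<Rightarrow> nat \<Rightarrow> bool" where
  "support_check_at d L a b w \<longleftrightarrow> (if 2 \<le> a + b + w \<and> a + b + w \<le> 5 \<and> (d \<le> 5 \<longrightarrow> b = 0) \<and> (d \<le> 8 \<longrightarrow> w = 0)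
     then support_test d a b w (table L a b w) (table L (a - 1) b w) (table L a (b - 1) w) (table L a b (w - 1)) else True)"

definition support_check :: "nat \<Rightarrow> int list \<Rightarrow> bool" where
  "support_check d L \<longleftrightarrow> list_all (\<lambda>a. list_all (\<lambda>b. list_all (\<lambda>w. support_check_at d L a b w)
     [0,1,2,3,4,5]) [0,1,2,3,4,5]) [0,1,2,3,4,5]"

text \<open>\<open>base2\<close> and \<open>base3\<close> list the first coefficients of \<open>geo
^ 2\<close> and \<open>geo ^ 3\<close>.\<close>

definition base2 :: "int list" where "base2 = [1,2,3,4,5,6,7,8,9,10]"
definition base3 :: "int list" where "base3 = [1,3,6,10,15,21,28,36,45,55]"

section \<open>Comparison of codimensions\<close>

lemmas support_check_simps = support_check_def support_check_at_def support_test_def table_def times_numeral tcoeff_def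

lemma support_checks: "support_check 4 base3" "support_check 5 base2" "support_check 6 base2" "support_check 7 base2" "support_check 9 base2"
  unfolding base2_def base3_def by (simp_all add: support_check_simps)

lemma tabulates_base: "tabulates (geo ^ 2) base2" "tabulates (geo ^ 3) base3"
  unfolding tabulates_def geo_power base2_def base3_def by (auto simp: eval_nat_numeral less_Suc_eq)

definition start_table :: "nat \<Rightarrow> int list" where "start_table d = (if d = 4 then base3 else base2)"
text \<open>For \<open>d = 4\<close> and \<open>c = 2\<close> the comparison fails: two quadrics
give 16 on both sides. So quartics start at \<open>c = 3\<close>.\<close>

definition start_dim :: "nat \<Rightarrow> nat" where "start_dim d = (if d = 4 then 3 else 2)"

lemma tabulates_start: "tabulates (geo ^ start_dim d) (start_table d)"
  using tabulates_base by (simp add: start_dim_def start_table_def)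

lemma support_check_start: "d \<in> {4, 5, 6, 7, 9} \<Longrightarrow> support_check d (start_table d)"
  using support_checks by (auto simp: start_table_def)

lemma support_checkD:
  assumes "support_check d L" "2 \<le> a + b + w" "a + b + w \<le> 5" "d \<le> 5 \<longrightarrow> b = 0" "d \<le> 8 \<longrightarrow> w = 0" "k \<le> 4"
  shows "int a * (tcoeff (table L a b w) 2 k + tcoeff (table L (a - 1) b w) 2 k)
    + int b * (tcoeff (table L a b w) 3 k + tcoeff (table L a (b - 1) w) 3 k)
    + int w * (tcoeff (table L a b w) 4 k + tcoeff (table L a b (w - 1)) 4 k)
    \<le> tcoeff (table L a b w) d k + (if a + b + w = 2 \<and> k = 0 then 2 else 0)"
proof -
  have *: "x \<in> set [0,1,2,3,4,5::nat]" if "x \<le> 5" for x using that by (auto simp: eval_nat_numeral le_Suc_eq)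
  have "\<forall>a\<in>set [0,1,2,3,4,5]. \<forall>b\<in>set [0,1,2,3,4,5]. \<forall>w\<in>set [0,1,2,3,4,5]. support_check_at d L a b w"
    using assms(1) unfolding support_check_def list_all_iff .
  moreover have "a \<le> 5" "b \<le> 5" "w \<le> 5" using assms(3) by linarith+
  ultimately have "support_check_at d L a b w" using * by blast
  moreover have "k \<in> set [0,1,2,3,4::nat]" using assms(6) by (auto simp: eval_nat_numeral le_Suc_eq)
  moreover have "support_test d a b w (table L a b w) (table L (a - 1) b w) (table L a (b - 1) w) (table L a b (w - 1))"
    using \<open>support_check_at d L a b w\<close> assms(2-5) unfolding support_check_at_def by (simp only: if_True simp_thms)
  ultimately show ?thesis unfolding support_test_def list_all_iff by (blast dest: bspec)
qed

lemma prod_blk: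
  assumes "finite T" "\<And>i. i \<in> T \<Longrightarrow> e i \<in> {2, 3, 4}"
  shows "(\<Prod>i\<in>T. blk (e i)) = blk 2 ^ card {i\<in>T. e i = 2} * blk 3 ^ card {i\<in>T. e i = 3} * blk 4 ^ card {i\<in>T. e i = 4}"
proof -
  have "(\<Prod>i\<in>T. blk (e i)) = (\<Prod>v\<in>{2, 3, 4}. \<Prod>i\<in>{i\<in>T. e i = v}. blk (e i))"
    by (rule prod.group[symmetric]) (use assms in auto)
  thus ?thesis by (simp add: mult.assoc)
qed

lemma sum_values:
  assumes "finite T" "\<And>i. i \<in> T \<Longrightarrow> e i \<in> {2, 3, 4::nat}" "\<And>i. i \<in> T \<Longrightarrow> f i = F (e i)"
  shows "(\<Sum>i\<in>T. f i) = int (card {i\<in>T. e i = 2}) * F 2 + int (card {i\<in>T. e i = 3}) * F 3 + int (card {i\<in>T. e i = 4}) * F 4"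
proof -
  have "(\<Sum>i\<in>T. f i) = (\<Sum>v\<in>{2, 3, 4}. \<Sum>i\<in>{i\<in>T. e i = v}. f i)"
    by (rule sum.group[symmetric]) (use assms in auto)
  also have "\<dots> = (\<Sum>v\<in>{2, 3, 4}. \<Sum>i\<in>{i\<in>T. e i = v}. F v)" using assms(3) by (intro sum.cong refl) auto
  finally show ?thesis by simp
qed

lemma prod_blk_low:
  assumes "finite T" "m < card T" shows "fps_nth ((\<Prod>i\<in>T. blk (e i)) * f) m = 0"
  using assms
proof (induction T arbitrary: m rule: finite_induct)
  case (insert x T)
  have "fps_nth (blk (e x)) 0 = 0" by (simp add: blk_def ind_fps_def)
  moreover have "fps_nth ((\<Prod>i\<in>T. blk (e i)) * f) (m - j) = 0" if "j \<noteq> 0" "j \<le> m" for j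
    using insert that by (intro insert.IH) auto
  ultimately have "fps_nth (blk (e x) * ((\<Prod>i\<in>T. blk (e i)) * f)) m = 0"
    unfolding fps_mult_nth[of "blk (e x)"] by (intro sum.neutral ballI) (metis atLeastAtMost_iff mult_eq_0_iff)
  thus ?case using insert.hyps by (simp add: mult.assoc)
qed simp

lemma support_ineq_start:
  assumes d: "d \<in> {4, 5, 6, 7, 9}" and T: "finite T" "2 \<le> card T"
    and e: "\<And>i. i \<in> T \<Longrightarrow> 2 \<le> e i \<and> e i \<le> d div 2"
  shows "(\<Sum>i\<in>T. shifted ((\<Prod>i\<in>T. blk (e i)) * geo ^ start_dim d) (e i) k + shifted ((\<Prod>i\<in>T-{i}. blk (e i)) * geo ^ start_dim d) (e i) k)
    \<le> shifted ((\<Prod>i\<in>T. blk (e i)) * geo ^ start_dim d) d k + (if card T = 2 \<and> k = 0 then 2 else 0)"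
proof (cases "card T \<le> 5 \<and> k \<le> 4")
  case False
  have "shifted ((\<Prod>i\<in>T. blk (e i)) * geo ^ start_dim d) (e i) k = 0 \<and> shifted ((\<Prod>i\<in>T-{i}. blk (e i)) * geo ^ start_dim d) (e i) k = 0"
    if i: "i \<in> T" for i
  proof (cases "k \<le> e i")
    case True
    have "e i \<le> 4" using e[OF i] d by auto
    hence "card T > 5" using False True by simp
    hence "e i - k < card (T - {i})" "e i - k < card T" using \<open>e i \<le> 4\<close> T i by (auto simp: card_Diff_singleton)
    thus ?thesis using prod_blk_low[of T] prod_blk_low[of "T - {i}"] T by (simp add: shifted_def)
  qed (simp add: shifted_def)
  thus ?thesis by (simp add: sum.neutral)
next
  case True
  let ?L = "start_table d"
  have e234: "e i \<in> {2, 3, 4}" if "i \<in> T" for i using e[OF that] d by auto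
  define a where "a = card {i\<in>T. e i = 2}"
  define b where "b = card {i\<in>T. e i = 3}"
  define w where "w = card {i\<in>T. e i = 4}"
  have "T = {i\<in>T. e i = 2} \<union> {i\<in>T. e i = 3} \<union> {i\<in>T. e i = 4}" using e234 by auto
  hence "card T = card ({i\<in>T. e i = 2} \<union> {i\<in>T. e i = 3} \<union> {i\<in>T. e i = 4})" by simp
  also have "\<dots> = a + b + w" unfolding a_def b_def w_def using T
    by (subst card_Un_disjoint; (subst card_Un_disjoint)?; auto)
  finally have p: "card T = a + b + w" .
  have "d \<le> 5 \<Longrightarrow> {i\<in>T. e i = 3} = {}" "d \<le> 7 \<Longrightarrow> {i\<in>T. e i = 4} = {}" using e by force+
  moreover have "d \<le> 8 \<Longrightarrow> d \<le> 7" using d by auto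
  ultimately have "d \<le> 5 \<longrightarrow> {i\<in>T. e i = 3} = {}" "d \<le> 8 \<longrightarrow> {i\<in>T. e i = 4} = {}" by blast+
  hence bw: "d \<le> 5 \<longrightarrow> b = 0" "d \<le> 8 \<longrightarrow> w = 0" unfolding b_def w_def by (metis card.empty)+
  note rp = tabulates_table[OF tabulates_start[of d]]
  have F: "(\<Prod>i\<in>T. blk (e i)) = blk 2 ^ a * blk 3 ^ b * blk 4 ^ w"
    unfolding a_def b_def w_def by (rule prod_blk[OF T(1) e234])
  have Fi: "(\<Prod>j\<in>T-{i}. blk (e j)) = (if e i = 2 then blk 2 ^ (a - 1) * blk 3 ^ b * blk 4 ^ w
      else if e i = 3 then blk 2 ^ a * blk 3 ^ (b - 1) * blk 4 ^ w else blk 2 ^ a * blk 3 ^ b * blk 4 ^ (w - 1))" if i: "i \<in> T" for i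
  proof -
    have v: "card {j\<in>T-{i}. e j = v} = (if e i = v then card {j\<in>T. e j = v} - 1 else card {j\<in>T. e j = v})" for v
    proof -
      have "{j\<in>T-{i}. e j = v} = (if e i = v then {j\<in>T. e j = v} - {i} else {j\<in>T. e j = v})" by auto
      thus ?thesis using i T by (simp add: card_Diff_singleton)
    qed
    have "(\<Prod>j\<in>T-{i}. blk (e j)) = blk 2 ^ card {j\<in>T-{i}. e j = 2} * blk 3 ^ card {j\<in>T-{i}. e j = 3} * blk 4 ^ card {j\<in>T-{i}. e j = 4}"
      by (rule prod_blk) (use T e234 in auto)
    thus ?thesis unfolding v using e234[OF i] by (auto simp: a_def b_def w_def)
  qed
  define V where "V v = (if v = 2 then tcoeff (table ?L a b w) 2 k + tcoeff (table ?L (a - 1) b w) 2 k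
    else if v = 3 then tcoeff (table ?L a b w) 3 k + tcoeff (table ?L a (b - 1) w) 3 k
    else tcoeff (table ?L a b w) 4 k + tcoeff (table ?L a b (w - 1)) 4 k)" for v :: nat
  have V: "int (shifted ((\<Prod>i\<in>T. blk (e i)) * geo ^ start_dim d) (e i) k + shifted ((\<Prod>i\<in>T-{i}. blk (e i)) * geo ^ start_dim d) (e i) k) = V (e i)"
    if i: "i \<in> T" for i
    using e234[OF i] unfolding F Fi[OF i] by (auto simp: V_def tabulates_coeff[OF rp])
  have "int (\<Sum>i\<in>T. shifted ((\<Prod>i\<in>T. blk (e i)) * geo ^ start_dim d) (e i) k + shifted ((\<Prod>i\<in>T-{i}. blk (e i)) * geo ^ start_dim d) (e i) k)
    = int a * V 2 + int b * V 3 + int w * V 4"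
    unfolding of_nat_sum a_def b_def w_def
    by (rule sum_values[where F = V and e = e, OF T(1)]) (fact e234, fact V)
  also have "\<dots> \<le> tcoeff (table ?L a b w) d k + (if a + b + w = 2 \<and> k = 0 then 2 else 0)"
    using support_checkD[OF support_check_start[OF d], of a b w k] True T p bw by (simp add: V_def)
  also have "tcoeff (table ?L a b w) d k = int (shifted ((\<Prod>i\<in>T. blk (e i)) * geo ^ start_dim d) d k)"
    unfolding F by (rule tabulates_coeff[OF rp, symmetric]) (use d in auto)
  also have "\<dots> + (if a + b + w = 2 \<and> k = 0 then 2 else 0)
    = int (shifted ((\<Prod>i\<in>T. blk (e i)) * geo ^ start_dim d) d k + (if card T = 2 \<and> k = 0 then 2 else 0))"
    by (simp add: p)
  finally show ?thesis by (simp only: of_nat_le_iff)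
qed

text \<open>The contribution of the monomials whose support among the first \<open>r\<close>
variables is exactly \<open>T\<close>. The second summand on the left is there because a subset that
does not contain \<open>i\<close> is recorded at \<open>T = insert i T'\<close>; see
\<open>sum_Pow_split\<close>.\<close>

lemma support_ineq:
  assumes d: "d \<in> {4, 5, 6, 7, 9}" and T: "finite T" "2 \<le> card T"
    and e: "\<And>i. i \<in> T \<Longrightarrow> 2 \<le> e i \<and> e i \<le> d div 2" and c: "start_dim d \<le> c"
  shows "(\<Sum>i\<in>T. fps_nth ((\<Prod>i\<in>T. blk (e i)) * geo ^ c) (e i) + fps_nth ((\<Prod>i\<in>T-{i}. blk (e i)) * geo ^ c) (e i))
    \<le> fps_nth ((\<Prod>i\<in>T. blk (e i)) * geo ^ c) d + (if card T = 2 then 2 else 0)"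
proof -
  \<comment> \<open>the constant 2 is two copies of the coefficient of \<open>geo ^ c\<close> at index 0; its shifts vanish\<close>
  let ?w = "if card T = 2 then 1 else 0 :: nat fps"
  let ?P = "\<lambda>T. \<Prod>i\<in>T. blk (e i)"
  let ?I = "Inl ` T \<union> Inr ` T"
  let ?f = "case_sum (\<lambda>i. ?P T) (\<lambda>i. ?P (T - {i}))" and ?m = "case_sum e e"
  let ?g = "\<lambda>j::nat. if j = 0 then ?P T else ?w" and ?m' = "\<lambda>j::nat. if j = 0 then d else 0"
  have L: "(\<Sum>t\<in>?I. shifted (?f t * geo ^ c) (?m t) k) = (\<Sum>i\<in>T. shifted (?P T * geo ^ c) (e i) k + shifted (?P (T - {i}) * geo ^ c) (e i) k)" for c k
    using T by (subst sum.union_disjoint) (auto simp: sum.reindex sum.distrib)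
  have w: "shifted (?w * geo ^ c) 0 k = (if card T = 2 \<and> k = 0 then 1 else 0)" for c k
    by (simp add: shifted_def geo_power)
  have R: "(\<Sum>t\<in>{0,1,2}. shifted (?g t * geo ^ c) (?m' t) k) = shifted (?P T * geo ^ c) d k + (if card T = 2 \<and> k = 0 then 2 else 0)" for c k
    using w[of c k] by simp
  have ed: "e i \<le> d" if "i \<in> T" for i using e[OF that] by linarith
  have "(\<Sum>t\<in>Inl ` ?I. shifted (case_sum ?f ?g t * geo ^ c) (case_sum ?m ?m' t) 0)
    \<le> (\<Sum>t\<in>Inr ` {0,1,2}. shifted (case_sum ?f ?g t * geo ^ c) (case_sum ?m ?m' t) 0)"
  proof (rule shift_ineq[where d = d and ?c0.0 = "start_dim d"])
    fix k
    have "(\<Sum>t\<in>?I. shifted (?f t * geo ^ start_dim d) (?m t) k) \<le> (\<Sum>t\<in>{0,1,2}. shifted (?g t * geo ^ start_dim d) (?m' t) k)"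
      unfolding L R by (rule support_ineq_start[OF d T e])
    thus "(\<Sum>t\<in>Inl ` ?I. shifted (case_sum ?f ?g t * geo ^ start_dim d) (case_sum ?m ?m' t) k)
      \<le> (\<Sum>t\<in>Inr ` {0,1,2}. shifted (case_sum ?f ?g t * geo ^ start_dim d) (case_sum ?m ?m' t) k)"
      by (subst (1 2) sum.reindex) (auto simp: comp_def)
  qed (use ed c in auto)
  hence "(\<Sum>t\<in>?I. shifted (?f t * geo ^ c) (?m t) 0) \<le> (\<Sum>t\<in>{0,1,2}. shifted (?g t * geo ^ c) (?m' t) 0)"
    by (subst (asm) (1 2) sum.reindex) (auto simp: comp_def)
  thus ?thesis unfolding L R by (simp add: shifted_def)
qed

definition single_check :: "nat \<Rightarrow> nat \<Rightarrow> int list \<Rightarrow> int list \<Rightarrow> bool" where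
  "single_check d e L h \<longleftrightarrow> list_all (\<lambda>k. int d * (tcoeff h e k + tcoeff L e k) + sum_list (map (\<lambda>j. tcoeff L j k) [0..<d])
      \<le> int d * (tcoeff h d k + tcoeff L 1 k + tcoeff L 0 k)) [0,1,2,3,4,5,6,7,8,9]"

lemma single_checks:
  "single_check 4 2 base3 (table base3 1 0 0)"
  "single_check 5 2 base2 (table base2 1 0 0)"
  "single_check 6 2 base2 (table base2 1 0 0)" "single_check 6 3 base2 (table base2 0 1 0)"
  "single_check 7 2 base2 (table base2 1 0 0)" "single_check 7 3 base2 (table base2 0 1 0)"
  "single_check 9 2 base2 (table base2 1 0 0)" "single_check 9 3 base2 (table base2 0 1 0)"
  "single_check 9 4 base2 (table base2 0 0 1)"
  unfolding base2_def base3_def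
  by (simp_all add: single_check_def table_def tcoeff_def upt_rec[of _ "numeral _"])

lemma single_ineq_start:
  assumes d: "d \<in> {4, 5, 6, 7, 9}" and e: "2 \<le> e" "e \<le> d div 2"
  shows "d * (shifted (blk e * geo ^ start_dim d) e k + shifted (1 * geo ^ start_dim d) e k) + (\<Sum>j<d. shifted (1 * geo ^ start_dim d) j k)
    \<le> d * (shifted (blk e * geo ^ start_dim d) d k + shifted (1 * geo ^ start_dim d) 1 k + shifted (1 * geo ^ start_dim d) 0 k)"
proof (cases "k \<le> 9")
  case False
  thus ?thesis using d e by (auto simp: shifted_def)
next
  case True
  let ?L = "start_table d"
  define h where "h = (if e = 2 then table ?L 1 0 0 else if e = 3 then table ?L 0 1 0 else table ?L 0 0 1)"
  have chk: "single_check d e ?L h"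
  proof -
    have "e = 2 \<or> e = 3 \<and> d \<in> {6, 7, 9} \<or> e = 4 \<and> d = 9" using d e by auto
    thus ?thesis using d single_checks unfolding h_def start_table_def by (elim disjE) auto
  qed
  have "e \<in> {2, 3, 4}" using d e by auto
  hence rh: "tabulates (blk e * geo ^ start_dim d) h"
    using tabulates_table[OF tabulates_start[of d], of 1 0 0] tabulates_table[OF tabulates_start[of d], of 0 1 0]
      tabulates_table[OF tabulates_start[of d], of 0 0 1] by (auto simp: h_def)
  have rL: "tabulates (1 * geo ^ start_dim d) ?L" using tabulates_start[of d] by simp
  have "k \<in> set [0,1,2,3,4,5,6,7,8,9]" using True by (auto simp: eval_nat_numeral le_Suc_eq)
  hence "int d * (tcoeff h e k + tcoeff ?L e k) + sum_list (map (\<lambda>j. tcoeff ?L j k) [0..<d])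
      \<le> int d * (tcoeff h d k + tcoeff ?L 1 k + tcoeff ?L 0 k)"
    using chk unfolding single_check_def list_all_iff by (blast dest: bspec)
  also have "sum_list (map (\<lambda>j. tcoeff ?L j k) [0..<d]) = (\<Sum>j<d. tcoeff ?L j k)"
    by (simp add: interv_sum_list_conv_sum_set_nat atLeast0LessThan)
  also have "\<dots> = (\<Sum>j<d. int (shifted (1 * geo ^ start_dim d) j k))"
    using d by (intro sum.cong refl tabulates_coeff[OF rL, symmetric]) auto
  finally have "int (d * (shifted (blk e * geo ^ start_dim d) e k + shifted (1 * geo ^ start_dim d) e k) + (\<Sum>j<d. shifted (1 * geo ^ start_dim d) j k))
    \<le> int (d * (shifted (blk e * geo ^ start_dim d) d k + shifted (1 * geo ^ start_dim d) 1 k + shifted (1 * geo ^ start_dim d) 0 k))"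
    using d e tabulates_coeff[OF rh, of e k] tabulates_coeff[OF rh, of d k] tabulates_coeff[OF rL, of e k] tabulates_coeff[OF rL, of 1 k] tabulates_coeff[OF rL, of 0 k]
    by (auto simp del: mult_1)
  thus ?thesis by (simp only: of_nat_le_iff)
qed

text \<open>For a singleton \<open>T\<close> there is no room for the term \<open>r\<close> without
the bound \<open>r c < C(c + d - 1, d)\<close>. By absorption that bound is \<open>d r < C(c + d -
1, d - 1)\<close>, whose right side is the sum of the coefficients of \<open>geo ^ c\<close> below
\<open>d\<close>. In this form \<open>r\<close> is eliminated, and after multiplication by
\<open>d\<close> only shifted coefficients are left.\<close>

lemma single_ineq:
  assumes d: "d \<in> {4, 5, 6, 7, 9}" and e: "2 \<le> e" "e \<le> d div 2" and c: "start_dim d \<le> c"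
    and r: "r * c < (c + d - 1) choose d"
  shows "fps_nth (blk e * geo ^ c) e + fps_nth (geo ^ c) e + r \<le> fps_nth (blk e * geo ^ c) d + c + 1"
proof -
  \<comment> \<open>the factor \<open>d\<close> becomes a sum over \<open>j < d\<close>, where \<open>j\<close> also indexes the coefficients that bound \<open>r\<close>\<close>
  let ?I = "{..<d} \<times> {0,1,2::nat}"
  let ?f = "\<lambda>t::nat\<times>nat. if snd t = 0 then blk e else 1"
  let ?m = "\<lambda>t. if snd t = 0 \<or> snd t = 1 then e else fst t"
  let ?m' = "\<lambda>t. if snd t = 0 then d else if snd t = 1 then 1 else 0 :: nat"
  have S: "(\<Sum>t\<in>?I. F t) = (\<Sum>j<d. F (j, 0) + F (j, 1) + F (j, 2))" for F :: "nat \<times> nat \<Rightarrow> nat"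
    by (simp add: sum.cartesian_product[symmetric, of "\<lambda>a b. F (a, b)", unfolded split_def, simplified] add.assoc)
  have L: "(\<Sum>t\<in>?I. shifted (?f t * geo ^ c) (?m t) k) =
      d * (shifted (blk e * geo ^ c) e k + shifted (1 * geo ^ c) e k) + (\<Sum>j<d. shifted (1 * geo ^ c) j k)" for c k
    unfolding S by (simp add: sum.distrib distrib_left)
  have R: "(\<Sum>t\<in>?I. shifted (?f t * geo ^ c) (?m' t) k) =
      d * (shifted (blk e * geo ^ c) d k + shifted (1 * geo ^ c) 1 k + shifted (1 * geo ^ c) 0 k)" for c k
    unfolding S by (simp add: sum.distrib distrib_left)
  have "(\<Sum>t\<in>?I. shifted (?f t * geo ^ c) (?m t) 0) \<le> (\<Sum>t\<in>?I. shifted (?f t * geo ^ c) (?m' t) 0)"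
  proof (rule shift_ineq[where d = d and ?c0.0 = "start_dim d"])
    fix k show "(\<Sum>t\<in>?I. shifted (?f t * geo ^ start_dim d) (?m t) k) \<le> (\<Sum>t\<in>?I. shifted (?f t * geo ^ start_dim d) (?m' t) k)"
      unfolding L R by (rule single_ineq_start[OF d e])
  next
    fix t assume "t \<in> ?I" thus "?m t \<le> d" using e by auto
  next
    fix t assume "t \<in> ?I" thus "?m' t \<le> d" by auto
  qed (use c in auto)
  hence main: "d * (fps_nth (blk e * geo ^ c) e + fps_nth (geo ^ c) e) + (\<Sum>j<d. fps_nth (geo ^ c) j)
    \<le> d * (fps_nth (blk e * geo ^ c) d + c + 1)"
    unfolding L R by (simp add: shifted_def geo_power)
  have c0: "c > 0" "d > 0" using c d by (auto simp: start_dim_def split: if_splits)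
  have "(\<Sum>j<d. fps_nth (geo ^ c) j) = fps_nth (geo ^ Suc c) (d - 1)"
    using c0 geo_mult[of "geo ^ c" "d - 1"] by (simp add: lessThan_Suc_atMost[symmetric] mult.commute)
  also have "\<dots> = (c + d - 1) choose (d - 1)" using c0 by (simp add: geo_power del: power_Suc)
  finally have B: "(\<Sum>j<d. fps_nth (geo ^ c) j) = (c + d - 1) choose (d - 1)" .
  have abs: "d * ((c + d - 1) choose d) = c * ((c + d - 1) choose (d - 1))"
    using binomial_absorption[of "d - 1" "c + d - 1"] binomial_absorb_comp[of "c + d - 1" "d - 1"] c0 by simp
  have "c * (d * r) < c * ((c + d - 1) choose (d - 1))"
    unfolding abs[symmetric] using r c0 by (simp add: mult.commute mult.left_commute)
  hence "d * r < (\<Sum>j<d. fps_nth (geo ^ c) j)" unfolding B using c0 by simp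
  hence "d * (fps_nth (blk e * geo ^ c) e + fps_nth (geo ^ c) e + r) < d * (fps_nth (blk e * geo ^ c) d + c + 1)"
    using main by (simp only: distrib_left)
  hence "fps_nth (blk e * geo ^ c) e + fps_nth (geo ^ c) e + r < fps_nth (blk e * geo ^ c) d + c + 1"
    by (simp only: mult_less_cancel1)
  thus ?thesis by (rule less_imp_le)
qed

text \<open>The monomials outside the ideal \<open>(x\<^sub>0^e\<^sub>0, \<dots>,
x\<^sub>r\<^sub>-\<^sub>1^e\<^sub>r\<^sub>-\<^sub>1)\<close>. Their number is the Hilbert function
of a complete intersection of type \<open>e\<close>.\<close>

definition std_mons :: "nat \<Rightarrow> nat \<Rightarrow> (nat \<Rightarrow> nat) \<Rightarrow> nat \<Rightarrow> (nat \<Rightarrow>\<^sub>0 nat) set" where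
  "std_mons n r e j = {m \<in> mons {..n} j. \<forall>i<r. lkp m i < e i}"

lemma card_std_mons:
  assumes "n + 1 = r + c"
  shows "card (std_mons n r e j) = fps_nth ((\<Prod>i<r. ind_fps {..<e i}) * geo ^ c) j"
proof -
  let ?A = "\<lambda>i. if i < r then {..<e i} else UNIV"
  have "std_mons n r e j = boxed {..n} ?A j" using assms by (auto simp: std_mons_def boxed_def)
  hence "card (std_mons n r e j) = fps_nth (\<Prod>i\<le>n. ind_fps (?A i)) j" by (simp add: card_boxed)
  also have "{..n} = {..<r} \<union> {r..n}" using assms by auto
  also have "(\<Prod>i\<in>{..<r} \<union> {r..n}. ind_fps (?A i)) = (\<Prod>i<r. ind_fps (?A i)) * (\<Prod>i\<in>{r..n}. ind_fps (?A i))"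
    by (rule prod.union_disjoint) auto
  also have "(\<Prod>i\<in>{r..n}. ind_fps (?A i)) = (\<Prod>i\<in>{r..n}. geo)" by (intro prod.cong) (auto simp: geo_def)
  also have "\<dots> = geo ^ c" using assms by simp
  also have "(\<Prod>i<r. ind_fps (?A i)) = (\<Prod>i<r. ind_fps {..<e i})" by (intro prod.cong) auto
  finally show ?thesis .
qed

text \<open>Each factor is \<open>blk (e i) + 1\<close>: the variable occurs or it does not. A
factor with \<open>e i = 1\<close> is 1.\<close>

lemma std_mons_expand:
  assumes "n + 1 = r + c" "\<And>i. i < r \<Longrightarrow> 1 \<le> e i"
  shows "card (std_mons n r e j) = (\<Sum>T\<in>Pow {i. i < r \<and> 2 \<le> e i}. fps_nth ((\<Prod>i\<in>T. blk (e i)) * geo ^ c) j)"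
proof -
  let ?S = "{i. i < r \<and> 2 \<le> e i}"
  have "(\<Prod>i<r. ind_fps {..<e i}) = (\<Prod>i\<in>?S. ind_fps {..<e i})"
  proof (rule prod.mono_neutral_right)
    show "\<forall>i\<in>{..<r} - ?S. ind_fps {..<e i} = 1"
    proof
      fix i assume "i \<in> {..<r} - ?S"
      hence "e i = 1" using assms(2)[of i] by auto
      thus "ind_fps {..<e i} = 1" by (intro fps_ext) (auto simp: ind_fps_def)
    qed
  qed auto
  also have "\<dots> = (\<Prod>i\<in>?S. blk (e i) + 1)" by (intro prod.cong refl box_eq) auto
  also have "\<dots> = (\<Sum>T\<in>Pow ?S. \<Prod>i\<in>T. blk (e i))" by (subst prod_add) auto
  finally show ?thesis unfolding card_std_mons[OF assms(1)] by (simp add: sum_distrib_right fps_sum_nth)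
qed

text \<open>Sets \<open>T\<close> that contain \<open>i\<close> are paired with \<open>T -
{i}\<close>, so that every term is attached to a set containing its index.\<close>

lemma sum_Pow_split:
  fixes h :: "'b set \<Rightarrow> nat \<Rightarrow> nat"
  assumes "finite S"
  shows "(\<Sum>i\<in>S. \<Sum>T\<in>Pow S. h T (e i)) = (\<Sum>T\<in>Pow S. \<Sum>i\<in>T. h T (e i) + h (T - {i}) (e i))"
proof -
  have "(\<Sum>T\<in>Pow S. h T (e i)) = (\<Sum>T\<in>{T\<in>Pow S. i \<in> T}. h T (e i) + h (T - {i}) (e i))" if i: "i \<in> S" for i
  proof -
    have "(\<Sum>T\<in>Pow S. h T (e i)) = (\<Sum>T\<in>{T\<in>Pow S. i \<in> T}. h T (e i)) + (\<Sum>T\<in>{T\<in>Pow S. i \<notin> T}. h T (e i))"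
      using assms by (subst sum.union_disjoint[symmetric]) (auto intro!: sum.cong)
    also have "(\<Sum>T\<in>{T\<in>Pow S. i \<notin> T}. h T (e i)) = (\<Sum>T\<in>{T\<in>Pow S. i \<in> T}. h (T - {i}) (e i))"
      by (rule sum.reindex_bij_witness[of _ "\<lambda>T. T - {i}" "insert i"]) (use i in auto)
    finally show ?thesis by (simp add: sum.distrib)
  qed
  hence "(\<Sum>i\<in>S. \<Sum>T\<in>Pow S. h T (e i)) = (\<Sum>i\<in>S. \<Sum>T\<in>{T\<in>Pow S. i \<in> T}. h T (e i) + h (T - {i}) (e i))" by simp
  also have "\<dots> = (\<Sum>T\<in>Pow S. \<Sum>i\<in>{i\<in>S. i \<in> T}. h T (e i) + h (T - {i}) (e i))"
    by (rule sum.swap_restrict) (use assms in auto)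
  also have "\<dots> = (\<Sum>T\<in>Pow S. \<Sum>i\<in>T. h T (e i) + h (T - {i}) (e i))"
    by (intro sum.cong refl) auto
  finally show ?thesis .
qed

text \<open>With \<open>s\<close> generators of degree at least 2, each linear generator contributes
\<open>c + s\<close>. The comparison over the supports \<open>T\<close> leaves a deficit of \<open>c
+ 1 - r\<close> for each singleton and of 2 for each pair, and all this adds up to \<open>r
c\<close>, which is less than the contribution \<open>C(c + d - 1, d)\<close> of the empty
support.\<close>

lemma codimension_ineq:
  assumes d: "d \<in> {4, 5, 6, 7, 9}" and c: "start_dim d \<le> c" and n: "n + 1 = r + c"
    and e: "\<And>i. i < r \<Longrightarrow> 1 \<le> e i \<and> e i \<le> d div 2" and r: "r * c < (c + d - 1) choose d"
  shows "(\<Sum>i<r. card (std_mons n r e (e i))) < card (std_mons n r e d)"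
proof -
  define S where "S = {i. i < r \<and> 2 \<le> e i}"
  define s where "s = card S"
  have finS: "finite S" by (simp add: S_def)
  have sr: "s \<le> r" using card_mono[of "{..<r}" S] by (auto simp: s_def S_def)
  define h where "h T j = fps_nth ((\<Prod>i\<in>T. blk (e i)) * geo ^ c) j" for T :: "nat set" and j
  define \<kappa> where "\<kappa> T = (\<Sum>i\<in>T. h T (e i) + h (T - {i}) (e i))" for T
  have H: "card (std_mons n r e j) = (\<Sum>T\<in>Pow S. h T j)" for j
    unfolding S_def h_def by (rule std_mons_expand[OF n]) (use e in auto)
  define P1 where "P1 = {T\<in>Pow S. card T = 1}"
  define P2 where "P2 = {T\<in>Pow S. 2 \<le> card T}"
  have P: "Pow S = insert {} (P1 \<union> P2)" and Pd: "{} \<notin> P1 \<union> P2" "P1 \<inter> P2 = {}"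
  proof -
    have "T = {} \<or> card T = 1 \<or> 2 \<le> card T" if "T \<subseteq> S" for T
    proof -
      have "finite T" using finS that finite_subset by blast
      moreover have "card T = 0 \<or> card T = 1 \<or> 2 \<le> card T" by linarith
      ultimately show ?thesis by auto
    qed
    thus "Pow S = insert {} (P1 \<union> P2)" by (auto simp: P1_def P2_def)
  qed (auto simp: P1_def P2_def)
  have finP: "finite P1" "finite P2" using finS by (auto simp: P1_def P2_def)
  have split: "(\<Sum>T\<in>Pow S. F T) = F {} + (\<Sum>T\<in>P1. F T) + (\<Sum>T\<in>P2. F T)" for F :: "nat set \<Rightarrow> nat"
    unfolding P using Pd finP by (simp add: sum.union_disjoint)
  have P1: "P1 = (\<lambda>i. {i}) ` S" by (auto simp: P1_def card_1_singleton_iff)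
  have sumP1: "(\<Sum>T\<in>P1. F T) = (\<Sum>i\<in>S. F {i})" for F :: "nat set \<Rightarrow> nat"
    unfolding P1 by (simp add: sum.reindex)
  have h0: "h {} d = (c + d - 1) choose d" "h {} 1 = c" by (simp_all add: h_def geo_power)
  have H1: "card (std_mons n r e 1) = c + s"
  proof -
    have "(\<Sum>i\<in>S. h {i} 1) = (\<Sum>i\<in>S. 1)"
      by (intro sum.cong refl) (auto simp: h_def S_def fps_mult_nth blk_def ind_fps_def geo_power)
    moreover have "(\<Sum>T\<in>P2. h T 1) = 0"
      unfolding h_def using finS by (intro sum.neutral ballI prod_blk_low) (auto simp: P2_def intro: finite_subset)
    ultimately show ?thesis unfolding H split sumP1 h0(2) by (simp add: s_def)
  qed
  have "(\<Sum>i<r. card (std_mons n r e (e i))) = (\<Sum>i\<in>{..<r} - S. card (std_mons n r e (e i))) + (\<Sum>i\<in>S. card (std_mons n r e (e i)))"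
    by (rule sum.subset_diff) (auto simp: S_def)
  also have "(\<Sum>i\<in>{..<r} - S. card (std_mons n r e (e i))) = (\<Sum>i\<in>{..<r} - S. c + s)"
  proof (intro sum.cong refl)
    fix i assume "i \<in> {..<r} - S"
    hence "e i = 1" using e[of i] by (auto simp: S_def)
    thus "card (std_mons n r e (e i)) = c + s" using H1 by simp
  qed
  also have "\<dots> = (r - s) * (c + s)"
    using finS by (simp add: s_def card_Diff_subset S_def subset_eq)
  also have "(\<Sum>i\<in>S. card (std_mons n r e (e i))) = (\<Sum>T\<in>Pow S. \<kappa> T)"
    unfolding H \<kappa>_def by (rule sum_Pow_split[OF finS])
  also have "\<dots> = (\<Sum>i\<in>S. \<kappa> {i}) + (\<Sum>T\<in>P2. \<kappa> T)" unfolding split sumP1 by (simp add: \<kappa>_def)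
  finally have total: "(\<Sum>i<r. card (std_mons n r e (e i))) = (r - s) * (c + s) + ((\<Sum>i\<in>S. \<kappa> {i}) + (\<Sum>T\<in>P2. \<kappa> T))" .
  have single: "(\<Sum>i\<in>S. \<kappa> {i}) + s * r \<le> (\<Sum>i\<in>S. h {i} d) + s * (c + 1)"
  proof -
    have "(\<Sum>i\<in>S. \<kappa> {i} + r) \<le> (\<Sum>i\<in>S. h {i} d + (c + 1))"
    proof (rule sum_mono)
      fix i assume "i \<in> S"
      hence "2 \<le> e i" "e i \<le> d div 2" using e by (auto simp: S_def)
      from single_ineq[OF d this c r] show "\<kappa> {i} + r \<le> h {i} d + (c + 1)"
        by (simp add: \<kappa>_def h_def)
    qed
    also have "\<dots> = (\<Sum>i\<in>S. h {i} d) + s * (c + 1)"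
      unfolding sum.distrib by (simp add: s_def)
    finally show ?thesis unfolding sum.distrib by (simp add: s_def)
  qed
  have multi: "(\<Sum>T\<in>P2. \<kappa> T) \<le> (\<Sum>T\<in>P2. h T d) + s * (s - 1)"
  proof -
    have "(\<Sum>T\<in>P2. \<kappa> T) \<le> (\<Sum>T\<in>P2. h T d + (if card T = 2 then 2 else 0))"
    proof (rule sum_mono)
      fix T assume T: "T \<in> P2"
      hence "finite T" "2 \<le> card T" "\<And>i. i \<in> T \<Longrightarrow> 2 \<le> e i \<and> e i \<le> d div 2"
        using finS e by (auto simp: P2_def S_def intro: finite_subset)
      from support_ineq[OF d this c] show "\<kappa> T \<le> h T d + (if card T = 2 then 2 else 0)"
        by (simp add: \<kappa>_def h_def)
    qed
    also have "\<dots> = (\<Sum>T\<in>P2. h T d) + (\<Sum>T\<in>{T\<in>P2. card T = 2}. 2)"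
      using finP by (simp add: sum.distrib sum.If_cases Int_def conj_commute)
    also have "{T\<in>P2. card T = 2} = {T. T \<subseteq> S \<and> card T = 2}" by (auto simp: P2_def)
    also have "(\<Sum>T\<in>{T. T \<subseteq> S \<and> card T = 2}. 2) = s * (s - 1)"
    proof -
      have "even (s * (s - 1))" by (cases s) auto
      thus ?thesis using n_subsets[OF finS, of 2] by (simp add: s_def choose_two mult.commute[of _ 2])
    qed
    finally show ?thesis .
  qed
  \<comment> \<open>linear generators, singletons and pairs together leave exactly \<open>r * c\<close>\<close>
  have "(r - s) * (c + s) + s * (c + 1) + s * (s - 1) = r * c + s * r"
  proof -
    obtain a where a: "r = a + s" using sr by (metis add.commute le_add_diff_inverse)
    define x where "x = s * (s - 1)"
    have "x + s = s * s" unfolding x_def by (cases s) auto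
    thus ?thesis unfolding a x_def[symmetric] by (simp add: algebra_simps)
  qed
  moreover have "card (std_mons n r e d) = (c + d - 1 choose d) + (\<Sum>i\<in>S. h {i} d) + (\<Sum>T\<in>P2. h T d)"
    unfolding H split sumP1 by (simp add: h0)
  ultimately show ?thesis using total single multi r by linarith
qed

text \<open>Here \<open>r \<le> 2\<close> and exactly one generator is a quadric; the values of the
Hilbert function in degrees 1, 2, 4 are 3, 5, 9.\<close>

lemma codimension_ineq_quartic_surface:
  assumes r: "1 \<le> r" "r * 2 < 5" and n: "n + 1 = r + 2"
    and e: "\<And>i. i < r \<Longrightarrow> 1 \<le> e i \<and> e i \<le> (2::nat)" and ex: "\<exists>i<r. 2 \<le> e i"
    and not: "\<not> (r = 2 \<and> e 0 = 2 \<and> e 1 = 2)"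
  shows "(\<Sum>i<r. card (std_mons n r e (e i))) < card (std_mons n r e 4)"
proof -
  have "\<exists>i. {i. i < r \<and> 2 \<le> e i} = {i}"
  proof (cases "r = 1")
    case True
    thus ?thesis using ex by (intro exI[of _ 0]) auto
  next
    case False
    hence r2: "r = 2" using r by auto
    obtain i where i: "i < r" "2 \<le> e i" using ex by blast
    have "j = i" if "j < r" "2 \<le> e j" for j
    proof (rule ccontr)
      assume "j \<noteq> i"
      hence "{i, j} = {0, 1}" using i that r2 by (auto simp: less_2_cases_iff)
      hence "e 0 = 2 \<and> e 1 = 2" using i that e by (metis doubleton_eq_iff le_antisym)
      thus False using not r2 by simp
    qed
    hence "{i. i < r \<and> 2 \<le> e i} = {i}" using i by blast
    thus ?thesis ..
  qed
  then obtain i where S: "{i. i < r \<and> 2 \<le> e i} = {i}" by blast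
  have "i \<in> {i. i < r \<and> 2 \<le> e i}" unfolding S by simp
  hence i: "i < r" "e i = 2" using e[of i] by auto
  have H: "card (std_mons n r e j) = fps_nth (geo ^ 2) j + fps_nth (blk 2 * geo ^ 2) j" for j
    using std_mons_expand[OF n, of e j] e unfolding S by (simp add: Pow_insert i)
  have v: "card (std_mons n r e 1) = 3" "card (std_mons n r e 2) = 5" "card (std_mons n r e 4) = 9"
    unfolding H blk_mult_nth geo_power by (simp_all add: eval_nat_numeral)
  have "(\<Sum>i<r. card (std_mons n r e (e i))) = card (std_mons n r e (e i)) + (\<Sum>j\<in>{..<r}-{i}. card (std_mons n r e (e j)))"
    using i by (intro sum.remove) auto
  also have "(\<Sum>j\<in>{..<r}-{i}. card (std_mons n r e (e j))) = (\<Sum>j\<in>{..<r}-{i}. 3)"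
  proof (intro sum.cong refl)
    fix j assume "j \<in> {..<r} - {i}"
    hence "e j = 1" using S e[of j] by force
    thus "card (std_mons n r e (e j)) = 3" using v by simp
  qed
  also have "\<dots> = 3 * (r - 1)" using i by simp
  finally show ?thesis using v i r by simp
qed

section \<open>Linear algebra and second-order variation\<close>

lemma maximal_rows:
  fixes f :: "'j \<Rightarrow> 'm \<Rightarrow> 'a::field"
  assumes "finite I"
  shows "\<exists>J\<subseteq>I. rows_independent J M f \<and> (\<forall>y\<in>I. \<exists>C. \<forall>m\<in>M. f y m = (\<Sum>j\<in>J. C j * f j m))"
  using assms
proof (induction I rule: finite_induct)
  case empty
  thus ?case by (simp add: rows_independent_def)
next
  case (insert y I)
  then obtain J where J: "J \<subseteq> I" "rows_independent J M f" "\<forall>y\<in>I. \<exists>C. \<forall>m\<in>M. f y m = (\<Sum>j\<in>J. C j * f j m)" by blast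
  have finJ: "finite J" using J(1) insert.hyps finite_subset by blast
  have yJ: "y \<notin> J" using J(1) insert.hyps by auto
  show ?case
  proof (cases "\<exists>C. \<forall>m\<in>M. f y m = (\<Sum>j\<in>J. C j * f j m)")
    case True
    thus ?thesis using J by (intro exI[of _ J]) auto
  next
    case False
    have ind: "rows_independent (insert y J) M f" unfolding rows_independent_def
    proof (intro allI impI ballI)
      fix c j assume c: "\<forall>m\<in>M. (\<Sum>j\<in>insert y J. c j * f j m) = 0" and j: "j \<in> insert y J"
      have s: "c y * f y m = - (\<Sum>j\<in>J. c j * f j m)" if "m \<in> M" for m
        using c that finJ yJ by (simp add: eq_neg_iff_add_eq_0)
      have cy: "c y = 0"
      proof (rule ccontr)
        assume nz: "c y \<noteq> 0"
        have "f y m = (\<Sum>j\<in>J. (- c j / c y) * f j m)" if "m \<in> M" for m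
        proof -
          have "f y m = (c y * f y m) / c y" using nz by simp
          thus ?thesis unfolding s[OF that] by (simp add: sum_divide_distrib sum_negf[symmetric])
        qed
        hence "\<exists>C. \<forall>m\<in>M. f y m = (\<Sum>j\<in>J. C j * f j m)" by (intro exI[of _ "\<lambda>j. - c j / c y"] ballI)
        thus False using False by contradiction
      qed
      hence "\<forall>m\<in>M. (\<Sum>j\<in>J. c j * f j m) = 0" using s by simp
      thus "c j = 0" using J(2) cy j unfolding rows_independent_def by blast
    qed
    have "\<exists>C. \<forall>m\<in>M. f z m = (\<Sum>j\<in>insert y J. C j * f j m)" if z: "z \<in> insert y I" for z
    proof (cases "z = y")
      case True
      have "f y m = (\<Sum>j\<in>insert y J. (if j = y then 1 else 0) * f j m)" for m
      proof -
        have "(\<Sum>j\<in>J. (if j = y then 1 else 0) * f j m) = 0" using yJ by (intro sum.neutral) auto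
        thus ?thesis using finJ yJ by simp
      qed
      thus ?thesis using True by (intro exI[of _ "\<lambda>j. if j = y then 1 else 0"]) simp
    next
      case False
      then obtain C where C: "\<forall>m\<in>M. f z m = (\<Sum>j\<in>J. C j * f j m)" using J(3) z by blast
      have "f z m = (\<Sum>j\<in>insert y J. (if j = y then 0 else C j) * f j m)" if "m \<in> M" for m
      proof -
        have "(\<Sum>j\<in>J. (if j = y then 0 else C j) * f j m) = (\<Sum>j\<in>J. C j * f j m)" using yJ by (intro sum.cong) auto
        thus ?thesis using finJ yJ C that by simp
      qed
      thus ?thesis by (intro exI[of _ "\<lambda>j. if j = y then 0 else C j"] ballI)
    qed
    thus ?thesis using J(1) ind by (intro exI[of _ "insert y J"]) auto
  qed
qed

lemma no_annihilator_card:
  fixes f :: "'j \<Rightarrow> 'm \<Rightarrow> 'a::field"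
  assumes fin: "finite I" "finite M"
    and no: "\<And>\<phi>. (\<And>i. i \<in> I \<Longrightarrow> (\<Sum>m\<in>M. \<phi> m * f i m) = 0) \<Longrightarrow> \<forall>m\<in>M. \<phi> m = 0"
    and J: "J \<subseteq> I" "\<forall>y\<in>I. \<exists>C. \<forall>m\<in>M. f y m = (\<Sum>j\<in>J. C j * f j m)"
  shows "card M \<le> card J"
proof (rule ccontr)
  have finJ: "finite J" using J(1) fin(1) finite_subset by blast
  assume "\<not> ?thesis"
  hence "card J < card M" by simp
  from linear_relation[OF fin(2) finJ this, of "\<lambda>m j. f j m"] obtain \<phi> where
    \<phi>: "\<exists>m\<in>M. \<phi> m \<noteq> 0" "\<forall>j\<in>J. (\<Sum>m\<in>M. \<phi> m * f j m) = 0" by blast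
  have "(\<Sum>m\<in>M. \<phi> m * f i m) = 0" if iI: "i \<in> I" for i
  proof -
    obtain C where C: "\<forall>m\<in>M. f i m = (\<Sum>j\<in>J. C j * f j m)" using bspec[OF J(2) iI] ..
    have "(\<Sum>m\<in>M. \<phi> m * f i m) = (\<Sum>m\<in>M. \<Sum>j\<in>J. C j * (\<phi> m * f j m))"
      using C by (intro sum.cong refl) (simp add: sum_distrib_left mult_ac)
    also have "\<dots> = (\<Sum>j\<in>J. C j * (\<Sum>m\<in>M. \<phi> m * f j m))"
      by (subst sum.swap) (simp add: sum_distrib_left)
    finally show ?thesis using \<phi>(2) by simp
  qed
  hence "\<forall>m\<in>M. \<phi> m = 0" by (rule no[of \<phi>])
  thus False using \<phi>(1) by blast
qed

lemma no_annihilator_imp_independent: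
  fixes f :: "'j \<Rightarrow> 'm \<Rightarrow> 'a::field"
  assumes fin: "finite I" "finite M"
    and no: "\<And>\<phi>. (\<And>i. i \<in> I \<Longrightarrow> (\<Sum>m\<in>M. \<phi> m * f i m) = 0) \<Longrightarrow> \<forall>m\<in>M. \<phi> m = 0"
    and card: "card I \<le> card M"
  shows "rows_independent I M f"
proof -
  obtain J where J: "J \<subseteq> I" "rows_independent J M f" "\<forall>y\<in>I. \<exists>C. \<forall>m\<in>M. f y m = (\<Sum>j\<in>J. C j * f j m)"
    using maximal_rows[OF fin(1), of M f] by (elim exE conjE)
  have "card M \<le> card J" by (rule no_annihilator_card[OF fin no J(1,3)])
  hence "J = I" using card J(1) fin(1) by (intro card_seteq) auto
  thus ?thesis using J(2) by simp
qed

text \<open>Duality, in coordinates: if no nonzero functional kills the rows, they span.\<close>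

lemma no_annihilator_imp_spanning:
  fixes f :: "'j \<Rightarrow> 'm \<Rightarrow> 'a::field"
  assumes fin: "finite I" "finite M"
    and no: "\<And>\<phi>. (\<And>i. i \<in> I \<Longrightarrow> (\<Sum>m\<in>M. \<phi> m * f i m) = 0) \<Longrightarrow> \<forall>m\<in>M. \<phi> m = 0"
  shows "\<exists>c. \<forall>m\<in>M. v m = (\<Sum>i\<in>I. c i * f i m)"
proof -
  obtain J where J: "J \<subseteq> I" "rows_independent J M f" "\<forall>y\<in>I. \<exists>C. \<forall>m\<in>M. f y m = (\<Sum>j\<in>J. C j * f j m)"
    using maximal_rows[OF fin(1), of M f] by (elim exE conjE)
  have finJ: "finite J" using J(1) fin(1) finite_subset by blast
  have "card M \<le> card J" by (rule no_annihilator_card[OF fin no J(1,3)])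
  define g where "g k m = (case k of None \<Rightarrow> v m | Some j \<Rightarrow> f j m)" for k m
  have "card M < card (insert None (Some ` J))"
    using \<open>card M \<le> card J\<close> finJ by (simp add: card_image)
  from linear_relation[OF _ fin(2) this, of g] finJ obtain c where
    c: "\<exists>k\<in>insert None (Some ` J). c k \<noteq> 0" "\<forall>m\<in>M. (\<Sum>k\<in>insert None (Some ` J). c k * g k m) = 0" by auto
  have s: "c None * v m = - (\<Sum>j\<in>J. c (Some j) * f j m)" if "m \<in> M" for m
    using c(2) that finJ by (auto simp: g_def sum.reindex eq_neg_iff_add_eq_0)
  have nz: "c None \<noteq> 0"
  proof
    assume z: "c None = 0"
    hence "\<forall>m\<in>M. (\<Sum>j\<in>J. c (Some j) * f j m) = 0" using s by simp
    hence "\<forall>j\<in>J. c (Some j) = 0"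
      using J(2)[unfolded rows_independent_def, rule_format, of "\<lambda>j. c (Some j)"] by blast
    thus False using c(1) z by auto
  qed
  have "v m = (\<Sum>i\<in>I. (if i \<in> J then - c (Some i) / c None else 0) * f i m)" if "m \<in> M" for m
  proof -
    have "v m = (c None * v m) / c None" using nz by simp
    also have "\<dots> = (\<Sum>j\<in>J. (- c (Some j) / c None) * f j m)"
      unfolding s[OF that] by (simp add: sum_divide_distrib sum_negf[symmetric])
    also have "\<dots> = (\<Sum>i\<in>I. (if i \<in> J then - c (Some i) / c None else 0) * f i m)"
      by (rule sum.mono_neutral_cong_left) (use J(1) fin in auto)
    finally show ?thesis .
  qed
  thus ?thesis by (intro exI[of _ "\<lambda>i. if i \<in> J then - c (Some i) / c None else 0"] ballI)
qed

text \<open>Let \<open>v\<close> be a direction in which the lowest-order form of \<open>P\<close>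
at \<open>y\<close> does not vanish. Along \<open>y + \<epsilon> v + \<epsilon>\<^sup>2 w\<close>
the lowest coefficient is the same as along \<open>y + \<epsilon> v\<close>, so no choice of
\<open>w\<close> makes \<open>P\<close> vanish on the curve. Thus a set that contains, through one
point, such a quadratic curve for every tangent vector \<open>v\<close> is dense. No derivative of
\<open>P\<close> is involved, and the argument is valid in every characteristic.\<close>

lemma second_order_variation:
  fixes P :: "('m \<Rightarrow> 'a::alg_closed_field) \<Rightarrow> 'a"
  assumes P: "P \<in> polyfun M" "P z \<noteq> 0"
  shows "\<exists>v. \<forall>w. \<exists>\<epsilon>. P (\<lambda>m. y m + \<epsilon> * v m + \<epsilon> * \<epsilon> * w m) \<noteq> 0"
proof -
  have "\<forall>v. \<exists>p. \<forall>t. poly p t = P (\<lambda>m. y m + t * v m)" using polyfun_line[OF P(1), of y] by blast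
  from choice[OF this] obtain p where p: "\<forall>v t. poly (p v) t = P (\<lambda>m. y m + t * v m)" by blast
  have "poly (p (\<lambda>m. z m - y m)) 1 \<noteq> 0" using p P(2) by simp
  hence "p (\<lambda>m. z m - y m) \<noteq> 0" by auto
  hence "\<exists>k v. coeff (p v) k \<noteq> 0" by (metis leading_coeff_0_iff)
  \<comment> \<open>the multiplicity of \<open>P\<close> at \<open>y\<close>\<close>
  then obtain \<kappa> where k: "\<exists>v. coeff (p v) \<kappa> \<noteq> 0" and low: "\<And>j. j < \<kappa> \<Longrightarrow> \<not> (\<exists>v. coeff (p v) j \<noteq> 0)"
    using exists_least_iff[of "\<lambda>k. \<exists>v. coeff (p v) k \<noteq> 0"] by blast
  from k obtain v where v: "coeff (p v) \<kappa> \<noteq> 0" by blast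
  have "\<exists>\<epsilon>. P (\<lambda>m. y m + \<epsilon> * v m + \<epsilon> * \<epsilon> * w m) \<noteq> 0" for w
  proof -
    \<comment> \<open>treat the direction \<open>v + \<delta> w\<close> with a second parameter and set \<open>\<delta> = \<epsilon>\<close> at the end\<close>
    define R where "R = {F :: 'a \<times> 'a \<Rightarrow> 'a. \<exists>H :: 'a poly poly. \<forall>\<epsilon> \<delta>. F (\<epsilon>, \<delta>) = poly (poly H [:\<epsilon>:]) \<delta>}"
    have R: "fun_alg R" unfolding fun_alg_def
    proof (intro conjI allI ballI)
      fix a show "(\<lambda>_. a) \<in> R" unfolding R_def by (auto intro!: exI[of _ "[:[:a:]:]"])
    next
      fix F G assume "F \<in> R" "G \<in> R"
      then obtain H K where "\<forall>\<epsilon> \<delta>. F (\<epsilon>, \<delta>) = poly (poly H [:\<epsilon>:]) \<delta>" "\<forall>\<epsilon> \<delta>. G (\<epsilon>, \<delta>) = poly (poly K [:\<epsilon>:]) \<delta>"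
        unfolding R_def by auto
      hence "\<forall>\<epsilon> \<delta>. F (\<epsilon>, \<delta>) + G (\<epsilon>, \<delta>) = poly (poly (H + K) [:\<epsilon>:]) \<delta>"
        "\<forall>\<epsilon> \<delta>. F (\<epsilon>, \<delta>) * G (\<epsilon>, \<delta>) = poly (poly (H * K) [:\<epsilon>:]) \<delta>" by simp_all
      thus "(\<lambda>x. F x + G x) \<in> R" "(\<lambda>x. F x * G x) \<in> R" unfolding R_def by blast+
    qed
    have "(\<lambda>x. P (\<lambda>m. y m + fst x * (v m + snd x * w m))) \<in> R"
    proof (rule polyfun_comp[OF P(1) R])
      fix m show "(\<lambda>x. y m + fst x * (v m + snd x * w m)) \<in> R" unfolding R_def
        by (auto intro!: exI[of _ "[:[:y m:], [:v m, w m:]:]"] simp: algebra_simps)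
    qed
    then obtain H where H: "\<And>\<epsilon> \<delta>. P (\<lambda>m. y m + \<epsilon> * (v m + \<delta> * w m)) = poly (poly H [:\<epsilon>:]) \<delta>"
      unfolding R_def by auto
    have coeffs: "poly (coeff H j) \<delta> = coeff (p (\<lambda>m. v m + \<delta> * w m)) j" for j \<delta>
    proof -
      have "poly (map_poly (\<lambda>h. poly h \<delta>) H) \<epsilon> = poly (p (\<lambda>m. v m + \<delta> * w m)) \<epsilon>" for \<epsilon>
      proof -
        have "poly (map_poly (\<lambda>h. poly h \<delta>) H) \<epsilon> = poly (poly H [:\<epsilon>:]) \<delta>"
          by (induction H) (auto simp: map_poly_pCons)
        thus ?thesis using p H by simp
      qed
      hence "poly (map_poly (\<lambda>h. poly h \<delta>) H - p (\<lambda>m. v m + \<delta> * w m)) \<epsilon> = 0" for \<epsilon> by simp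
      hence "map_poly (\<lambda>h. poly h \<delta>) H - p (\<lambda>m. v m + \<delta> * w m) = 0" by (intro poly_cofinite_zero[of "{}"]) auto
      hence "coeff (map_poly (\<lambda>h. poly h \<delta>) H) j = coeff (p (\<lambda>m. v m + \<delta> * w m)) j" by simp
      thus ?thesis by (simp add: coeff_map_poly)
    qed
    have zero: "coeff H j = 0" if "j < \<kappa>" for j
      by (rule poly_cofinite_zero[of "{}"]) (use coeffs low[OF that] in auto)
    define H' where "H' = poly_shift \<kappa> H"
    have "H = monom 1 \<kappa> * H'"
      by (rule poly_eqI) (auto simp: coeff_monom_mult H'_def coeff_poly_shift zero)
    hence eq: "poly H [:0, 1:] = [:0, 1:] ^ \<kappa> * poly H' [:0, 1:]" by (simp add: poly_monom)
    have "poly (poly H' [:0, 1:]) 0 = poly (coeff H' 0) 0" by (cases H') auto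
    also have "\<dots> = coeff (p v) \<kappa>" using coeffs[of \<kappa> 0] by (simp add: H'_def coeff_poly_shift)
    finally have "poly H' [:0, 1:] \<noteq> 0" using v by auto
    hence "poly H [:0, 1:] \<noteq> 0" unfolding eq by simp
    then obtain \<epsilon> where \<epsilon>: "poly (poly H [:0, 1:]) \<epsilon> \<noteq> 0"
      using poly_cofinite_zero[of "{}" "poly H [:0, 1:]"] by auto
    have "poly (poly H [:0, 1:]) \<epsilon> = poly (poly H [:\<epsilon>:]) \<epsilon>" by (induction H) auto
    hence "P (\<lambda>m. y m + \<epsilon> * (v m + \<epsilon> * w m)) \<noteq> 0" using H \<epsilon> by simp
    thus ?thesis by (intro exI[of _ \<epsilon>]) (simp add: algebra_simps)
  qed
  thus ?thesis by blast
qed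

lemma convex_le_endpoints:
  fixes f :: "nat \<Rightarrow> int"
  assumes "\<And>q. f (Suc q) - f q \<le> f (Suc (Suc q)) - f (Suc q)" "a \<le> q" "q \<le> b"
  shows "f q \<le> max (f a) (f b)"
proof (cases "f q \<le> f (Suc q)")
  case True
  have up: "f i \<le> f (Suc i)" if "q \<le> i" for i using that
  proof (induction i rule: dec_induct)
    case base show ?case by (rule True)
  next
    case (step i) thus ?case using assms(1)[of i] by linarith
  qed
  have "f q \<le> f b" using assms(3)
  proof (induction b rule: dec_induct)
    case (step i) thus ?case using up[of i] by linarith
  qed simp
  thus ?thesis by simp
next
  case False
  have down: "f (Suc i) \<le> f i" if "i \<le> q" for i using that
  proof (induction i rule: inc_induct)
    case base show ?case using False by simp
  next
    case (step i) thus ?case using assms(1)[of i] by linarith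
  qed
  have "f q \<le> f a" using assms(2)
  proof (induction a rule: inc_induct)
    case (step i) thus ?case using down[of i] by linarith
  qed simp
  thus ?thesis by simp
qed

lemma absorb: "d > 0 \<Longrightarrow> d * ((c + d - 1) choose d) = c * ((c + d - 1) choose (d - 1))"
  using binomial_absorption[of "d - 1" "c + d - 1"] binomial_absorb_comp[of "c + d - 1" "d - 1"] by simp

text \<open>Divided by \<open>q\<close> and multiplied by \<open>d\<close>, the inequality compares
a convex function of \<open>q\<close> with a constant. At \<open>q = 1\<close> it says \<open>c
\<le> r\<close> and at \<open>q = c\<close> it is the hypothesis on \<open>r c\<close>.\<close>

lemma rank_ineq:
  assumes d: "2 \<le> d" and q: "1 \<le> q" "q \<le> c" and r: "c \<le> r" "(c + d - 1) choose d \<le> r * c"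
  shows "q * (c - q) + ((q + d - 1) choose d) \<le> r * q"
proof -
  define f where "f k = int ((k + d - 1) choose (d - 1)) - int d * int k" for k
  have f: "f q \<le> max (f 1) (f c)"
  proof (rule convex_le_endpoints)
    fix k
    define d' where "d' = d - 2"
    have d': "d = Suc (Suc d')" using d by (simp add: d'_def)
    have "(Suc (k + d')) choose d' \<le> (Suc (Suc (k + d'))) choose d'" by (rule binomial_right_mono) simp
    thus "f (Suc k) - f k \<le> f (Suc (Suc k)) - f (Suc k)" by (simp add: f_def d' algebra_simps)
  qed (use q in auto)
  have "d choose (d - 1) = d" using d binomial_symmetric[of 1 d] by simp
  hence "f 1 = 0" by (simp add: f_def)
  moreover have "f c \<le> int d * (int r - int c)"
  proof -
    have "d * ((c + d - 1) choose d) \<le> d * (r * c)" using r(2) by simp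
    hence "c * ((c + d - 1) choose (d - 1)) \<le> c * (d * r)"
      unfolding absorb[of d c, symmetric, OF order_less_le_trans[OF pos2 d]] by (simp only: mult_ac)
    hence "((c + d - 1) choose (d - 1)) \<le> d * r" using q by simp
    hence "int ((c + d - 1) choose (d - 1)) \<le> int (d * r)" by (simp only: of_nat_le_iff)
    thus ?thesis by (simp add: f_def algebra_simps)
  qed
  moreover have "0 \<le> int d * (int r - int c)" using r by simp
  ultimately have "f q \<le> int d * (int r - int c)" using f by simp
  hence "int d * int (c - q) + int ((q + d - 1) choose (d - 1)) \<le> int d * int r"
    using q by (simp add: f_def of_nat_diff algebra_simps)
  hence "d * (c - q) + ((q + d - 1) choose (d - 1)) \<le> d * r" by (simp only: of_nat_mult[symmetric] of_nat_add[symmetric] of_nat_le_iff)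
  hence "q * (d * (c - q) + ((q + d - 1) choose (d - 1))) \<le> q * (d * r)" by (rule mult_le_mono2)
  hence "d * (q * (c - q) + ((q + d - 1) choose d)) \<le> d * (r * q)"
    using absorb[of d q] d by (simp add: algebra_simps)
  thus ?thesis using d by simp
qed

section \<open>Forms spanning the next degree\<close>

abbreviation x1 :: "nat \<Rightarrow> nat \<Rightarrow>\<^sub>0 nat" where "x1 y \<equiv> Poly_Mapping.single y 1"

lemma mons_remove:
  assumes "finite Y" "m \<in> mons Y d" "y \<in> Y" "0 < lkp m y"
  shows "m - x1 y \<in> mons Y (d - 1)" "m = (m - x1 y) + x1 y" "0 < d"
proof -
  show eq: "m = (m - x1 y) + x1 y"
    by (rule poly_mapping_eqI) (use assms in \<open>auto simp: lookup_add lookup_minus lookup_single when_def\<close>)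
  have "(\<Sum>i\<in>Y. lkp m i) = (\<Sum>i\<in>Y. lkp (m - x1 y) i) + (\<Sum>i\<in>Y. lkp (x1 y) i)"
    by (subst eq) (simp add: lookup_add sum.distrib)
  moreover have "(\<Sum>i\<in>Y. lkp (x1 y) i) = 1"
    using assms by (simp add: lookup_single when_def sum.delta')
  moreover have "supp (m - x1 y) \<subseteq> supp m" by (auto simp: in_keys_iff lookup_minus)
  ultimately show "m - x1 y \<in> mons Y (d - 1)" "0 < d" using assms by (auto simp: mons_def)
qed

lemma x1_mons: "finite Y \<Longrightarrow> y \<in> Y \<Longrightarrow> x1 y \<in> mons Y 1"
  by (simp add: mons_def lookup_single when_def sum.delta')

lemma mons_mono: "finite Y \<Longrightarrow> J \<subseteq> Y \<Longrightarrow> mons J d \<subseteq> mons Y d"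
proof
  fix m assume f: "finite Y" "J \<subseteq> Y" and m: "m \<in> mons J d"
  have "(\<Sum>i\<in>Y. lkp m i) = (\<Sum>i\<in>J. lkp m i)"
    by (rule sum.mono_neutral_right) (use f m in \<open>auto simp: mons_def in_keys_iff\<close>)
  thus "m \<in> mons Y d" using m f by (auto simp: mons_def)
qed

text \<open>A functional \<open>\<phi>\<close> on forms of degree \<open>d\<close> gives the
functionals \<open>\<mu> \<mapsto> \<phi> (\<mu> + x1 y)\<close> on degree \<open>d - 1\<close>.
Here those with \<open>y \<notin> J\<close> are combinations of those with \<open>y \<in> J\<close>,
with coefficients \<open>C\<close>; the least possible size of \<open>J\<close> is the rank of
\<open>\<phi>\<close>.\<close>

definition functional_rel :: "nat set \<Rightarrow> nat set \<Rightarrow> nat \<Rightarrow> (nat \<Rightarrow> nat \<Rightarrow> 'a::field) \<Rightarrow> ((nat \<Rightarrow>\<^sub>0 nat) \<Rightarrow> 'a) \<Rightarrow> bool" where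
  "functional_rel Y J d C \<phi> \<longleftrightarrow>
     (\<forall>y\<in>Y - J. \<forall>\<mu>\<in>mons Y (d - 1). \<phi> (\<mu> + x1 y) = (\<Sum>j\<in>J. C y j * \<phi> (\<mu> + x1 j)))"

text \<open>A functional of rank \<open>|J|\<close> is determined by the coefficients
\<open>C\<close> and its values on the monomials in \<open>J\<close>. It is scaled to be 1 at
\<open>m0\<close>, which saves one parameter.\<close>

definition functional_params :: "nat set \<Rightarrow> nat set \<Rightarrow> nat \<Rightarrow> (nat \<Rightarrow>\<^sub>0 nat) \<Rightarrow> ((nat \<times> nat) + (nat \<Rightarrow>\<^sub>0 nat)) set" where
  "functional_params Y J d m0 = Inl ` ((Y - J) \<times> J) \<union> Inr ` (mons J d - {m0})"

text \<open>Replacing a variable outside \<open>J\<close> by variables in \<open>J\<close>, one at a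
time, expresses each value of \<open>\<phi>\<close> in terms of the parameters.\<close>

lemma functional_poly:
  fixes m :: "nat \<Rightarrow>\<^sub>0 nat"
  assumes Y: "finite Y" "J \<subseteq> Y" and m: "m \<in> mons Y d"
  shows "\<exists>p :: ((nat \<times> nat) + (nat \<Rightarrow>\<^sub>0 nat) \<Rightarrow> 'a::field) \<Rightarrow> 'a. p \<in> polyfun (functional_params Y J d m0) \<and>
    (\<forall>C \<phi>. \<phi> m0 = 1 \<and> functional_rel Y J d C \<phi> \<longrightarrow> p (case_sum (\<lambda>(y, j). C y j) \<phi>) = \<phi> m)"
  using m
proof (induction "\<Sum>y\<in>Y - J. lkp m y" arbitrary: m rule: less_induct)
  case less
  let ?V = "functional_params Y J d m0"
  show ?case
  proof (cases "\<exists>y\<in>Y - J. 0 < lkp m y")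
    case False
    hence "m \<in> mons J d"
    proof -
      have "(\<Sum>i\<in>Y. lkp m i) = (\<Sum>i\<in>J. lkp m i)"
        by (rule sum.mono_neutral_right) (use Y False in auto)
      moreover have "supp m \<subseteq> J" using less.prems False by (auto simp: mons_def in_keys_iff)
      ultimately show ?thesis using less.prems by (simp add: mons_def)
    qed
    show ?thesis
    proof (cases "m = m0")
      case True
      thus ?thesis by (intro exI[of _ "\<lambda>_. 1"]) (auto intro: polyfun_const)
    next
      case False
      hence "(\<lambda>x. x (Inr m)) \<in> polyfun ?V"
        using \<open>m \<in> mons J d\<close> by (intro polyfun_var) (auto simp: functional_params_def)
      thus ?thesis by (intro exI[of _ "\<lambda>x. x (Inr m)"]) auto
    qed
  next
    case True
    then obtain y where y: "y \<in> Y - J" "0 < lkp m y" by blast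
    define \<mu> where "\<mu> = m - x1 y"
    have \<mu>: "\<mu> \<in> mons Y (d - 1)" "m = \<mu> + x1 y" "0 < d"
      using mons_remove[OF Y(1) less.prems, of y] y by (auto simp: \<mu>_def)
    have "\<forall>j\<in>J. \<exists>p :: ((nat \<times> nat) + (nat \<Rightarrow>\<^sub>0 nat) \<Rightarrow> 'a) \<Rightarrow> 'a. p \<in> polyfun ?V \<and>
      (\<forall>C \<phi>. \<phi> m0 = 1 \<and> functional_rel Y J d C \<phi> \<longrightarrow> p (case_sum (\<lambda>(y, j). C y j) \<phi>) = \<phi> (\<mu> + x1 j))"
    proof
      fix j assume j: "j \<in> J"
      have "\<mu> + x1 j \<in> mons Y d" using mons_add[OF \<mu>(1) x1_mons[OF Y(1), of j]] j Y \<mu>(3) by auto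
      moreover have "(\<Sum>z\<in>Y - J. lkp (\<mu> + x1 j) z) < (\<Sum>z\<in>Y - J. lkp m z)"
      proof (rule sum_strict_mono_ex1)
        show "finite (Y - J)" using Y by simp
        show "\<forall>z\<in>Y - J. lkp (\<mu> + x1 j) z \<le> lkp m z"
          using j by (auto simp: \<mu>_def lookup_add lookup_minus lookup_single when_def)
        show "\<exists>z\<in>Y - J. lkp (\<mu> + x1 j) z < lkp m z"
          using y j by (intro bexI[of _ y]) (auto simp: \<mu>_def lookup_add lookup_minus lookup_single when_def)
      qed
      ultimately show "\<exists>p :: ((nat \<times> nat) + (nat \<Rightarrow>\<^sub>0 nat) \<Rightarrow> 'a) \<Rightarrow> 'a. p \<in> polyfun ?V \<and>
        (\<forall>C \<phi>. \<phi> m0 = 1 \<and> functional_rel Y J d C \<phi> \<longrightarrow> p (case_sum (\<lambda>(y, j). C y j) \<phi>) = \<phi> (\<mu> + x1 j))"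
        by (rule less.hyps[rotated])
    qed
    from bchoice[OF this] obtain p :: "nat \<Rightarrow> ((nat \<times> nat) + (nat \<Rightarrow>\<^sub>0 nat) \<Rightarrow> 'a) \<Rightarrow> 'a" where
      p: "\<forall>j\<in>J. p j \<in> polyfun ?V \<and> (\<forall>C \<phi>. \<phi> m0 = 1 \<and> functional_rel Y J d C \<phi> \<longrightarrow>
        p j (case_sum (\<lambda>(y, j). C y j) \<phi>) = \<phi> (\<mu> + x1 j))" by (elim exE)
    show ?thesis
    proof (intro exI[of _ "\<lambda>x. \<Sum>j\<in>J. x (Inl (y, j)) * p j x"] conjI allI impI)
      show "(\<lambda>x. \<Sum>j\<in>J. x (Inl (y, j)) * p j x) \<in> polyfun ?V"
      proof (intro fun_alg_sum fun_alg_mult fun_alg_polyfun polyfun_var)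
        fix j assume "j \<in> J"
        thus "Inl (y, j) \<in> ?V" "p j \<in> polyfun ?V" using y p by (auto simp: functional_params_def)
      qed
      fix C :: "nat \<Rightarrow> nat \<Rightarrow> 'a" and \<phi> :: "(nat \<Rightarrow>\<^sub>0 nat) \<Rightarrow> 'a"
      assume rel: "\<phi> m0 = 1 \<and> functional_rel Y J d C \<phi>"
      hence "\<phi> m = (\<Sum>j\<in>J. C y j * \<phi> (\<mu> + x1 j))" using \<mu> y unfolding functional_rel_def by auto
      also have "\<dots> = (\<Sum>j\<in>J. C y j * p j (case_sum (\<lambda>(y, j). C y j) \<phi>))"
        using p rel by (intro sum.cong refl) auto
      finally show "(\<Sum>j\<in>J. case_sum (\<lambda>(y, j). C y j) \<phi> (Inl (y, j)) * p j (case_sum (\<lambda>(y, j). C y j) \<phi>)) = \<phi> m"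
        by simp
    qed
  qed
qed

lemma functional_zero:
  fixes m :: "nat \<Rightarrow>\<^sub>0 nat" and \<phi> :: "_ \<Rightarrow> 'a::field"
  assumes Y: "finite Y" "J \<subseteq> Y" and rel: "functional_rel Y J d C \<phi>" and z: "\<And>m. m \<in> mons J d \<Longrightarrow> \<phi> m = 0"
    and m: "m \<in> mons Y d"
  shows "\<phi> m = 0"
  using m
proof (induction "\<Sum>y\<in>Y - J. lkp m y" arbitrary: m rule: less_induct)
  case less
  show ?case
  proof (cases "\<exists>y\<in>Y - J. 0 < lkp m y")
    case False
    have "(\<Sum>i\<in>Y. lkp m i) = (\<Sum>i\<in>J. lkp m i)"
      by (rule sum.mono_neutral_right) (use Y False in auto)
    moreover have "supp m \<subseteq> J" using less.prems False by (auto simp: mons_def in_keys_iff)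
    ultimately have "m \<in> mons J d" using less.prems by (simp add: mons_def)
    thus ?thesis by (rule z)
  next
    case True
    then obtain y where y: "y \<in> Y - J" "0 < lkp m y" by blast
    define \<mu> where "\<mu> = m - x1 y"
    have \<mu>: "\<mu> \<in> mons Y (d - 1)" "m = \<mu> + x1 y" "0 < d"
      using mons_remove[OF Y(1) less.prems, of y] y by (auto simp: \<mu>_def)
    have "\<phi> (\<mu> + x1 j) = 0" if j: "j \<in> J" for j
    proof (rule less.hyps)
      show "\<mu> + x1 j \<in> mons Y d" using mons_add[OF \<mu>(1) x1_mons[OF Y(1), of j]] j Y \<mu>(3) by auto
      show "(\<Sum>z\<in>Y - J. lkp (\<mu> + x1 j) z) < (\<Sum>z\<in>Y - J. lkp m z)"
      proof (rule sum_strict_mono_ex1)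
        show "finite (Y - J)" using Y by simp
        show "\<forall>z\<in>Y - J. lkp (\<mu> + x1 j) z \<le> lkp m z"
          using j by (auto simp: \<mu>_def lookup_add lookup_minus lookup_single when_def)
        show "\<exists>z\<in>Y - J. lkp (\<mu> + x1 j) z < lkp m z"
          using y j by (intro bexI[of _ y]) (auto simp: \<mu>_def lookup_add lookup_minus lookup_single when_def)
      qed
    qed
    thus ?thesis using rel y \<mu> unfolding functional_rel_def by simp
  qed
qed

text \<open>The tuples of forms \<open>F\<^sub>i\<close> of degree \<open>d - 1\<close>, given by
their coefficients, for which the products \<open>y F\<^sub>i\<close> lie in a hyperplane of the
forms of degree \<open>d\<close>.\<close>

definition not_spanning :: "nat \<Rightarrow> nat set \<Rightarrow> nat \<Rightarrow> (nat \<times> (nat \<Rightarrow>\<^sub>0 nat) \<Rightarrow> 'a::field) set" where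
  "not_spanning r Y d = {F. \<exists>\<phi>. (\<exists>m\<in>mons Y d. \<phi> m \<noteq> 0) \<and>
     (\<forall>i<r. \<forall>y\<in>Y. (\<Sum>\<mu>\<in>mons Y (d - 1). \<phi> (\<mu> + x1 y) * F (i, \<mu>)) = 0)}"

text \<open>The functionals of rank \<open>q = |J|\<close> have \<open>q (|Y| - q) + C(q + d - 1, d)
- 1\<close> parameters, and such a functional imposes \<open>q\<close> independent conditions on
each of the \<open>r\<close> forms, with solutions parametrized rationally by the
elimination.\<close>

lemma thin_stratum:
  fixes p :: "(nat \<Rightarrow>\<^sub>0 nat) \<Rightarrow> (nat \<Rightarrow>\<^sub>0 nat) \<Rightarrow> ((nat \<times> nat) + (nat \<Rightarrow>\<^sub>0 nat) \<Rightarrow> 'a::alg_closed_field) \<Rightarrow> 'a"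
  assumes Y: "finite Y" "J \<subseteq> Y" and m0: "m0 \<in> mons J d"
    and P: "P \<subseteq> mons Y (d - 1)" "card P = card J" and g: "g \<in> polyfun (functional_params Y J d m0)"
    and p: "\<And>\<mu> \<nu>. \<mu> \<in> P \<Longrightarrow> \<nu> \<in> mons Y (d - 1) - P \<Longrightarrow> p \<mu> \<nu> \<in> polyfun (functional_params Y J d m0)"
    and num: "card J * (card Y - card J) + card (mons J d) \<le> r * card J"
  shows "thin ({..<r} \<times> mons Y (d - 1)) {F. \<exists>x. g x \<noteq> 0 \<and>
    (\<forall>i<r. \<forall>\<mu>\<in>P. g x * F (i, \<mu>) = (\<Sum>\<nu>\<in>mons Y (d - 1) - P. p \<mu> \<nu> x * F (i, \<nu>)))}"
proof -
  let ?M = "mons Y (d - 1)" and ?U = "functional_params Y J d m0"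
  let ?V = "Inl ` ?U \<union> Inr ` ({..<r} \<times> (?M - P))"
  have finJ: "finite J" using Y finite_subset by blast
  have fin: "finite ?U" "finite ?M" "finite P"
    using Y finJ P finite_mons finite_subset by (auto simp: functional_params_def intro: finite_subset)
  define F where "F x k = (if snd k \<in> P
      then (\<Sum>\<nu>\<in>?M - P. p (snd k) \<nu> (\<lambda>v. x (Inl v)) * x (Inr (fst k, \<nu>)))
      else g (\<lambda>v. x (Inl v)) * x (Inr k))" for x :: "_ \<Rightarrow> 'a" and k :: "nat \<times> (nat \<Rightarrow>\<^sub>0 nat)"
  have lift: "(\<lambda>x :: ((nat \<times> nat) + (nat \<Rightarrow>\<^sub>0 nat)) + (nat \<times> (nat \<Rightarrow>\<^sub>0 nat)) \<Rightarrow> 'a. f (\<lambda>v. x (Inl v))) \<in> polyfun ?V" if "f \<in> polyfun ?U" for f :: "((nat \<times> nat) + (nat \<Rightarrow>\<^sub>0 nat) \<Rightarrow> 'a) \<Rightarrow> 'a"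
    by (rule polyfun_comp[OF that fun_alg_polyfun]) (auto intro: polyfun_var)
  show ?thesis
  proof (rule thin_rational_image[where V = ?V and F = F and g = "\<lambda>x. g (\<lambda>v. x (Inl v))"])
    show "finite ?V" "finite ({..<r} \<times> ?M)" using fin by auto
    show "(\<lambda>x. g (\<lambda>v. x (Inl v))) \<in> polyfun ?V" by (rule lift[OF g])
    show "card ?V < card ({..<r} \<times> ?M)"
    proof -
      have "card ?U = card ((Y - J) \<times> J) + card (mons J d - {m0})"
        unfolding functional_params_def using Y finJ finite_mons[OF finJ]
        by (subst card_Un_disjoint) (auto simp: card_image)
      also have "\<dots> = (card Y - card J) * card J + (card (mons J d) - 1)"
        using Y finJ finite_mons[OF finJ] m0 by (simp add: card_cartesian_product card_Diff_subset card_Diff_singleton)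
      finally have V0: "card ?U < r * card J"
        using num m0 finite_mons[OF finJ, of d] card_gt_0_iff[of "mons J d"] by (auto simp: mult.commute)
      have "card ?V = card ?U + r * card (?M - P)"
        using fin by (subst card_Un_disjoint) (auto simp: card_image card_cartesian_product)
      also have "card (?M - P) = card ?M - card J" using fin P by (simp add: card_Diff_subset)
      also have "card ?U + r * (card ?M - card J) < r * card J + r * (card ?M - card J)" using V0 by simp
      also have "\<dots> = r * card ?M"
        using card_mono[OF fin(2) P(1)] P(2) by (simp add: distrib_left[symmetric])
      finally show ?thesis by (simp add: card_cartesian_product)
    qed
    fix k assume k: "k \<in> {..<r} \<times> ?M"
    show "(\<lambda>x. F x k) \<in> polyfun ?V"
    proof (cases "snd k \<in> P")
      case True
      have "(\<lambda>x. \<Sum>\<nu>\<in>?M - P. p (snd k) \<nu> (\<lambda>v. x (Inl v)) * x (Inr (fst k, \<nu>))) \<in> polyfun ?V"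
        using k True by (intro fun_alg_sum fun_alg_mult fun_alg_polyfun lift p polyfun_var) auto
      thus ?thesis using True by (simp add: F_def)
    next
      case False
      have "(\<lambda>x. g (\<lambda>v. x (Inl v)) * x (Inr k)) \<in> polyfun ?V"
        using k False by (intro fun_alg_mult fun_alg_polyfun lift g polyfun_var) auto
      thus ?thesis using False by (simp add: F_def)
    qed
  next
    fix z assume "z \<in> {F. \<exists>x. g x \<noteq> 0 \<and>
      (\<forall>i<r. \<forall>\<mu>\<in>P. g x * F (i, \<mu>) = (\<Sum>\<nu>\<in>?M - P. p \<mu> \<nu> x * F (i, \<nu>)))}"
    then obtain x where x: "g x \<noteq> 0" "\<forall>i<r. \<forall>\<mu>\<in>P. g x * z (i, \<mu>) = (\<Sum>\<nu>\<in>?M - P. p \<mu> \<nu> x * z (i, \<nu>))"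
      by blast
    show "\<exists>x. g (\<lambda>v. x (Inl v)) \<noteq> 0 \<and> (\<forall>k\<in>{..<r} \<times> ?M. g (\<lambda>v. x (Inl v)) * z k = F x k)"
      using x by (intro exI[of _ "case_sum x z"]) (auto simp: F_def)
  qed
qed

text \<open>Finitely many strata cover all tuples: a set \<open>J\<close> of variables that index a
basis of the functionals \<open>\<mu> \<mapsto> \<phi> (\<mu> + x1 y)\<close>, a monomial
\<open>m0\<close> at which \<open>\<phi>\<close> does not vanish, and a choice of pivots.\<close>

lemma thin_not_spanning:
  assumes Y: "finite Y" and d: "1 \<le> d"
    and num: "\<And>q. 1 \<le> q \<Longrightarrow> q \<le> card Y \<Longrightarrow> q * (card Y - q) + ((q + d - 1) choose d) \<le> r * q"
  shows "thin ({..<r} \<times> mons Y (d - 1)) (not_spanning r Y d :: (_ \<Rightarrow> 'a::alg_closed_field) set)"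
proof -
  let ?M = "mons Y (d - 1)"
  define \<J> where "\<J> = {(J, m0). J \<subseteq> Y \<and> J \<noteq> {} \<and> m0 \<in> mons J d}"
  have "\<J> \<subseteq> (Pow Y) \<times> mons Y d" using mons_mono[OF Y] by (auto simp: \<J>_def)
  hence fin\<J>: "finite \<J>" using Y finite_mons by (meson finite_Pow_iff finite_SigmaI finite_subset)
  have "\<forall>k\<in>\<J>. \<exists>pm :: (nat \<Rightarrow>\<^sub>0 nat) \<Rightarrow> ((nat \<times> nat) + (nat \<Rightarrow>\<^sub>0 nat) \<Rightarrow> 'a) \<Rightarrow> 'a. \<forall>m\<in>mons Y d.
    pm m \<in> polyfun (functional_params Y (fst k) d (snd k)) \<and>
    (\<forall>C \<phi>. \<phi> (snd k) = 1 \<and> functional_rel Y (fst k) d C \<phi> \<longrightarrow> pm m (case_sum (\<lambda>(y, j). C y j) \<phi>) = \<phi> m)"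
  proof (rule ballI, rule bchoice, rule ballI)
    fix k m assume "k \<in> \<J>" "m \<in> mons Y d"
    thus "\<exists>p :: ((nat \<times> nat) + (nat \<Rightarrow>\<^sub>0 nat) \<Rightarrow> 'a) \<Rightarrow> 'a. p \<in> polyfun (functional_params Y (fst k) d (snd k)) \<and>
      (\<forall>C \<phi>. \<phi> (snd k) = 1 \<and> functional_rel Y (fst k) d C \<phi> \<longrightarrow> p (case_sum (\<lambda>(y, j). C y j) \<phi>) = \<phi> m)"
      using functional_poly[OF Y, of "fst k" m d "snd k", where 'a = 'a] by (auto simp: \<J>_def)
  qed
  from bchoice[OF this] obtain pm :: "_ \<Rightarrow> (nat \<Rightarrow>\<^sub>0 nat) \<Rightarrow> ((nat \<times> nat) + (nat \<Rightarrow>\<^sub>0 nat) \<Rightarrow> 'a) \<Rightarrow> 'a" where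
    pm: "\<forall>k\<in>\<J>. \<forall>m\<in>mons Y d. pm k m \<in> polyfun (functional_params Y (fst k) d (snd k)) \<and>
    (\<forall>C \<phi>. \<phi> (snd k) = 1 \<and> functional_rel Y (fst k) d C \<phi> \<longrightarrow> pm k m (case_sum (\<lambda>(y, j). C y j) \<phi>) = \<phi> m)"
    by (elim exE)
  define a where "a k j \<mu> = pm k (\<mu> + x1 j)" for k j \<mu>
  have add: "\<mu> + x1 j \<in> mons Y d" if "\<mu> \<in> ?M" "j \<in> Y" for \<mu> j
    using mons_add[OF that(1) x1_mons[OF Y that(2)]] d by simp
  have "\<forall>k\<in>\<J>. \<exists>\<C>. finite \<C> \<and>
    (\<forall>(P, g, p)\<in>\<C>. eliminates (polyfun (functional_params Y (fst k) d (snd k))) (fst k) ?M (a k) P g p) \<and>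
    (\<forall>x. rows_independent (fst k) ?M (\<lambda>j m. a k j m x) \<longrightarrow> (\<exists>(P, g, p)\<in>\<C>. g x \<noteq> 0))"
  proof
    fix k assume k: "k \<in> \<J>"
    show "\<exists>\<C>. finite \<C> \<and>
    (\<forall>(P, g, p)\<in>\<C>. eliminates (polyfun (functional_params Y (fst k) d (snd k))) (fst k) ?M (a k) P g p) \<and>
    (\<forall>x. rows_independent (fst k) ?M (\<lambda>j m. a k j m x) \<longrightarrow> (\<exists>(P, g, p)\<in>\<C>. g x \<noteq> 0))"
    proof (rule elimination)
      have "fst k \<subseteq> Y" using k by (auto simp: \<J>_def)
      thus "finite (fst k)" using Y by (rule finite_subset)
      show "finite ?M" by (rule finite_mons[OF Y])
      fix j m assume "j \<in> fst k" "m \<in> ?M"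
      thus "a k j m \<in> polyfun (functional_params Y (fst k) d (snd k))"
        using bspec[OF bspec[OF pm k] add[of m j]] k by (auto simp: a_def \<J>_def)
    qed simp
  qed
  from bchoice[OF this] obtain \<C> where \<C>: "\<forall>k\<in>\<J>. finite (\<C> k) \<and>
    (\<forall>(P, g, p)\<in>\<C> k. eliminates (polyfun (functional_params Y (fst k) d (snd k))) (fst k) ?M (a k) P g p) \<and>
    (\<forall>x. rows_independent (fst k) ?M (\<lambda>j m. a k j m x) \<longrightarrow> (\<exists>(P, g, p)\<in>\<C> k. g x \<noteq> 0))" by (elim exE)
  define Z where "Z = (\<lambda>(P, g :: ((nat \<times> nat) + (nat \<Rightarrow>\<^sub>0 nat) \<Rightarrow> 'a) \<Rightarrow> 'a, p). {F :: nat \<times> (nat \<Rightarrow>\<^sub>0 nat) \<Rightarrow> 'a. \<exists>x. g x \<noteq> 0 \<and>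
    (\<forall>i<r. \<forall>\<mu>\<in>P. g x * F (i, \<mu>) = (\<Sum>\<nu>\<in>?M - P. p \<mu> \<nu> x * F (i, \<nu>)))})"
  have "thin ({..<r} \<times> ?M) (\<Union>k\<in>\<J>. \<Union>t\<in>\<C> k. Z t)"
  proof (intro thin_UN fin\<J>)
    fix k assume k: "k \<in> \<J>"
    show "finite (\<C> k)" using \<C> k by blast
    fix t assume t: "t \<in> \<C> k"
    obtain P g p where tt: "t = (P, g, p)" by (cases t)
    have J: "fst k \<subseteq> Y" "fst k \<noteq> {}" "snd k \<in> mons (fst k) d" using k by (auto simp: \<J>_def)
    have finJ: "finite (fst k)" using J Y finite_subset by blast
    have "eliminates (polyfun (functional_params Y (fst k) d (snd k))) (fst k) ?M (a k) P g p"
      using \<C> k t tt by blast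
    hence el: "P \<subseteq> ?M" "card P = card (fst k)" "g \<in> polyfun (functional_params Y (fst k) d (snd k))"
      "\<And>\<mu> \<nu>. \<mu> \<in> P \<Longrightarrow> \<nu> \<in> ?M - P \<Longrightarrow> p \<mu> \<nu> \<in> polyfun (functional_params Y (fst k) d (snd k))"
      unfolding eliminates_def by blast+
    have "card (fst k) * (card Y - card (fst k)) + card (mons (fst k) d) \<le> r * card (fst k)"
    proof -
      have "card (fst k) \<ge> 1" using J(2) finJ by (simp add: Suc_le_eq card_gt_0_iff)
      moreover have "card (fst k) \<le> card Y" using J(1) Y by (rule card_mono[rotated])
      ultimately show ?thesis using num[of "card (fst k)"] by (simp add: card_mons[OF finJ])
    qed
    from thin_stratum[OF Y J(1,3) el this] show "thin ({..<r} \<times> ?M) (Z t)" by (simp add: Z_def tt)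
  qed
  moreover have "not_spanning r Y d \<subseteq> (\<Union>k\<in>\<J>. \<Union>t\<in>\<C> k. Z t)"
  proof
    fix F :: "nat \<times> (nat \<Rightarrow>\<^sub>0 nat) \<Rightarrow> 'a" assume "F \<in> not_spanning r Y d"
    then obtain \<phi> m1 where \<phi>: "m1 \<in> mons Y d" "\<phi> m1 \<noteq> 0"
      "\<forall>i<r. \<forall>y\<in>Y. (\<Sum>\<mu>\<in>?M. \<phi> (\<mu> + x1 y) * F (i, \<mu>)) = 0" unfolding not_spanning_def by blast
    have "\<exists>J\<subseteq>Y. rows_independent J ?M (\<lambda>y \<mu>. \<phi> (\<mu> + x1 y)) \<and>
      (\<forall>y\<in>Y. \<exists>C. \<forall>\<mu>\<in>?M. \<phi> (\<mu> + x1 y) = (\<Sum>j\<in>J. C j * \<phi> (\<mu> + x1 j)))"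
      by (rule maximal_rows[OF Y, of ?M "\<lambda>y \<mu>. \<phi> (\<mu> + x1 y)"])
    then obtain J where J: "J \<subseteq> Y" "rows_independent J ?M (\<lambda>y \<mu>. \<phi> (\<mu> + x1 y))"
      "\<forall>y\<in>Y. \<exists>C. \<forall>\<mu>\<in>?M. \<phi> (\<mu> + x1 y) = (\<Sum>j\<in>J. C j * \<phi> (\<mu> + x1 j))" by (elim exE conjE)
    from bchoice[OF J(3)] obtain C where C: "\<forall>y\<in>Y. \<forall>\<mu>\<in>?M. \<phi> (\<mu> + x1 y) = (\<Sum>j\<in>J. C y j * \<phi> (\<mu> + x1 j))"
      by (elim exE)
    have rel: "functional_rel Y J d C \<phi>" using C unfolding functional_rel_def by blast
    have "\<exists>m0\<in>mons J d. \<phi> m0 \<noteq> 0" using functional_zero[OF Y J(1) rel] \<phi> by blast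
    then obtain m0 where m0: "m0 \<in> mons J d" "\<phi> m0 \<noteq> 0" by blast
    have "J \<noteq> {}" using m0 d by (auto simp: mons_def)
    hence k: "(J, m0) \<in> \<J>" using J m0 by (simp add: \<J>_def)
    define \<psi> where "\<psi> m = \<phi> m / \<phi> m0" for m
    have \<psi>: "\<psi> m0 = 1" "functional_rel Y J d C \<psi>"
      using m0 rel by (simp_all add: \<psi>_def functional_rel_def sum_divide_distrib)
    define x where "x = case_sum (\<lambda>(y, j). C y j) \<psi>"
    have ax: "a (J, m0) j \<mu> x = \<psi> (\<mu> + x1 j)" if "j \<in> J" "\<mu> \<in> ?M" for j \<mu>
      using pm[rule_format, OF k add[OF that(2), of j]] that J(1) \<psi> unfolding a_def x_def by auto
    have "rows_independent J ?M (\<lambda>j \<mu>. a (J, m0) j \<mu> x)" unfolding rows_independent_def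
    proof (rule allI, rule impI)
      fix c assume c: "\<forall>\<mu>\<in>?M. (\<Sum>j\<in>J. c j * a (J, m0) j \<mu> x) = 0"
      have "(\<Sum>j\<in>J. c j * \<phi> (\<mu> + x1 j)) = 0" if \<mu>: "\<mu> \<in> ?M" for \<mu>
      proof -
        have "(\<Sum>j\<in>J. c j * \<phi> (\<mu> + x1 j)) = \<phi> m0 * (\<Sum>j\<in>J. c j * a (J, m0) j \<mu> x)"
          unfolding sum_distrib_left
        proof (intro sum.cong refl)
          fix j assume "j \<in> J"
          thus "c j * \<phi> (\<mu> + x1 j) = \<phi> m0 * (c j * a (J, m0) j \<mu> x)"
            using ax[OF _ \<mu>, of j] m0 by (simp add: \<psi>_def)
        qed
        thus ?thesis using c \<mu> by simp
      qed
      thus "\<forall>j\<in>J. c j = 0" using J(2) unfolding rows_independent_def by blast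
    qed
    then obtain P g p where t: "(P, g, p) \<in> \<C> (J, m0)" "g x \<noteq> 0" using \<C> k by fastforce
    have el: "eliminates (polyfun (functional_params Y J d m0)) J ?M (a (J, m0)) P g p"
      using \<C> k t(1) by fastforce
    have "F \<in> Z (P, g, p)"
    proof -
      have "\<forall>\<mu>\<in>P. g x * F (i, \<mu>) = (\<Sum>\<nu>\<in>?M - P. p \<mu> \<nu> x * F (i, \<nu>))" if i: "i < r" for i
      proof -
        have "(\<Sum>m\<in>?M. a (J, m0) j m x * F (i, m)) = 0" if j: "j \<in> J" for j
        proof -
          have "(\<Sum>m\<in>?M. a (J, m0) j m x * F (i, m)) = (\<Sum>m\<in>?M. \<phi> (m + x1 j) * F (i, m)) / \<phi> m0"
            unfolding sum_divide_distrib by (intro sum.cong refl) (simp add: ax[OF j] \<psi>_def)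
          thus ?thesis using \<phi>(3) i j J(1) by auto
        qed
        thus ?thesis using el[unfolded eliminates_def, THEN conjunct2, THEN conjunct2, THEN conjunct2, THEN conjunct2,
            rule_format, of x "\<lambda>m. F (i, m)"] by blast
      qed
      thus ?thesis using t(2) unfolding Z_def by blast
    qed
    thus "F \<in> (\<Union>k\<in>\<J>. \<Union>t\<in>\<C> k. Z t)" using k t(1) by blast
  qed
  ultimately show ?thesis by (rule thin_subset)
qed

section \<open>Density of forms of bounded slice rank\<close>

lemma lookup_cst_mult [simp]: "lkp (cst a * p) m = a * lkp p m"
proof -
  have "lkp (cst a * p) m = (\<Sum>l\<in>{0}. \<Sum>k\<in>insert m (supp p). if l + k = m then lkp (cst a) l * lkp p k else 0)"
    by (rule lookup_mult_finite) (auto simp: cst_def)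
  also have "\<dots> = (\<Sum>k\<in>insert m (supp p). if k = m then a * lkp p k else 0)"
    by (simp add: cst_def)
  also have "\<dots> = a * lkp p m" by (simp add: sum.delta)
  finally show ?thesis .
qed

lemma cst_form: "cst a \<in> forms n 0"
  by (auto simp: forms_iff cst_def mons_def)

lemma cst_mult_form: "f \<in> forms n d \<Longrightarrow> cst a * f \<in> forms n d"
  using forms_mult[OF cst_form[of a n], of f d] by simp

lemma forms_add: "f \<in> forms n d \<Longrightarrow> g \<in> forms n d \<Longrightarrow> f + g \<in> forms n d"
  using keys_add[of f g] by (auto simp: forms_iff)

lemma forms_diff: "f \<in> forms n d \<Longrightarrow> g \<in> forms n d \<Longrightarrow> f - g \<in> forms n d"
  using keys_diff[of f g] by (auto simp: forms_iff)

lemma lookup_var_mult: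
  fixes p :: "'a::field mpoly"
  assumes "finite M" "supp p \<subseteq> M"
  shows "lkp (var y * p) m = (\<Sum>\<mu>\<in>M. if \<mu> + x1 y = m then lkp p \<mu> else 0)"
proof -
  have "lkp (var y * p) m = (\<Sum>l\<in>{x1 y}. \<Sum>k\<in>M. if l + k = m then lkp (var y) l * lkp p k else 0)"
    by (rule lookup_mult_finite) (use assms in \<open>auto simp: var_def\<close>)
  moreover have "lkp (var y) (x1 y) = (1 :: 'a)" by (simp add: var_def)
  ultimately show ?thesis by (simp only: sum.insert_if finite.emptyI sum.empty empty_iff if_False add_0_right mult_1 add.commute[of "x1 y"])
qed

text \<open>Take the base point \<open>f\<^sub>0 = \<Sum> x\<^sub>i G\<^sub>i\<close> with forms
\<open>G\<^sub>i\<close> in the last \<open>c\<close> variables for which the products \<open>y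
G\<^sub>i\<close> span. Any form is \<open>\<Sum> (x\<^sub>i h\<^sub>i + l\<^sub>i
G\<^sub>i)\<close> for suitable linear forms \<open>l\<^sub>i\<close> and forms
\<open>h\<^sub>i\<close>: the monomials that involve only the last variables come from the second
part, the others are divisible by some \<open>x\<^sub>i\<close>. Thus \<open>\<Sum> (x\<^sub>i +
\<epsilon> l\<^sub>i)(G\<^sub>i + \<epsilon> h\<^sub>i)\<close> is a curve of slice rank at most
\<open>r\<close> with a prescribed tangent vector, to which \<open>second_order_variation\<close>
applies.\<close>

lemma slice_dense_criterion:
  assumes n: "n + 1 = r + c" and c: "1 \<le> c" "c \<le> r" and d: "2 \<le> d"
    and rc: "(c + d - 1) choose d \<le> r * c"
  shows "slice_dense TYPE('a::alg_closed_field) n d r"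
proof (unfold slice_dense_def, rule notI)
  let ?W = "sums_of_products n d r (\<lambda>_. 1) :: 'a mpoly set"
  let ?Mon = "mons {..n} d"
  assume "thin ?Mon (lkp ` ?W)"
  then obtain P z where P: "P \<in> polyfun ?Mon" "P z \<noteq> 0" "\<forall>f\<in>?W. P (lkp f) = 0" unfolding thin_def by blast
  define Y where "Y = {r..n}"
  have Y: "finite Y" "card Y = c" "Y \<subseteq> {..n}" using n by (auto simp: Y_def)
  let ?M = "mons Y d" and ?N = "mons Y (d - 1)"
  have fin: "finite ?M" "finite ?N" using Y finite_mons by blast+
  have "thin ({..<r} \<times> ?N) (not_spanning r Y d :: (_ \<Rightarrow> 'a) set)"
    by (rule thin_not_spanning) (use Y d rank_ineq[OF d _ _ c(2) rc] in auto)
  then obtain F :: "nat \<times> (nat \<Rightarrow>\<^sub>0 nat) \<Rightarrow> 'a" where F: "F \<notin> not_spanning r Y d"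
    unfolding thin_def by blast
  define G where "G i = of_coords ?N (\<lambda>\<mu>. F (i, \<mu>))" for i
  have Gk: "supp (G i) \<subseteq> ?N" for i unfolding G_def by (rule keys_of_coords[OF fin(2)])
  have G: "G i \<in> forms n (d - 1)" for i
    using Gk[of i] mons_mono[of "{..n}" Y "d - 1"] Y(3) by (auto simp: forms_iff)
  have Gl: "lkp (G i) \<mu> = F (i, \<mu>)" if "\<mu> \<in> ?N" for i \<mu> using that fin by (simp add: G_def lookup_of_coords)
  have shift: "\<mu> + x1 y \<in> ?M" if "\<mu> \<in> ?N" "y \<in> Y" for \<mu> y
    using mons_add[OF that(1) x1_mons[OF Y(1) that(2)]] d by simp
  have vG: "supp (var y * G i) \<subseteq> ?M" if "y \<in> Y" for y i
    using keys_mult[of "var y :: 'a mpoly" "G i"] Gk[of i] shift[OF _ that]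
    by (fastforce simp: var_def add.commute)
  have spanning: "\<exists>c. \<forall>m\<in>?M. v m = (\<Sum>k\<in>{..<r} \<times> Y. c k * lkp (var (snd k) * G (fst k)) m)" for v :: "_ \<Rightarrow> 'a"
  proof (rule no_annihilator_imp_spanning)
    fix \<phi> :: "_ \<Rightarrow> 'a"
    assume 0: "\<And>k. k \<in> {..<r} \<times> Y \<Longrightarrow> (\<Sum>m\<in>?M. \<phi> m * lkp (var (snd k) * G (fst k)) m) = 0"
    have "(\<Sum>\<mu>\<in>?N. \<phi> (\<mu> + x1 y) * F (i, \<mu>)) = 0" if iy: "i < r" "y \<in> Y" for i y
    proof -
      have "0 = (\<Sum>m\<in>?M. \<phi> m * lkp (var y * G i) m)" using 0[of "(i, y)"] iy by simp
      also have "\<dots> = (\<Sum>m\<in>?M. \<Sum>\<mu>\<in>?N. if \<mu> + x1 y = m then \<phi> m * F (i, \<mu>) else 0)"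
        unfolding lookup_var_mult[OF fin(2) Gk] sum_distrib_left
        by (intro sum.cong refl) (auto simp: Gl)
      also have "\<dots> = (\<Sum>\<mu>\<in>?N. \<Sum>m\<in>?M. if \<mu> + x1 y = m then \<phi> m * F (i, \<mu>) else 0)" by (rule sum.swap)
      also have "\<dots> = (\<Sum>\<mu>\<in>?N. \<phi> (\<mu> + x1 y) * F (i, \<mu>))"
        using shift[OF _ iy(2)] fin by (intro sum.cong refl) (simp add: sum.delta')
      finally show ?thesis by simp
    qed
    thus "\<forall>m\<in>?M. \<phi> m = 0" using F unfolding not_spanning_def by blast
  qed (use Y fin in auto)
  define f0 where "f0 = (\<Sum>i<r. var i * G i)"
  have "\<exists>v. \<forall>w. \<exists>\<epsilon>. P (\<lambda>m. lkp f0 m + \<epsilon> * v m + \<epsilon> * \<epsilon> * w m) \<noteq> 0"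
    by (rule second_order_variation[OF P(1), of z]) (rule P(2))
  then obtain v where v: "\<forall>w. \<exists>\<epsilon>. P (\<lambda>m. lkp f0 m + \<epsilon> * v m + \<epsilon> * \<epsilon> * w m) \<noteq> 0" ..
  define vf where "vf = of_coords ?Mon v"
  have vf: "vf \<in> forms n d" unfolding vf_def by (rule of_coords_forms)
  have vfl: "lkp vf m = v m" if "m \<in> ?Mon" for m using that by (simp add: vf_def lookup_of_coords finite_mons)
  from spanning[of "lkp vf"] obtain co where
    co: "\<forall>m\<in>?M. lkp vf m = (\<Sum>k\<in>{..<r} \<times> Y. co k * lkp (var (snd k) * G (fst k)) m)" ..
  define l where "l i = (\<Sum>y\<in>Y. cst (co (i, y)) * var y)" for i
  have l: "l i \<in> forms n 1" for i unfolding l_def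
    using Y(3) by (intro forms_sum cst_mult_form var_form) auto
  define g where "g = (\<Sum>i<r. l i * G i)"
  have "l i * G i \<in> forms n d" for i using forms_mult[OF l[of i] G[of i]] d by simp
  hence g: "g \<in> forms n d" unfolding g_def by (intro forms_sum)
  have gl: "lkp g m = (\<Sum>k\<in>{..<r} \<times> Y. co k * lkp (var (snd k) * G (fst k)) m)" for m
    unfolding g_def l_def
    by (simp add: lookup_sum sum_distrib_right mult.assoc sum.cartesian_product case_prod_unfold)
  have "\<exists>h. (\<forall>i. h i \<in> forms n (d - 1)) \<and> vf - g = (\<Sum>i<r. var i * h i)"
  proof (rule sliced_by_variables)
    show "r \<le> Suc n" using n by simp
    show "vf - g \<in> forms n d" by (rule forms_diff[OF vf g])
    fix m assume m: "m \<in> supp (vf - g)"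
    show "\<exists>i<r. i \<in> supp m"
    proof (rule ccontr)
      assume "\<not> ?thesis"
      moreover have mM: "m \<in> ?Mon" using m forms_diff[OF vf g] by (auto simp: forms_iff)
      ultimately have k: "supp m \<subseteq> Y" by (auto simp: mons_def Y_def not_less dest!: subsetD)
      have "(\<Sum>i\<le>n. lkp m i) = (\<Sum>i\<in>Y. lkp m i)"
        by (rule sum.mono_neutral_right) (use Y k in \<open>auto simp: in_keys_iff\<close>)
      hence "m \<in> ?M" using mM k by (simp add: mons_def)
      hence "lkp (vf - g) m = 0" using co gl by (simp add: lookup_minus)
      thus False using m by (simp add: in_keys_iff)
    qed
  qed
  then obtain h where h: "\<forall>i. h i \<in> forms n (d - 1)" "vf - g = (\<Sum>i<r. var i * h i)" by blast
  define w where "w = (\<Sum>i<r. l i * h i)"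
  have "P (\<lambda>m. lkp f0 m + \<epsilon> * v m + \<epsilon> * \<epsilon> * lkp w m) = 0" for \<epsilon>
  proof -
    define f where "f = (\<Sum>i<r. (var i + cst \<epsilon> * l i) * (G i + cst \<epsilon> * h i))"
    have "f \<in> ?W"
    proof (rule sums_of_productsI[OF f_def])
      fix i assume "i < r"
      hence "var i \<in> (forms n 1 :: 'a mpoly set)" using n by (intro var_form) simp
      thus "var i + cst \<epsilon> * l i \<in> forms n 1" by (intro forms_add cst_mult_form l)
      show "G i + cst \<epsilon> * h i \<in> forms n (d - 1)" using h(1) by (intro forms_add cst_mult_form G) blast
    qed
    hence Pf: "P (lkp f) = 0" using P(3) by blast
    have "f = f0 + cst \<epsilon> * ((\<Sum>i<r. var i * h i) + g) + cst \<epsilon> * (cst \<epsilon> * w)"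
      unfolding f_def f0_def g_def w_def
      by (simp add: distrib_left distrib_right sum.distrib sum_distrib_left mult_ac)
    also have "(\<Sum>i<r. var i * h i) + g = vf" using h(2) by (metis diff_add_cancel)
    finally have "lkp f m = lkp f0 m + \<epsilon> * lkp vf m + \<epsilon> * \<epsilon> * lkp w m" for m
      by (simp add: lookup_add)
    hence "P (\<lambda>m. lkp f0 m + \<epsilon> * v m + \<epsilon> * \<epsilon> * lkp w m) = P (lkp f)"
      by (intro polyfun_cong[OF P(1)]) (simp add: vfl)
    thus ?thesis using Pf by simp
  qed
  thus False using v by blast
qed

text \<open>This is what turns \<open>C(c + d - 1, d) \<le> r c\<close> into \<open>c \<le>
r\<close>.\<close>

lemma square_le_binomial:
  assumes "1 \<le> c" "4 \<le> d" shows "c * c \<le> (c + d - 1) choose d"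
proof -
  obtain k where c: "c = Suc k" using assms(1) by (metis Suc_le_D One_nat_def)
  have "(k + 1) * (k + 1) \<le> (k + 4) choose 4"
  proof (induction k)
    case (Suc k)
    have "2 * k + 3 \<le> (k + 4) choose 3"
    proof (induction k)
      case (Suc k)
      have "2 \<le> (k + 4) choose 2" using binomial_right_mono[of 4 "k + 4" 2] by (simp add: eval_nat_numeral)
      moreover have "(Suc k + 4) choose 3 = ((k + 4) choose 2) + ((k + 4) choose 3)"
        by (simp add: eval_nat_numeral)
      ultimately show ?case using Suc by simp
    qed (simp add: eval_nat_numeral)
    moreover have "(Suc k + 4) choose 4 = ((k + 4) choose 3) + ((k + 4) choose 4)"
      by (simp add: eval_nat_numeral)
    ultimately show ?case using Suc by simp
  qed simp
  also have "\<dots> = (k + 4) choose k" using binomial_symmetric[of 4 "k + 4"] by simp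
  also have "\<dots> \<le> (k + d) choose k" using assms(2) by (intro binomial_right_mono) simp
  also have "\<dots> = (c + d - 1) choose d" using binomial_symmetric[of k "k + d"] by (simp add: c)
  finally show ?thesis by (simp add: c)
qed

section \<open>Generic generators with prescribed leading powers\<close>

abbreviation smul :: "'a \<Rightarrow> 'a mpoly \<Rightarrow> 'a::field mpoly" where "smul a p \<equiv> cst a * p"

lemma cst_add: "cst (a + b) = cst a + cst b" by (simp add: cst_def single_add)
lemma cst_mult: "cst (a * b) = cst a * cst b" by (simp add: cst_def mult_single)
lemma cst_0: "cst 0 = 0" by (simp add: cst_def)

interpretation mp: vector_space smul
  by unfold_locales (simp_all add: cst_add cst_mult cst_1 algebra_simps)

abbreviation mon :: "(nat \<Rightarrow>\<^sub>0 nat) \<Rightarrow> 'a::field mpoly" where "mon m \<equiv> Poly_Mapping.single m 1"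

lemma span_family:
  assumes "finite I"
  shows "p \<in> mp.span (v ` I) \<longleftrightarrow> (\<exists>c. p = (\<Sum>i\<in>I. smul (c i) (v i)))"
proof
  assume "p \<in> mp.span (v ` I)"
  thus "\<exists>c. p = (\<Sum>i\<in>I. smul (c i) (v i))"
  proof (induction rule: mp.span_induct_alt)
    case base
    show ?case by (rule exI[of _ "\<lambda>_. 0"]) (simp add: cst_0)
  next
    case (step a x y)
    then obtain j c where j: "j \<in> I" "x = v j" and c: "y = (\<Sum>i\<in>I. smul (c i) (v i))" by blast
    have "smul a x + y = (\<Sum>i\<in>I. smul (if i = j then a + c j else c i) (v i))"
      using assms j unfolding c
      by (simp add: sum.remove[of I j] cst_add distrib_right)
    thus ?case by (rule exI[of _ "\<lambda>i. if i = j then a + c j else c i"])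
  qed
next
  assume "\<exists>c. p = (\<Sum>i\<in>I. smul (c i) (v i))"
  then obtain c where "p = (\<Sum>i\<in>I. smul (c i) (v i))" ..
  thus "p \<in> mp.span (v ` I)"
    by (simp only:) (intro mp.span_sum mp.span_scale mp.span_base imageI)
qed

lemma form_in_span: assumes "f \<in> forms n d" shows "f \<in> mp.span (mon ` mons {..n} d)"
proof -
  have "f = of_coords (mons {..n} d) (lkp f)"
    using of_coords_lookup[of "mons {..n} d" f] assms finite_mons by (auto simp: forms_iff)
  also have "\<dots> = (\<Sum>m\<in>mons {..n} d. smul (lkp f m) (mon m))"
    by (simp add: of_coords_def cst_def mult_single)
  finally show ?thesis using span_family[OF finite_mons[of "{..n}" d], of f mon] by auto
qed

lemma mon_form: "m \<in> mons {..n} d \<Longrightarrow> mon m \<in> forms n d"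
  by (simp add: forms_iff)

lemma span_mult_left:
  assumes "p \<in> mp.span A" "\<And>a. a \<in> A \<Longrightarrow> a * q \<in> mp.span B"
  shows "p * q \<in> mp.span B"
  using assms(1)
proof (induction rule: mp.span_induct_alt)
  case base show ?case by (simp add: mp.span_zero)
next
  case (step a x y)
  have "(smul a x + y) * q = smul a (x * q) + y * q" by (simp add: algebra_simps)
  thus ?case using step assms(2) by (auto intro: mp.span_add mp.span_scale)
qed

text \<open>Index pairs for the products \<open>\<mu> g\<^sub>l\<close>, \<open>l < i\<close>, that
span the degree \<open>j\<close> part of the ideal \<open>(g\<^sub>0, \<dots>,
g\<^sub>i\<^sub>-\<^sub>1)\<close>.\<close>

definition ideal_gens :: "nat \<Rightarrow> (nat \<Rightarrow> nat) \<Rightarrow> nat \<Rightarrow> nat \<Rightarrow> (nat \<times> (nat \<Rightarrow>\<^sub>0 nat)) set" where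
  "ideal_gens n e i j = {(l, \<mu>). l < i \<and> e l \<le> j \<and> \<mu> \<in> mons {..n} (j - e l)}"

text \<open>A multiple of \<open>g\<^sub>l\<close> is kept only if \<open>\<mu>\<close> is standard
for the generators before \<open>g\<^sub>l\<close>; the other multiples are redundant, as
\<open>\<mu>\<close> can be reduced modulo the earlier generators.\<close>

definition std_gens :: "nat \<Rightarrow> (nat \<Rightarrow> nat) \<Rightarrow> nat \<Rightarrow> nat \<Rightarrow> (nat \<times> (nat \<Rightarrow>\<^sub>0 nat)) set" where
  "std_gens n e i j = {(l, \<mu>). l < i \<and> e l \<le> j \<and> \<mu> \<in> std_mons n l e (j - e l)}"

abbreviation gen :: "(nat \<Rightarrow> 'a mpoly) \<Rightarrow> nat \<times> (nat \<Rightarrow>\<^sub>0 nat) \<Rightarrow> 'a::field mpoly" where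
  "gen g \<equiv> \<lambda>(l, \<mu>). mon \<mu> * g l"

abbreviation ideal_piece :: "nat \<Rightarrow> (nat \<Rightarrow> nat) \<Rightarrow> (nat \<Rightarrow> 'a mpoly) \<Rightarrow> nat \<Rightarrow> nat \<Rightarrow> 'a::field mpoly set" where
  "ideal_piece n e g i j \<equiv> mp.span (gen g ` ideal_gens n e i j)"

lemma finite_std_mons: "finite (std_mons n l e j)"
  using finite_mons[of "{..n}" j] by (auto simp: std_mons_def intro: rev_finite_subset)

lemma finite_ideal_gens: "finite (ideal_gens n e i j)"
proof -
  have "ideal_gens n e i j \<subseteq> (SIGMA l:{..<i}. mons {..n} (j - e l))" by (auto simp: ideal_gens_def)
  thus ?thesis by (rule finite_subset) (auto simp: finite_mons)
qed

lemma std_gens_subset: "std_gens n e i j \<subseteq> ideal_gens n e i j"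
  by (auto simp: std_gens_def ideal_gens_def std_mons_def)

lemma finite_std_gens: "finite (std_gens n e i j)"
  using finite_subset[OF std_gens_subset finite_ideal_gens] .

lemma ideal_piece_mult:
  fixes p q :: "'a::field mpoly"
  assumes "p \<in> forms n a" "q \<in> ideal_piece n e g i j"
  shows "p * q \<in> ideal_piece n e g i (a + j)"
proof (rule span_mult_left[OF form_in_span[OF assms(1)]])
  fix x :: "'a mpoly" assume "x \<in> mon ` mons {..n} a"
  then obtain m where m: "m \<in> mons {..n} a" "x = mon m" by blast
  have "q * x \<in> ideal_piece n e g i (a + j)"
  proof (rule span_mult_left[OF assms(2)])
    fix y assume "y \<in> gen g ` ideal_gens n e i j"
    then obtain l \<mu> where y: "y = mon \<mu> * g l" "l < i" "e l \<le> j" "\<mu> \<in> mons {..n} (j - e l)"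
      by (auto simp: ideal_gens_def)
    have "y * x = mon (m + \<mu>) * g l" unfolding y m
      by (metis (no_types, lifting) mult.commute mult.left_commute mult_1 mult_single)
    moreover have "m + \<mu> \<in> mons {..n} (a + j - e l)" using mons_add[OF m(1) y(4)] y(3) by simp
    hence "(l, m + \<mu>) \<in> ideal_gens n e i (a + j)" using y by (simp add: ideal_gens_def)
    ultimately show "y * x \<in> ideal_piece n e g i (a + j)"
      by (intro mp.span_base image_eqI[of _ _ "(l, m + \<mu>)"]) auto
  qed
  thus "x * q \<in> ideal_piece n e g i (a + j)" by (simp add: mult.commute)
qed

lemma gen_in_ideal_piece: "l < i \<Longrightarrow> g l \<in> ideal_piece n e g i (e l)"
proof -
  assume l: "l < i"
  have "(0 :: nat \<Rightarrow>\<^sub>0 nat) \<in> mons {..n} 0" by (auto simp: mons_def)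
  hence "(l, 0) \<in> ideal_gens n e i (e l)" using l by (auto simp: ideal_gens_def)
  hence "gen g (l, 0) \<in> ideal_piece n e g i (e l)" by (intro mp.span_base imageI)
  thus ?thesis by simp
qed

lemma ideal_piece_subset:
  assumes "\<And>l. l < i \<Longrightarrow> e l \<le> j \<Longrightarrow> g l \<in> ideal_piece n e g' k (e l)"
  shows "ideal_piece n e g i j \<subseteq> ideal_piece n e g' k j"
proof (rule mp.span_minimal)
  show "gen g ` ideal_gens n e i j \<subseteq> ideal_piece n e g' k j"
  proof clarify
    fix l \<mu> assume "(l, \<mu>) \<in> ideal_gens n e i j"
    hence l: "l < i" "e l \<le> j" "\<mu> \<in> mons {..n} (j - e l)" by (auto simp: ideal_gens_def)
    show "mon \<mu> * g l \<in> ideal_piece n e g' k j"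
      using ideal_piece_mult[OF mon_form[OF l(3)] assms[OF l(1,2)]] l(2) by simp
  qed
qed (rule mp.subspace_span)

abbreviation xe :: "(nat \<Rightarrow> nat) \<Rightarrow> nat \<Rightarrow> nat \<Rightarrow>\<^sub>0 nat" where "xe e l \<equiv> Poly_Mapping.single l (e l)"

text \<open>Standard monomials and kept multiples together: for general generators this is a basis
of all forms of degree \<open>j\<close>.\<close>

definition rows :: "nat \<Rightarrow> (nat \<Rightarrow> nat) \<Rightarrow> nat \<Rightarrow> nat \<Rightarrow> ((nat \<Rightarrow>\<^sub>0 nat) + nat \<times> (nat \<Rightarrow>\<^sub>0 nat)) set" where
  "rows n e i j = Inl ` std_mons n i e j \<union> Inr ` std_gens n e i j"

text \<open>The monomial that a row becomes when each \<open>g\<^sub>l\<close> is replaced by the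
power \<open>x\<^sub>l^e\<^sub>l\<close>.\<close>

definition lead :: "(nat \<Rightarrow> nat) \<Rightarrow> (nat \<Rightarrow>\<^sub>0 nat) + nat \<times> (nat \<Rightarrow>\<^sub>0 nat) \<Rightarrow> nat \<Rightarrow>\<^sub>0 nat" where
  "lead e = case_sum (\<lambda>b. b) (\<lambda>(l, b). b + xe e l)"

lemma finite_rows: "finite (rows n e i j)"
  by (simp add: rows_def finite_std_mons finite_std_gens)

text \<open>A monomial that is not standard is divisible by \<open>x\<^sub>l^e\<^sub>l\<close> for a
first \<open>l\<close>, and its cofactor is then standard for the generators before
\<open>l\<close>.\<close>

lemma lead_bij: assumes "i \<le> Suc n" shows "bij_betw (lead e) (rows n e i j) (mons {..n} j)"
  unfolding bij_betw_def
proof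
  have std: "lkp b k < e k" if "b \<in> std_mons n i e j" "k < i" for b k i j using that by (auto simp: std_mons_def)
  have xe: "lkp (b + xe e l) k = lkp b k + (if k = l then e l else 0)" for b l k
    by (auto simp: lookup_add lookup_single when_def)
  show "inj_on (lead e) (rows n e i j)"
  proof (rule inj_onI)
    fix s t assume s: "s \<in> rows n e i j" and t: "t \<in> rows n e i j" and eq: "lead e s = lead e t"
    have cl: "l = l' \<and> b = b'" if "(l, b) \<in> std_gens n e i j" "(l', b') \<in> std_gens n e i j" "b + xe e l = b' + xe e l'" for l b l' b'
    proof -
      have h: "b \<in> std_mons n l e (j - e l)" "b' \<in> std_mons n l' e (j - e l')" using that by (auto simp: std_gens_def)
      have "\<not> l < l'"
      proof
        assume "l < l'"
        hence "lkp (b' + xe e l') l < e l" using std[OF h(2), of l] xe by simp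
        thus False using that(3) xe[of b l l] by simp
      qed
      moreover have "\<not> l' < l"
      proof
        assume "l' < l"
        hence "lkp (b + xe e l) l' < e l'" using std[OF h(1), of l'] xe by simp
        thus False using that(3) xe[of b' l' l'] by simp
      qed
      ultimately show ?thesis using that(3) by simp
    qed
    have mix: False if "b \<in> std_mons n i e j" "(l, b') \<in> std_gens n e i j" "b = b' + xe e l" for b l b'
    proof -
      have "l < i" using that by (auto simp: std_gens_def)
      thus False using std[OF that(1), of l] xe[of b' l l] that(3) by simp
    qed
    show "s = t" using s t eq cl mix[OF _ _ refl] mix[OF _ _ sym] by (auto simp: rows_def lead_def)
  qed
  show "lead e ` rows n e i j = mons {..n} j"
  proof (intro equalityI subsetI)
    fix m assume "m \<in> lead e ` rows n e i j"
    then consider b where "b \<in> std_mons n i e j" "m = b" | l b where "(l, b) \<in> std_gens n e i j" "m = b + xe e l"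
      by (auto simp: rows_def lead_def)
    thus "m \<in> mons {..n} j"
    proof cases
      case 1 thus ?thesis by (simp add: std_mons_def)
    next
      case 2
      hence l: "l < i" "e l \<le> j" "b \<in> mons {..n} (j - e l)" by (auto simp: std_gens_def std_mons_def)
      have "xe e l \<in> mons {..n} (e l)" using l(1) assms
        by (auto simp: mons_def lookup_single when_def sum.delta')
      thus ?thesis using mons_add[OF l(3)] l(2) 2 by fastforce
    qed
  next
    fix m assume m: "m \<in> mons {..n} j"
    show "m \<in> lead e ` rows n e i j"
    proof (cases "\<exists>l<i. e l \<le> lkp m l")
      case False
      hence "m \<in> std_mons n i e j" using m by (auto simp: std_mons_def not_le)
      thus ?thesis by (intro image_eqI[of _ _ "Inl m"]) (auto simp: rows_def lead_def)
    next
      case True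
      define l where "l = (LEAST l. l < i \<and> e l \<le> lkp m l)"
      have l: "l < i \<and> e l \<le> lkp m l" unfolding l_def using True by (rule LeastI_ex)
      have low: "lkp m k < e k" if "k < l" for k
        using not_less_Least[of k "\<lambda>l. l < i \<and> e l \<le> lkp m l"] that l unfolding l_def by auto
      define b where "b = m - xe e l"
      have mb: "m = b + xe e l"
        by (rule poly_mapping_eqI) (use l in \<open>auto simp: b_def lookup_add lookup_minus lookup_single when_def\<close>)
      have "l \<le> n" using l assms by simp
      hence "(\<Sum>k\<le>n. lkp m k) = (\<Sum>k\<le>n. lkp b k) + e l"
        by (subst mb) (simp add: lookup_add sum.distrib lookup_single when_def sum.delta')
      moreover have "supp b \<subseteq> supp m" by (auto simp: b_def in_keys_iff lookup_minus)
      ultimately have "b \<in> mons {..n} (j - e l)" "e l \<le> j" using m by (auto simp: mons_def)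
      moreover have "lkp b k < e k" if "k < l" for k using low[OF that] that by (simp add: b_def lookup_minus lookup_single)
      ultimately have "(l, b) \<in> std_gens n e i j" using l by (auto simp: std_gens_def std_mons_def)
      thus ?thesis using mb by (intro image_eqI[of _ _ "Inr (l, b)"]) (auto simp: rows_def lead_def)
    qed
  qed
qed

lemma card_std_split:
  assumes "i \<le> Suc n"
  shows "card (std_mons n i e j) + card (std_gens n e i j) = card (mons {..n} j)"
proof -
  have "card (rows n e i j) = card (std_mons n i e j) + card (std_gens n e i j)"
    unfolding rows_def by (subst card_Un_disjoint) (auto simp: finite_std_mons finite_std_gens card_image)
  thus ?thesis using bij_betw_same_card[OF lead_bij[OF assms]] by simp
qed

definition row_form :: "(nat \<Rightarrow> 'a mpoly) \<Rightarrow> (nat \<Rightarrow>\<^sub>0 nat) + nat \<times> (nat \<Rightarrow>\<^sub>0 nat) \<Rightarrow> 'a::field mpoly" where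
  "row_form g = case_sum mon (gen g)"

text \<open>The rows have no common annihilator, in all degrees up to \<open>d\<close> and for all
initial segments of the generators. As there are as many rows as monomials, they form a basis.
Stated by functionals, the condition needs no determinant.\<close>

definition good_gens :: "nat \<Rightarrow> (nat \<Rightarrow> nat) \<Rightarrow> nat \<Rightarrow> nat \<Rightarrow> (nat \<Rightarrow> 'a::field mpoly) \<Rightarrow> bool" where
  "good_gens n e r d g \<longleftrightarrow> (\<forall>i\<le>r. \<forall>j\<le>d. \<forall>\<phi>.
     (\<forall>s\<in>rows n e i j. (\<Sum>m\<in>mons {..n} j. \<phi> m * lkp (row_form g s) m) = 0) \<longrightarrow> (\<forall>m\<in>mons {..n} j. \<phi> m = 0))"

text \<open>At \<open>t = 1\<close> the rows are the monomials themselves, so the matrix of the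
system is nonsingular there. The denominator of the elimination is a polynomial in \<open>t\<close>
that does not vanish at 1, and the system is nonsingular wherever it does not vanish.\<close>

lemma generic_gens_good:
  fixes g :: "nat \<Rightarrow> 'a::alg_closed_field mpoly"
  assumes r: "r \<le> Suc n"
  shows "\<exists>S. finite S \<and> (\<forall>t. t \<notin> S \<longrightarrow> good_gens n e r d (\<lambda>l. smul (1 - t) (g l) + smul t (mon (xe e l))))"
proof -
  let ?g = "\<lambda>t l. smul (1 - t) (g l) + smul t (mon (xe e l))"
  let ?R = "range (poly :: 'a poly \<Rightarrow> _)"
  have "\<exists>S. finite S \<and> (\<forall>t. t \<notin> S \<longrightarrow> (\<forall>\<phi>. (\<forall>s\<in>rows n e i j. (\<Sum>m\<in>mons {..n} j. \<phi> m * lkp (row_form (?g t) s) m) = 0) \<longrightarrow>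
     (\<forall>m\<in>mons {..n} j. \<phi> m = 0)))" if i: "i \<le> r" for i j
  proof -
    let ?M = "mons {..n} j" and ?I = "rows n e i j"
    have i': "i \<le> Suc n" using i r by simp
    define a where "a s m t = lkp (row_form (?g t) s) m" for s m t
    have gen: "lkp (mon \<mu> * ?g t l) m = (1 - t) * lkp (mon \<mu> * g l) m + t * lkp (mon (\<mu> + xe e l)) m" for \<mu> t l m
    proof -
      have "mon \<mu> * ?g t l = smul (1 - t) (mon \<mu> * g l) + smul t (mon \<mu> * mon (xe e l))"
        by (simp add: distrib_left mult_ac)
      thus ?thesis by (simp add: lookup_add mult_single)
    qed
    have aR: "a s m \<in> ?R" for s m
    proof (cases s)
      case (Inl b)
      thus ?thesis using fun_alg_const[OF fun_alg_poly] by (simp add: a_def[abs_def] row_form_def)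
    next
      case (Inr lb)
      obtain l b where lb: "lb = (l, b)" by (cases lb)
      have "a s m = (\<lambda>t. lkp (mon b * g l) m + t * (lkp (mon (b + xe e l)) m - lkp (mon b * g l) m))"
        unfolding a_def Inr lb row_form_def by (rule ext) (simp only: sum.case prod.case gen, simp add: left_diff_distrib right_diff_distrib)
      thus ?thesis using poly_line by simp
    qed
    obtain C where C: "finite C" "\<forall>(P, p, q)\<in>C. eliminates ?R ?I ?M a P p q"
      "\<forall>t. rows_independent ?I ?M (\<lambda>s m. a s m t) \<longrightarrow> (\<exists>(P, p, q)\<in>C. p t \<noteq> 0)"
      using elimination[OF fun_alg_poly finite_rows finite_mons[OF finite_atMost] aR, of n e i j n j "\<lambda>s m. s" "\<lambda>s m. m"] by auto
    have bij: "bij_betw (lead e) ?I ?M" by (rule lead_bij[OF i'])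
    have a1: "a s m 1 = (if m = lead e s then 1 else 0)" if "s \<in> ?I" for s m
      by (cases s) (auto simp: a_def row_form_def lead_def gen lookup_single when_def mult_single)
    \<comment> \<open>at \<open>t = 1\<close> the matrix is a permutation matrix\<close>
    have "rows_independent ?I ?M (\<lambda>s m. a s m 1)" unfolding rows_independent_def
    proof (intro allI impI ballI)
      fix c s assume c: "\<forall>m\<in>?M. (\<Sum>s\<in>?I. c s * a s m 1) = 0" and s: "s \<in> ?I"
      have "lead e s \<in> ?M" using bij s by (auto simp: bij_betw_def)
      hence "0 = (\<Sum>s'\<in>?I. c s' * a s' (lead e s) 1)" using c by simp
      also have "\<dots> = (\<Sum>s'\<in>?I. if s' = s then c s else 0)"
      proof (intro sum.cong refl)
        fix s' assume s': "s' \<in> ?I"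
        have "lead e s = lead e s' \<longleftrightarrow> s' = s" using bij s s' by (auto simp: bij_betw_def inj_on_def)
        thus "c s' * a s' (lead e s) 1 = (if s' = s then c s else 0)" using a1[OF s'] by auto
      qed
      also have "\<dots> = c s" using s finite_rows by simp
      finally show "c s = 0" by simp
    qed
    then obtain P p q where pq: "(P, p, q) \<in> C" "p 1 \<noteq> 0" using C(3) by fastforce
    have el: "eliminates ?R ?I ?M a P p q" using C(2) pq(1) by fastforce
    hence P: "P \<subseteq> ?M" "card P = card ?I" "p \<in> ?R" unfolding eliminates_def by auto
    have "P = ?M" using P bij_betw_same_card[OF bij] finite_mons[of "{..n}" j] by (intro card_subset_eq) auto
    from P(3) obtain pp where pp: "p = poly pp" by blast
    show ?thesis
    proof (intro exI[of _ "{t. poly pp t = 0}"] conjI allI impI ballI)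
      show "finite {t. poly pp t = 0}" using pq(2) pp by (intro poly_roots_finite) auto
      fix t \<phi> m assume t: "t \<notin> {t. poly pp t = 0}" and m: "m \<in> ?M"
        and z: "\<forall>s\<in>?I. (\<Sum>m\<in>?M. \<phi> m * lkp (row_form (?g t) s) m) = 0"
      have "\<forall>s\<in>?I. (\<Sum>m\<in>?M. a s m t * \<phi> m) = 0" using z by (simp add: a_def mult.commute)
      hence "p t * \<phi> m = (\<Sum>\<nu>\<in>?M - P. q m \<nu> t * \<phi> \<nu>)"
        using el m \<open>P = ?M\<close> unfolding eliminates_def by blast
      hence "p t * \<phi> m = 0" using \<open>P = ?M\<close> by simp
      thus "\<phi> m = 0" using t pp by simp
    qed
  qed
  hence "\<forall>k\<in>{..r} \<times> {..d}. \<exists>S. finite S \<and> (\<forall>t. t \<notin> S \<longrightarrow> (\<forall>\<phi>. (\<forall>s\<in>rows n e (fst k) (snd k).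
     (\<Sum>m\<in>mons {..n} (snd k). \<phi> m * lkp (row_form (?g t) s) m) = 0) \<longrightarrow> (\<forall>m\<in>mons {..n} (snd k). \<phi> m = 0)))"
    by auto
  from bchoice[OF this] obtain S where S: "\<forall>k\<in>{..r} \<times> {..d}. finite (S k) \<and> (\<forall>t. t \<notin> S k \<longrightarrow> (\<forall>\<phi>. (\<forall>s\<in>rows n e (fst k) (snd k).
     (\<Sum>m\<in>mons {..n} (snd k). \<phi> m * lkp (row_form (?g t) s) m) = 0) \<longrightarrow> (\<forall>m\<in>mons {..n} (snd k). \<phi> m = 0)))" by (elim exE)
  show ?thesis
  proof (intro exI[of _ "\<Union>k\<in>{..r} \<times> {..d}. S k"] conjI allI impI)
    show "finite (\<Union>k\<in>{..r} \<times> {..d}. S k)" using S by auto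
    fix t assume t: "t \<notin> (\<Union>k\<in>{..r} \<times> {..d}. S k)"
    show "good_gens n e r d (?g t)" unfolding good_gens_def
    proof (intro allI impI)
      fix i j \<phi> assume ij: "i \<le> r" "j \<le> d" and z: "\<forall>s\<in>rows n e i j. (\<Sum>m\<in>mons {..n} j. \<phi> m * lkp (row_form (?g t) s) m) = 0"
      have "(i, j) \<in> {..r} \<times> {..d}" using ij by simp
      thus "\<forall>m\<in>mons {..n} j. \<phi> m = 0" using S t z by fastforce
    qed
  qed
qed

section \<open>Normal forms of generators and the parameter count\<close>

context
  fixes n r d :: nat and e :: "nat \<Rightarrow> nat" and g :: "nat \<Rightarrow> 'a::field mpoly"
  assumes r: "r \<le> Suc n" and good: "good_gens n e r d g"
    and g: "\<And>l. l < r \<Longrightarrow> g l \<in> forms n (e l)"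
    and e: "\<And>l. l < r \<Longrightarrow> 1 \<le> e l \<and> e l \<le> d" and sorted: "\<And>k l. k \<le> l \<Longrightarrow> l < r \<Longrightarrow> e k \<le> e l"
begin

lemma row_form_forms:
  assumes "i \<le> r" "s \<in> rows n e i j" shows "row_form g s \<in> forms n j"
proof (cases s)
  case (Inl b)
  thus ?thesis using assms by (auto simp: rows_def row_form_def std_mons_def mon_form)
next
  case (Inr lb)
  obtain l b where lb: "lb = (l, b)" by (cases lb)
  hence l: "l < i" "e l \<le> j" "b \<in> mons {..n} (j - e l)" using assms(2) Inr by (auto simp: rows_def std_gens_def std_mons_def)
  have "mon b * g l \<in> forms n (j - e l + e l)" using assms(1) l by (intro forms_mult mon_form g) auto
  thus ?thesis using l Inr lb by (simp add: row_form_def)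
qed

lemma forms_in_row_span:
  assumes "i \<le> r" "j \<le> d" "f \<in> forms n j"
  shows "f \<in> mp.span (row_form g ` rows n e i j)"
proof -
  have "\<exists>c. \<forall>m\<in>mons {..n} j. lkp f m = (\<Sum>s\<in>rows n e i j. c s * lkp (row_form g s) m)"
    by (rule no_annihilator_imp_spanning[OF finite_rows finite_mons])
      (use good assms in \<open>auto simp: good_gens_def\<close>)
  then obtain c where c: "\<forall>m\<in>mons {..n} j. lkp f m = (\<Sum>s\<in>rows n e i j. c s * lkp (row_form g s) m)" ..
  have "f = (\<Sum>s\<in>rows n e i j. smul (c s) (row_form g s))"
  proof (rule poly_mapping_eqI)
    fix m
    show "lkp f m = lkp (\<Sum>s\<in>rows n e i j. smul (c s) (row_form g s)) m"
    proof (cases "m \<in> mons {..n} j")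
      case True thus ?thesis using c by (simp add: lookup_sum)
    next
      case False
      have "lkp q m = 0" if "q \<in> forms n j" for q :: "'a mpoly" using that False by (auto simp: forms_iff in_keys_iff)
      thus ?thesis using assms row_form_forms by (simp add: lookup_sum)
    qed
  qed
  thus ?thesis using span_family[OF finite_rows] by blast
qed

lemma rows_unique:
  assumes "i \<le> r" "j \<le> d" "(\<Sum>s\<in>rows n e i j. smul (c s) (row_form g s)) = 0" "s \<in> rows n e i j"
  shows "c s = 0"
proof -
  have "rows_independent (rows n e i j) (mons {..n} j) (\<lambda>s m. lkp (row_form g s) m)"
  proof (rule no_annihilator_imp_independent[OF finite_rows finite_mons])
    show "card (rows n e i j) \<le> card (mons {..n} j)"
      using bij_betw_same_card[OF lead_bij, of i n e j] assms(1) r by simp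
  qed (use good assms in \<open>auto simp: good_gens_def\<close>)
  moreover have "\<forall>m\<in>mons {..n} j. (\<Sum>s\<in>rows n e i j. c s * lkp (row_form g s) m) = 0"
    using arg_cong[OF assms(3), of lkp] by (auto simp: lookup_sum fun_eq_iff)
  ultimately show ?thesis using assms(4) unfolding rows_independent_def by blast
qed

text \<open>Reduce the cofactor of the last generator: its standard part gives a kept multiple, and
its part in the ideal of the earlier generators moves the product into that ideal.\<close>

lemma ideal_piece_std_span:
  assumes "i \<le> r" "j \<le> d"
  shows "ideal_piece n e g i j \<subseteq> mp.span (gen g ` std_gens n e i j)"
  using assms(1)
proof (induction i)
  case 0
  have "ideal_gens n e 0 j = {}" by (auto simp: ideal_gens_def)
  thus ?case by (simp add: mp.span_zero)
next
  case (Suc i)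
  hence IH: "ideal_piece n e g i j \<subseteq> mp.span (gen g ` std_gens n e i j)" by simp
  have up: "mp.span (gen g ` std_gens n e i j) \<subseteq> mp.span (gen g ` std_gens n e (Suc i) j)"
    by (rule mp.span_mono) (auto simp: std_gens_def)
  show ?case
  proof (rule mp.span_minimal)
    show "gen g ` ideal_gens n e (Suc i) j \<subseteq> mp.span (gen g ` std_gens n e (Suc i) j)"
    proof clarify
      fix l \<mu> assume "(l, \<mu>) \<in> ideal_gens n e (Suc i) j"
      hence l: "l < Suc i" "e l \<le> j" "\<mu> \<in> mons {..n} (j - e l)" by (auto simp: ideal_gens_def)
      show "mon \<mu> * g l \<in> mp.span (gen g ` std_gens n e (Suc i) j)"
      proof (cases "l = i")
        case False
        hence "(l, \<mu>) \<in> ideal_gens n e i j" using l by (auto simp: ideal_gens_def)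
        hence "gen g (l, \<mu>) \<in> ideal_piece n e g i j" by (intro mp.span_base imageI)
        thus ?thesis using IH up by auto
      next
        case True
        have "mon \<mu> \<in> mp.span (row_form g ` rows n e i (j - e i))"
          using Suc.prems assms(2) l True by (intro forms_in_row_span mon_form) auto
        thus ?thesis
        proof (rule span_mult_left)
          fix a assume "a \<in> row_form g ` rows n e i (j - e i)"
          then consider b where "b \<in> std_mons n i e (j - e i)" "a = mon b"
            | k where "k \<in> std_gens n e i (j - e i)" "a = gen g k" by (auto simp: rows_def row_form_def)
          thus "a * g l \<in> mp.span (gen g ` std_gens n e (Suc i) j)"
          proof cases
            case 1
            hence "(i, b) \<in> std_gens n e (Suc i) j" using l True by (auto simp: std_gens_def)
            hence "gen g (i, b) \<in> mp.span (gen g ` std_gens n e (Suc i) j)" by (intro mp.span_base imageI)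
            thus ?thesis using 1 True by simp
          next
            case 2
            have "a \<in> ideal_piece n e g i (j - e i)"
            proof -
              have "k \<in> ideal_gens n e i (j - e i)" using 2(1) std_gens_subset[of n e i "j - e i"] by blast
              thus ?thesis unfolding 2(2) by (intro mp.span_base imageI)
            qed
            hence "g i * a \<in> ideal_piece n e g i (e i + (j - e i))"
              using Suc.prems by (intro ideal_piece_mult g) auto
            hence "a * g l \<in> ideal_piece n e g i j" using l True by (simp add: mult.commute)
            thus ?thesis using IH up by blast
          qed
        qed
      qed
    qed
  qed (rule mp.subspace_span)
qed

text \<open>The remainder of \<open>x\<^sub>l^e\<^sub>l\<close> on division by the ideal.\<close>

lemma reduced_generator:
  assumes "l < r"
  shows "\<exists>c. mon (xe e l) - (\<Sum>b\<in>std_mons n r e (e l). smul (c b) (mon b)) \<in> ideal_piece n e g r (e l)"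
proof -
  have "l \<le> n" using assms r by simp
  hence "xe e l \<in> mons {..n} (e l)" by (auto simp: mons_def lookup_single when_def sum.delta')
  hence "mon (xe e l) \<in> mp.span (row_form g ` rows n e r (e l))"
    using e[OF assms] by (intro forms_in_row_span mon_form) auto
  then obtain c where "mon (xe e l) = (\<Sum>s\<in>rows n e r (e l). smul (c s) (row_form g s))"
    using span_family[OF finite_rows] by blast
  also have "\<dots> = (\<Sum>b\<in>std_mons n r e (e l). smul (c (Inl b)) (mon b)) + (\<Sum>k\<in>std_gens n e r (e l). smul (c (Inr k)) (gen g k))"
    unfolding rows_def by (subst sum.union_disjoint) (auto simp: finite_std_mons finite_std_gens sum.reindex row_form_def)
  finally have eq: "mon (xe e l) - (\<Sum>b\<in>std_mons n r e (e l). smul (c (Inl b)) (mon b)) =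
    (\<Sum>k\<in>std_gens n e r (e l). smul (c (Inr k)) (gen g k))" by simp
  have "(\<Sum>k\<in>std_gens n e r (e l). smul (c (Inr k)) (gen g k)) \<in> ideal_piece n e g r (e l)"
    using std_gens_subset by (intro mp.span_sum mp.span_scale mp.span_base) blast
  thus ?thesis unfolding eq[symmetric] by (rule exI[of _ "\<lambda>b. c (Inl b)"])
qed

context
  fixes c :: "nat \<Rightarrow> (nat \<Rightarrow>\<^sub>0 nat) \<Rightarrow> 'a" and g' :: "nat \<Rightarrow> 'a mpoly"
  assumes g'_def: "\<And>l. g' l = mon (xe e l) - (\<Sum>b\<in>std_mons n r e (e l). smul (c l b) (mon b))"
    and g': "\<And>l. l < r \<Longrightarrow> g' l \<in> ideal_piece n e g r (e l)"
begin

lemma xe_inj: "k < r \<Longrightarrow> l < r \<Longrightarrow> xe e k = xe e l \<Longrightarrow> k = l"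
proof (rule ccontr)
  assume "k < r" "l < r" "xe e k = xe e l" "k \<noteq> l"
  hence "lkp (xe e k) k = 0" by (simp add: lookup_single)
  thus False using e[OF \<open>k < r\<close>] by simp
qed

lemma xe_not_std: "l < r \<Longrightarrow> xe e l \<notin> std_mons n r e j"
  by (auto simp: std_mons_def)

text \<open>The generators of degree \<open>E\<close> form a block that starts at \<open>i0\<close>.
The new generators of the block are combinations of monomials that are standard for the earlier
generators, and each contains its own power \<open>x\<^sub>l^e\<^sub>l\<close>, which occurs in no
other; so independence is inherited from the rows for \<open>i0\<close>.\<close>

lemma block_independent:
  assumes i0: "i0 \<le> r" and E: "E \<le> d" and L: "L \<subseteq> {i0..<r}" "\<And>l. l \<in> L \<Longrightarrow> e l = E"
    and rel: "(\<Sum>k\<in>std_gens n e i0 E. smul (a k) (gen g k)) + (\<Sum>l\<in>L. smul (b l) (g' l)) = 0"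
  shows "\<forall>k\<in>std_gens n e i0 E. a k = 0" "\<forall>l\<in>L. b l = 0"
proof -
  let ?S = "std_mons n i0 e E"
  have finL: "finite L" using L(1) finite_subset by blast
  have sub: "std_mons n r e E \<subseteq> ?S" using i0 by (auto simp: std_mons_def)
  have xS: "xe e l \<in> ?S" if "l \<in> L" for l
  proof -
    have l: "i0 \<le> l" "l < r" "e l = E" using L that by auto
    hence "xe e l \<in> mons {..n} E" using r by (auto simp: mons_def lookup_single when_def sum.delta')
    moreover have "lkp (xe e l) k < e k" if "k < i0" for k
      using that l e[of k] i0 by (auto simp: lookup_single when_def)
    ultimately show ?thesis by (simp add: std_mons_def)
  qed
  define w where "w l m = (if m = xe e l then 1 else 0) - (if m \<in> std_mons n r e E then c l m else 0)" for l m
  have g'w: "g' l = (\<Sum>m\<in>?S. smul (w l m) (mon m))" if l: "l \<in> L" for l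
  proof -
    have "(\<Sum>m\<in>?S. smul (w l m) (mon m)) = (\<Sum>m\<in>?S. smul (if m = xe e l then 1 else 0) (mon m))
      - (\<Sum>m\<in>?S. smul (if m \<in> std_mons n r e E then c l m else 0) (mon m))"
      unfolding w_def mp.scale_left_diff_distrib by (rule sum_subtractf)
    also have "(\<Sum>m\<in>?S. smul (if m = xe e l then 1 else 0) (mon m)) = (\<Sum>m\<in>?S. if m = xe e l then mon m else 0)"
      by (intro sum.cong) (auto simp: cst_1 cst_0)
    also have "\<dots> = mon (xe e l)" using xS[OF l] by (simp add: finite_std_mons)
    also have "(\<Sum>m\<in>?S. smul (if m \<in> std_mons n r e E then c l m else 0) (mon m)) =
      (\<Sum>m\<in>std_mons n r e E. smul (c l m) (mon m))"
      by (rule sum.mono_neutral_cong_right) (use sub in \<open>auto simp: finite_std_mons cst_0\<close>)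
    finally show ?thesis unfolding g'_def using L(2)[OF l] by simp
  qed
  define C where "C = case_sum (\<lambda>m. \<Sum>l\<in>L. b l * w l m) a"
  have "(\<Sum>l\<in>L. smul (b l) (g' l)) = (\<Sum>l\<in>L. \<Sum>m\<in>?S. smul (b l * w l m) (mon m))"
  proof (intro sum.cong refl)
    fix l assume "l \<in> L"
    show "smul (b l) (g' l) = (\<Sum>m\<in>?S. smul (b l * w l m) (mon m))"
      unfolding g'w[OF \<open>l \<in> L\<close>] by (simp only: mp.scale_sum_right mp.scale_scale)
  qed
  also have "\<dots> = (\<Sum>m\<in>?S. smul (\<Sum>l\<in>L. b l * w l m) (mon m))"
    by (subst sum.swap) (simp only: mp.scale_sum_left)
  finally have bl: "(\<Sum>l\<in>L. smul (b l) (g' l)) = (\<Sum>m\<in>?S. smul (\<Sum>l\<in>L. b l * w l m) (mon m))" .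
  have "(\<Sum>s\<in>rows n e i0 E. smul (C s) (row_form g s)) = 0"
    using rel unfolding bl rows_def
    by (subst sum.union_disjoint) (auto simp: finite_std_mons finite_std_gens sum.reindex row_form_def C_def add.commute)
  hence zero: "C s = 0" if "s \<in> rows n e i0 E" for s
    using rows_unique[OF i0 E, of C s] that by blast
  show "\<forall>k\<in>std_gens n e i0 E. a k = 0"
  proof
    fix k assume "k \<in> std_gens n e i0 E"
    thus "a k = 0" using zero[of "Inr k"] by (simp add: rows_def C_def)
  qed
  show "\<forall>l\<in>L. b l = 0"
  proof
    fix l assume l: "l \<in> L"
    have "0 = (\<Sum>l'\<in>L. b l' * w l' (xe e l))" using zero[of "Inl (xe e l)"] xS[OF l] by (simp add: rows_def C_def)
    also have "\<dots> = (\<Sum>l'\<in>L. if l' = l then b l else 0)"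
    proof (intro sum.cong refl)
      fix l' assume "l' \<in> L"
      have lr: "l < r" "l' < r" using l \<open>l' \<in> L\<close> L(1) by auto
      have "xe e l = xe e l' \<longleftrightarrow> l' = l" using xe_inj[OF lr] by blast
      hence "w l' (xe e l) = (if l' = l then 1 else 0)" unfolding w_def using xe_not_std[OF lr(1), of E] by simp
      thus "b l' * w l' (xe e l) = (if l' = l then b l else 0)" by simp
    qed
    also have "\<dots> = b l" using l finL by simp
    finally show "b l = 0" by simp
  qed
qed

text \<open>Induction on the degree. In degree \<open>E = e k0\<close> the ideal is spanned by the
kept multiples of generators of smaller degree, which belong to the new ideal by induction, and by
the generators of degree \<open>E\<close>. Replacing the latter by their equally many new versions
keeps independence, hence also the span. The order of the degrees enters here: the generators of
degree less than \<open>E\<close> must be an initial segment.\<close>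

lemma generator_recovered:
  assumes "k0 < r" shows "g k0 \<in> ideal_piece n e g' r (e k0)"
  using assms
proof (induction "e k0" arbitrary: k0 rule: less_induct)
  case less
  define E where "E = e k0"
  define i0 where "i0 = (LEAST i. E \<le> e i)"
  have i0: "E \<le> e i0" unfolding i0_def by (rule LeastI[of _ k0]) (simp add: E_def)
  have "i0 \<le> k0" unfolding i0_def by (rule Least_le) (simp add: E_def)
  hence i0r: "i0 \<le> r" using less.prems by simp
  have low: "e l < E" if "l < i0" for l using not_less_Least[of l "\<lambda>i. E \<le> e i"] that unfolding i0_def by simp
  have high: "E \<le> e l" if "i0 \<le> l" "l < r" for l using sorted[OF that] i0 by simp
  have Ed: "E \<le> d" using e[OF less.prems] by (simp add: E_def)
  define L where "L = {l. i0 \<le> l \<and> l < r \<and> e l = E}"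
  have L: "L \<subseteq> {i0..<r}" "finite L" "k0 \<in> L" using \<open>i0 \<le> k0\<close> less.prems by (auto simp: L_def E_def)
  let ?K = "std_gens n e i0 E"
  let ?I = "Inl ` ?K \<union> Inr ` L"
  define va where "va = case_sum (gen g) g"
  have J: "ideal_piece n e g i0 E \<subseteq> ideal_piece n e g' r E"
  proof (rule ideal_piece_subset)
    fix l assume "l < i0"
    thus "g l \<in> ideal_piece n e g' r (e l)" using low i0r by (intro less.hyps) (auto simp: E_def)
  qed
  have IE: "ideal_piece n e g r E \<subseteq> mp.span (va ` ?I)"
  proof (rule mp.span_minimal)
    have K: "mp.span (gen g ` ?K) \<subseteq> mp.span (va ` ?I)"
    proof (rule mp.span_mono)
      have "gen g ` ?K = va ` Inl ` ?K" by (simp add: va_def image_image)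
      thus "gen g ` ?K \<subseteq> va ` ?I" by (simp only:) (intro image_mono Un_upper1)
    qed
    show "gen g ` ideal_gens n e r E \<subseteq> mp.span (va ` ?I)"
    proof clarify
      fix l \<mu> assume "(l, \<mu>) \<in> ideal_gens n e r E"
      hence l: "l < r" "e l \<le> E" "\<mu> \<in> mons {..n} (E - e l)" by (auto simp: ideal_gens_def)
      show "mon \<mu> * g l \<in> mp.span (va ` ?I)"
      proof (cases "l < i0")
        case True
        hence "(l, \<mu>) \<in> ideal_gens n e i0 E" using l by (auto simp: ideal_gens_def)
        hence "gen g (l, \<mu>) \<in> ideal_piece n e g i0 E" by (intro mp.span_base imageI)
        thus ?thesis using ideal_piece_std_span[OF i0r Ed] K by auto
      next
        case False
        hence lL: "l \<in> L" "e l = E" using high[of l] l by (auto simp: L_def)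
        have "lkp \<mu> i = 0" for i using l(3) lL(2) by (cases "i \<le> n") (auto simp: mons_def in_keys_iff)
        hence "\<mu> = 0" by (intro poly_mapping_eqI) simp
        moreover have "g l \<in> va ` ?I" using lL by (intro image_eqI[of _ _ "Inr l"]) (auto simp: va_def)
        ultimately show ?thesis by (simp add: mp.span_base)
      qed
    qed
  qed (rule mp.subspace_span)
  \<comment> \<open>one vector more than the size of the spanning family: \<open>g k0\<close> and the candidate new basis\<close>
  define vb where "vb = (\<lambda>x. case x of None \<Rightarrow> g k0 | Some s \<Rightarrow> case_sum (gen g) g' s)"
  let ?X = "insert None (Some ` ?I)"
  have finI: "finite ?I" using L finite_std_gens by auto
  have "vb x \<in> mp.span (va ` ?I)" if "x \<in> ?X" for x
  proof -
    consider "x = None" | k where "k \<in> ?K" "x = Some (Inl k)" | l where "l \<in> L" "x = Some (Inr l)" using \<open>x \<in> ?X\<close> by auto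
    thus ?thesis
    proof cases
      case 1
      have "va (Inr k0) \<in> mp.span (va ` ?I)" using L by (intro mp.span_base imageI) auto
      thus ?thesis using 1 by (simp add: vb_def va_def)
    next
      case 2
      have "va (Inl k) \<in> mp.span (va ` ?I)" using 2 by (intro mp.span_base imageI) auto
      thus ?thesis using 2 by (simp add: vb_def va_def)
    next
      case 3
      hence "g' l \<in> ideal_piece n e g r E" using g'[of l] by (auto simp: L_def)
      thus ?thesis using 3 IE by (auto simp: vb_def)
    qed
  qed
  hence "\<forall>x\<in>?X. \<exists>f. vb x = (\<Sum>s\<in>?I. smul (f s) (va s))" using span_family[OF finI, of _ va] by blast
  from bchoice[OF this] obtain f where f: "\<forall>x\<in>?X. vb x = (\<Sum>s\<in>?I. smul (f x s) (va s))" by (elim exE)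
  have "card ?I < card ?X" using finI by (simp add: card_image)
  from linear_relation[OF _ finI this, of f] finI obtain q where
    q: "\<exists>x\<in>?X. q x \<noteq> 0" "\<forall>s\<in>?I. (\<Sum>x\<in>?X. q x * f x s) = 0" by auto
  have "(\<Sum>x\<in>?X. smul (q x) (vb x)) = (\<Sum>x\<in>?X. \<Sum>s\<in>?I. smul (q x * f x s) (va s))"
  proof (intro sum.cong refl)
    fix x assume "x \<in> ?X"
    hence "smul (q x) (vb x) = smul (q x) (\<Sum>s\<in>?I. smul (f x s) (va s))" using bspec[OF f] by (simp only:)
    thus "smul (q x) (vb x) = (\<Sum>s\<in>?I. smul (q x * f x s) (va s))"
      by (simp only: mp.scale_sum_right mp.scale_scale)
  qed
  also have "\<dots> = (\<Sum>s\<in>?I. smul (\<Sum>x\<in>?X. q x * f x s) (va s))"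
    by (subst sum.swap) (simp only: mp.scale_sum_left)
  also have "\<dots> = 0" using q(2) by (intro sum.neutral) (auto simp: cst_0)
  finally have rel0: "(\<Sum>x\<in>?X. smul (q x) (vb x)) = 0" .
  have "(\<Sum>x\<in>?X. smul (q x) (vb x)) = smul (q None) (g k0) + (\<Sum>s\<in>?I. smul (q (Some s)) (case_sum (gen g) g' s))"
    using finI by (subst sum.insert) (auto simp: vb_def sum.reindex)
  also have "(\<Sum>s\<in>?I. smul (q (Some s)) (case_sum (gen g) g' s)) =
    (\<Sum>k\<in>?K. smul (q (Some (Inl k))) (gen g k)) + (\<Sum>l\<in>L. smul (q (Some (Inr l))) (g' l))"
    using L finite_std_gens by (subst sum.union_disjoint) (auto simp: sum.reindex)
  finally have rel: "smul (q None) (g k0) + ((\<Sum>k\<in>?K. smul (q (Some (Inl k))) (gen g k)) + (\<Sum>l\<in>L. smul (q (Some (Inr l))) (g' l))) = 0"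
    using rel0 by simp
  have nz: "q None \<noteq> 0"
  proof
    assume z: "q None = 0"
    hence "(\<Sum>k\<in>?K. smul (q (Some (Inl k))) (gen g k)) + (\<Sum>l\<in>L. smul (q (Some (Inr l))) (g' l)) = 0"
      using rel by (simp add: cst_0)
    from block_independent[OF i0r Ed L(1) _ this] have
      "\<forall>k\<in>?K. q (Some (Inl k)) = 0" "\<forall>l\<in>L. q (Some (Inr l)) = 0" by (auto simp: L_def)
    thus False using q(1) z by auto
  qed
  have "(\<Sum>k\<in>?K. smul (q (Some (Inl k))) (gen g k)) + (\<Sum>l\<in>L. smul (q (Some (Inr l))) (g' l)) \<in> ideal_piece n e g' r E"
  proof (intro mp.span_add mp.span_sum mp.span_scale)
    fix k assume "k \<in> ?K"
    hence "gen g k \<in> ideal_piece n e g i0 E" using std_gens_subset by (intro mp.span_base) blast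
    thus "gen g k \<in> ideal_piece n e g' r E" using J by blast
  next
    fix l assume "l \<in> L"
    thus "g' l \<in> ideal_piece n e g' r E" using gen_in_ideal_piece[of l r g' n e] by (auto simp: L_def)
  qed
  hence "- smul (q None) (g k0) \<in> ideal_piece n e g' r E" unfolding minus_unique[OF rel] .
  hence "smul (- inverse (q None)) (- smul (q None) (g k0)) \<in> ideal_piece n e g' r E" by (rule mp.span_scale)
  moreover have "smul (- inverse (q None)) (- smul (q None) (g k0)) = g k0"
  proof -
    have "smul (- inverse (q None)) (- smul (q None) (g k0)) = smul (inverse (q None) * q None) (g k0)"
      by (simp only: mp.scale_minus_left mp.scale_minus_right mp.scale_scale minus_minus mult_minus_left)
    thus ?thesis using nz by (simp add: cst_1)
  qed
  ultimately show ?case unfolding E_def by (simp only:)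
qed

end

text \<open>Both generating sets span the same piece of degree \<open>d\<close>, whose dimension is
at most the number of kept multiples. So that many products of monomials with the reduced generators
already span it; which ones are needed is left open.\<close>

lemma normal_form:
  shows "\<exists>c T. T \<subseteq> ideal_gens n e r d \<and> card T \<le> card (std_gens n e r d) \<and>
    ideal_piece n e g r d \<subseteq>
      mp.span (gen (\<lambda>l. mon (xe e l) - (\<Sum>b\<in>std_mons n r e (e l). smul (c l b) (mon b))) ` T)"
proof -
  have "\<forall>l\<in>{..<r}. \<exists>c. mon (xe e l) - (\<Sum>b\<in>std_mons n r e (e l). smul (c b) (mon b)) \<in> ideal_piece n e g r (e l)"
    using reduced_generator by blast
  from bchoice[OF this] obtain c where
    c: "\<forall>l\<in>{..<r}. mon (xe e l) - (\<Sum>b\<in>std_mons n r e (e l). smul (c l b) (mon b)) \<in> ideal_piece n e g r (e l)" by (elim exE)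
  define g' where "g' l = mon (xe e l) - (\<Sum>b\<in>std_mons n r e (e l). smul (c l b) (mon b))" for l
  have g': "g' l \<in> ideal_piece n e g r (e l)" if "l < r" for l using c that by (simp add: g'_def)
  have sub1: "ideal_piece n e g r d \<subseteq> ideal_piece n e g' r d"
    by (rule ideal_piece_subset) (rule generator_recovered[OF g'_def g'])
  have "ideal_piece n e g' r d \<subseteq> ideal_piece n e g r d" by (rule ideal_piece_subset) (rule g')
  hence sub2: "ideal_piece n e g' r d \<subseteq> mp.span (gen g ` std_gens n e r d)"
    using ideal_piece_std_span[of r d] by simp
  obtain B where B: "B \<subseteq> gen g' ` ideal_gens n e r d" "mp.independent B" "gen g' ` ideal_gens n e r d \<subseteq> mp.span B"
    using mp.maximal_independent_subset[of "gen g' ` ideal_gens n e r d"] by blast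
  have "B \<subseteq> mp.span (gen g ` std_gens n e r d)"
    using B(1) sub2 mp.span_superset by blast
  from mp.independent_span_bound[OF _ B(2) this] have "card B \<le> card (gen g ` std_gens n e r d)"
    by (simp add: finite_std_gens)
  also have "\<dots> \<le> card (std_gens n e r d)" by (rule card_image_le[OF finite_std_gens])
  finally have cB: "card B \<le> card (std_gens n e r d)" .
  obtain T where T: "T \<subseteq> ideal_gens n e r d" "inj_on (gen g') T" "B = gen g' ` T"
    using B(1) unfolding subset_image_inj by blast
  have "ideal_piece n e g' r d \<subseteq> mp.span B" using B(3) by (intro mp.span_minimal) auto
  hence "ideal_piece n e g r d \<subseteq> mp.span (gen g' ` T)" using sub1 T(3) by blast
  moreover have "card T \<le> card (std_gens n e r d)" using cB T card_image by metis
  ultimately show ?thesis using T(1) unfolding g'_def[abs_def] by blast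
qed

end

text \<open>The parameters are the coefficients of the reduced generators (\<open>Inl\<close>, sign
absorbed) and the coefficients of the chosen products (\<open>Inr\<close>).\<close>

definition chart :: "nat \<Rightarrow> nat \<Rightarrow> (nat \<Rightarrow> nat) \<Rightarrow> (nat \<times> (nat \<Rightarrow>\<^sub>0 nat)) set \<Rightarrow>
    ((nat \<times> (nat \<Rightarrow>\<^sub>0 nat)) + (nat \<times> (nat \<Rightarrow>\<^sub>0 nat)) \<Rightarrow> 'a::field) \<Rightarrow> (nat \<Rightarrow>\<^sub>0 nat) \<Rightarrow> 'a" where
  "chart n r e T x m = (\<Sum>(l, \<mu>)\<in>T. x (Inr (l, \<mu>)) * (\<Sum>\<nu>\<in>mons {..n} (e l). if \<mu> + \<nu> = m then
     (if \<nu> = xe e l then 1 else if \<nu> \<in> std_mons n r e (e l) then x (Inl (l, \<nu>)) else 0) else 0))"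

text \<open>The number of parameters is \<open>\<Sum> H(e\<^sub>l)\<close> plus the dimension of the
degree \<open>d\<close> part of the ideal, and the latter is the number of all monomials minus
\<open>H(d)\<close>.\<close>

lemma thin_chart:
  assumes T: "T \<subseteq> ideal_gens n e r d" "card T \<le> card (std_gens n e r d)" and r: "r \<le> Suc n"
    and num: "(\<Sum>l<r. card (std_mons n r e (e l))) < card (std_mons n r e d)"
  shows "thin (mons {..n} d) (range (chart n r e T :: _ \<Rightarrow> _ \<Rightarrow> 'a::alg_closed_field))"
proof -
  let ?P = "SIGMA l:{..<r}. std_mons n r e (e l)"
  let ?V = "Inl ` ?P \<union> Inr ` T"
  have finT: "finite T" using T(1) finite_ideal_gens finite_subset by blast
  have finP: "finite ?P" by (auto simp: finite_std_mons)
  show ?thesis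
  proof (rule thin_rational_image[where V = ?V and F = "chart n r e T" and g = "\<lambda>_. 1"])
    show "finite ?V" using finT finP by simp
    show "finite (mons {..n} d)" by (simp add: finite_mons)
    have "card ?V = card ?P + card T" using finT finP by (subst card_Un_disjoint) (auto simp: card_image)
    also have "card ?P = (\<Sum>l<r. card (std_mons n r e (e l)))" by (simp add: finite_std_mons)
    finally show "card ?V < card (mons {..n} d)" using num T(2) card_std_split[OF r, of e d] by linarith
    show "(\<lambda>_. 1) \<in> polyfun ?V" by (rule polyfun_const)
    fix m
    have "(\<lambda>x. if \<mu> + \<nu> = m then (if \<nu> = xe e l then 1 else if \<nu> \<in> std_mons n r e (e l) then x (Inl (l, \<nu>)) else 0) else (0::'a)) \<in> polyfun ?V"
      if "(l, \<mu>) \<in> T" for l \<mu> \<nu>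
    proof (cases "\<mu> + \<nu> = m \<and> \<nu> \<noteq> xe e l \<and> \<nu> \<in> std_mons n r e (e l)")
      case True
      have "l < r" using T(1) that by (auto simp: ideal_gens_def)
      thus ?thesis using True by (auto intro!: polyfun_var)
    next
      case False
      thus ?thesis by (cases "\<mu> + \<nu> = m"; cases "\<nu> = xe e l") (auto intro: polyfun_const)
    qed
    moreover have "(\<lambda>x. x (Inr (l, \<mu>))) \<in> polyfun ?V" if "(l, \<mu>) \<in> T" for l \<mu> using that by (intro polyfun_var) auto
    ultimately show "(\<lambda>x. chart n r e T x m :: 'a) \<in> polyfun ?V"
      unfolding chart_def case_prod_unfold by (intro fun_alg_sum fun_alg_mult fun_alg_polyfun) auto
  qed auto
qed

lemma good_sum_in_chart:
  fixes g :: "nat \<Rightarrow> 'a::field mpoly"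
  assumes r: "r \<le> Suc n" and good: "good_gens n e r d g"
    and g: "\<And>l. l < r \<Longrightarrow> g l \<in> forms n (e l)" and h: "\<And>l. l < r \<Longrightarrow> h l \<in> forms n (d - e l)"
    and e: "\<And>l. l < r \<Longrightarrow> 1 \<le> e l \<and> e l \<le> d" and sorted: "\<And>k l. k \<le> l \<Longrightarrow> l < r \<Longrightarrow> e k \<le> e l"
  shows "\<exists>T. T \<subseteq> ideal_gens n e r d \<and> card T \<le> card (std_gens n e r d) \<and> lkp (\<Sum>l<r. g l * h l) \<in> range (chart n r e T)"
proof -
  from normal_form[OF r good g e sorted] obtain c T where T: "T \<subseteq> ideal_gens n e r d" "card T \<le> card (std_gens n e r d)"
    "ideal_piece n e g r d \<subseteq> mp.span (gen (\<lambda>l. mon (xe e l) - (\<Sum>b\<in>std_mons n r e (e l). smul (c l b) (mon b))) ` T)" by blast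
  define g' where "g' l = mon (xe e l) - (\<Sum>b\<in>std_mons n r e (e l). smul (c l b) (mon b))" for l
  have finT: "finite T" using T(1) finite_ideal_gens finite_subset by blast
  have "(\<Sum>l<r. g l * h l) \<in> ideal_piece n e g r d"
  proof (rule mp.span_sum)
    fix l assume "l \<in> {..<r}"
    hence l: "l < r" by simp
    have "h l * g l \<in> ideal_piece n e g r (d - e l + e l)"
      by (rule ideal_piece_mult[OF h[OF l] gen_in_ideal_piece[OF l]])
    thus "g l * h l \<in> ideal_piece n e g r d" using e[OF l] by (simp add: mult.commute)
  qed
  hence "(\<Sum>l<r. g l * h l) \<in> mp.span (gen g' ` T)" using T(3) unfolding g'_def[abs_def] by blast
  then obtain la where lam: "(\<Sum>l<r. g l * h l) = (\<Sum>t\<in>T. smul (la t) (gen g' t))" using span_family[OF finT] by blast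
  have g'l: "lkp (g' l) \<nu> = (if \<nu> = xe e l then 1 else if \<nu> \<in> std_mons n r e (e l) then - c l \<nu> else 0)" if "l < r" for l \<nu>
  proof -
    have "(\<Sum>b\<in>std_mons n r e (e l). c l b * lkp (mon b) \<nu>) = (if \<nu> \<in> std_mons n r e (e l) then c l \<nu> else 0)"
    proof -
      have "(\<Sum>b\<in>std_mons n r e (e l). c l b * lkp (mon b) \<nu>) = (\<Sum>b\<in>std_mons n r e (e l). if b = \<nu> then c l b else 0)"
        by (intro sum.cong refl) (simp add: lookup_single when_def)
      thus ?thesis by (simp add: finite_std_mons)
    qed
    moreover have "xe e l \<notin> std_mons n r e (e l)" using that by (auto simp: std_mons_def)
    ultimately show ?thesis by (auto simp: g'_def lookup_minus lookup_sum lookup_single when_def)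
  qed
  define x where "x = case_sum (\<lambda>(l, \<nu>). - c l \<nu>) la"
  have "lkp (\<Sum>l<r. g l * h l) m = chart n r e T x m" for m
    unfolding lam lookup_sum chart_def
  proof (intro sum.cong refl, clarify)
    fix l \<mu> assume "(l, \<mu>) \<in> T"
    hence l: "l < r" using T(1) by (auto simp: ideal_gens_def)
    have "xe e l \<in> mons {..n} (e l)" using l r by (auto simp: mons_def lookup_single when_def sum.delta')
    hence "supp (g' l) \<subseteq> mons {..n} (e l)"
      by (auto simp: in_keys_iff g'l[OF l] std_mons_def split: if_splits)
    hence "lkp (mon \<mu> * g' l) m = (\<Sum>a\<in>{\<mu>}. \<Sum>\<nu>\<in>mons {..n} (e l). if a + \<nu> = m then lkp (mon \<mu>) a * lkp (g' l) \<nu> else 0)"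
      by (intro lookup_mult_finite) (auto simp: finite_mons)
    hence "lkp (mon \<mu> * g' l) m = (\<Sum>\<nu>\<in>mons {..n} (e l). if \<mu> + \<nu> = m then lkp (g' l) \<nu> else 0)" by (simp cong: if_cong)
    also have "\<dots> = (\<Sum>\<nu>\<in>mons {..n} (e l). if \<mu> + \<nu> = m then
     (if \<nu> = xe e l then 1 else if \<nu> \<in> std_mons n r e (e l) then x (Inl (l, \<nu>)) else 0) else 0)"
      by (intro sum.cong refl) (simp add: g'l[OF l] x_def)
    finally show "lkp (smul (la (l, \<mu>)) (mon \<mu> * g' l)) m = x (Inr (l, \<mu>)) * (\<Sum>\<nu>\<in>mons {..n} (e l). if \<mu> + \<nu> = m then
     (if \<nu> = xe e l then 1 else if \<nu> \<in> std_mons n r e (e l) then x (Inl (l, \<nu>)) else 0) else 0)"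
      by (simp add: x_def)
  qed
  hence "lkp (\<Sum>l<r. g l * h l) \<in> range (chart n r e T)" by (intro range_eqI[of _ _ x] ext)
  thus ?thesis using T by blast
qed

text \<open>Only good generators are covered by the charts. For arbitrary ones the generators are
moved along a line to the powers \<open>x\<^sub>l^e\<^sub>l\<close>: the equation of the charts
holds at all but finitely many points of the line, hence at its origin.\<close>

lemma thin_sums_of_products:
  assumes r: "r \<le> Suc n" and e: "\<And>l. l < r \<Longrightarrow> 1 \<le> e l \<and> e l \<le> d"
    and sorted: "\<And>k l. k \<le> l \<Longrightarrow> l < r \<Longrightarrow> e k \<le> e l"
    and num: "(\<Sum>l<r. card (std_mons n r e (e l))) < card (std_mons n r e d)"
  shows "thin (mons {..n} d) (lkp ` (sums_of_products n d r e :: 'a::alg_closed_field mpoly set))"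
proof -
  let ?\<T> = "{T. T \<subseteq> ideal_gens n e r d \<and> card T \<le> card (std_gens n e r d)}"
  have "thin (mons {..n} d) (\<Union>T\<in>?\<T>. range (chart n r e T :: _ \<Rightarrow> _ \<Rightarrow> 'a))"
  proof (rule thin_UN)
    show "finite ?\<T>" using finite_ideal_gens[of n e r d] by simp
  qed (use r num in \<open>auto intro: thin_chart\<close>)
  then obtain P z where P: "P \<in> polyfun (mons {..n} d)" "P z \<noteq> 0"
    "\<forall>y\<in>(\<Union>T\<in>?\<T>. range (chart n r e T :: _ \<Rightarrow> _ \<Rightarrow> 'a)). P y = 0" unfolding thin_def by blast
  have "P (lkp f) = 0" if fW: "f \<in> sums_of_products n d r e" for f
  proof -
    obtain g h where gh: "f = (\<Sum>i<r. g i * h i)" "\<forall>i<r. g i \<in> forms n (e i) \<and> h i \<in> forms n (d - e i)"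
      using fW unfolding sums_of_products_def by blast
    obtain S where S: "finite S" "\<forall>t. t \<notin> S \<longrightarrow> good_gens n e r d (\<lambda>l. smul (1 - t) (g l) + smul t (mon (xe e l)))"
      using generic_gens_good[OF r, of e d g] by blast
    define f1 where "f1 = (\<Sum>i<r. mon (xe e i) * h i)"
    obtain p where p: "\<forall>t. poly p t = P (\<lambda>m. lkp f m + t * (lkp f1 m - lkp f m))"
      using polyfun_line[OF P(1), of "lkp f" "\<lambda>m. lkp f1 m - lkp f m"] by blast
    have "poly p t = 0" if "t \<notin> S" for t
    proof -
      let ?g = "\<lambda>l. smul (1 - t) (g l) + smul t (mon (xe e l))"
      have "\<exists>T. T \<subseteq> ideal_gens n e r d \<and> card T \<le> card (std_gens n e r d) \<and> lkp (\<Sum>l<r. ?g l * h l) \<in> range (chart n r e T)"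
      proof (rule good_sum_in_chart[OF r _ _ _ e sorted])
        show "good_gens n e r d ?g" using S that by blast
        fix l assume l: "l < r"
        have "xe e l \<in> mons {..n} (e l)" using l r by (auto simp: mons_def lookup_single when_def sum.delta')
        thus "?g l \<in> forms n (e l)" using gh(2) l by (intro forms_add cst_mult_form mon_form) auto
        show "h l \<in> forms n (d - e l)" using gh(2) l by blast
      qed auto
      hence "P (lkp (\<Sum>l<r. ?g l * h l)) = 0" using P(3) by blast
      moreover have "(\<Sum>l<r. ?g l * h l) = smul (1 - t) f + smul t f1"
        unfolding gh(1) f1_def by (simp add: distrib_right sum.distrib sum_distrib_left mult.assoc)
      hence "lkp (\<Sum>l<r. ?g l * h l) = (\<lambda>m. lkp f m + t * (lkp f1 m - lkp f m))"
        by (intro ext) (simp add: lookup_add left_diff_distrib right_diff_distrib)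
      ultimately show ?thesis using p by simp
    qed
    hence "p = 0" by (rule poly_cofinite_zero[OF S(1)])
    hence "poly p 0 = 0" by simp
    thus ?thesis using p by simp
  qed
  thus ?thesis unfolding thin_def using P(1,2) by (intro bexI[of _ P]) auto
qed

section \<open>Quartic surfaces and the main result\<close>

text \<open>Reduced echelon form, padded to exactly \<open>k\<close> pivots so that all cases have
the same number of parameters.\<close>

lemma echelon_span:
  fixes A :: "'a::field mpoly set"
  assumes M: "finite M" and A: "finite A" "A \<subseteq> mp.span (mon ` M)" "card A \<le> k" "k \<le> card M"
  shows "\<exists>P c. P \<subseteq> M \<and> card P = k \<and> A \<subseteq> mp.span ((\<lambda>\<mu>. mon \<mu> + (\<Sum>\<nu>\<in>M - P. smul (c \<mu> \<nu>) (mon \<nu>))) ` P)"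
  using A(1,3,2) A(4)
proof (induction k arbitrary: A)
  case 0
  thus ?case by (intro exI[of _ "{}"]) auto
next
  case (Suc k)
  define a where "a = (SOME a. a \<in> A \<or> A = {})"
  define A' where "A' = A - {a}"
  have a: "a \<in> A \<or> A = {}" unfolding a_def by (rule someI_ex) auto
  have "card A' \<le> k" using Suc.prems(1,2) a by (auto simp: A'_def)
  moreover have "A' \<subseteq> mp.span (mon ` M)" "finite A'" using Suc.prems by (auto simp: A'_def)
  ultimately obtain P c where P: "P \<subseteq> M" "card P = k"
    "A' \<subseteq> mp.span ((\<lambda>\<mu>. mon \<mu> + (\<Sum>\<nu>\<in>M - P. smul (c \<mu> \<nu>) (mon \<nu>))) ` P)"
    using Suc.IH[of A'] Suc.prems(4) by auto
  define w where "w \<mu> = mon \<mu> + (\<Sum>\<nu>\<in>M - P. smul (c \<mu> \<nu>) (mon \<nu>))" for \<mu>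
  have finP: "finite P" using P(1) M finite_subset by blast
  have ne: "M - P \<noteq> {}"
  proof
    assume "M - P = {}"
    hence "card M \<le> card P" using finP by (intro card_mono) auto
    thus False using P(2) Suc.prems(4) by simp
  qed
  \<comment> \<open>remove the old pivots from the new vector\<close>
  have "\<exists>b. (\<exists>\<beta>. b = (\<Sum>\<nu>\<in>M - P. smul (\<beta> \<nu>) (mon \<nu>))) \<and> (a \<in> A \<longrightarrow> a - b \<in> mp.span (w ` P))"
  proof (cases "a \<in> A")
    case False thus ?thesis by (intro exI[of _ 0] conjI exI[of _ "\<lambda>_. 0"]) (auto simp: cst_0)
  next
    case True
    then obtain \<alpha> where \<alpha>: "a = (\<Sum>m\<in>M. smul (\<alpha> m) (mon m))"
      using Suc.prems(3) span_family[OF M, of a mon] by blast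
    define \<beta> where "\<beta> \<nu> = \<alpha> \<nu> - (\<Sum>\<mu>\<in>P. \<alpha> \<mu> * c \<mu> \<nu>)" for \<nu>
    have "(\<Sum>\<mu>\<in>P. smul (\<alpha> \<mu>) (w \<mu>)) = (\<Sum>\<mu>\<in>P. smul (\<alpha> \<mu>) (mon \<mu>)) + (\<Sum>\<mu>\<in>P. \<Sum>\<nu>\<in>M - P. smul (\<alpha> \<mu> * c \<mu> \<nu>) (mon \<nu>))"
      unfolding w_def by (simp only: mp.scale_right_distrib sum.distrib mp.scale_sum_right mp.scale_scale)
    also have "(\<Sum>\<mu>\<in>P. \<Sum>\<nu>\<in>M - P. smul (\<alpha> \<mu> * c \<mu> \<nu>) (mon \<nu>)) = (\<Sum>\<nu>\<in>M - P. smul (\<Sum>\<mu>\<in>P. \<alpha> \<mu> * c \<mu> \<nu>) (mon \<nu>))"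
      by (subst sum.swap) (simp only: mp.scale_sum_left)
    finally have s: "(\<Sum>\<mu>\<in>P. smul (\<alpha> \<mu>) (w \<mu>)) = (\<Sum>\<mu>\<in>P. smul (\<alpha> \<mu>) (mon \<mu>)) + (\<Sum>\<nu>\<in>M - P. smul (\<Sum>\<mu>\<in>P. \<alpha> \<mu> * c \<mu> \<nu>) (mon \<nu>))" .
    have "a = (\<Sum>m\<in>M - P. smul (\<alpha> m) (mon m)) + (\<Sum>m\<in>P. smul (\<alpha> m) (mon m))"
      unfolding \<alpha> by (rule sum.subset_diff[OF P(1) M])
    hence "a - (\<Sum>\<nu>\<in>M - P. smul (\<beta> \<nu>) (mon \<nu>)) = (\<Sum>\<mu>\<in>P. smul (\<alpha> \<mu>) (w \<mu>))"
      unfolding s \<beta>_def mp.scale_left_diff_distrib sum_subtractf by simp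
    moreover have "(\<Sum>\<mu>\<in>P. smul (\<alpha> \<mu>) (w \<mu>)) \<in> mp.span (w ` P)"
      by (intro mp.span_sum mp.span_scale mp.span_base imageI)
    ultimately show ?thesis
      by (intro exI[of _ "\<Sum>\<nu>\<in>M - P. smul (\<beta> \<nu>) (mon \<nu>)"] conjI exI[of _ \<beta>]) simp_all
  qed
  then obtain b \<beta> where b: "b = (\<Sum>\<nu>\<in>M - P. smul (\<beta> \<nu>) (mon \<nu>))" "a \<in> A \<longrightarrow> a - b \<in> mp.span (w ` P)" by blast
  define \<nu>0 where "\<nu>0 = (SOME \<nu>. \<nu> \<in> M - P \<and> ((\<exists>\<nu>\<in>M - P. \<beta> \<nu> \<noteq> 0) \<longrightarrow> \<beta> \<nu> \<noteq> 0))"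
  have \<nu>0: "\<nu>0 \<in> M - P" "(\<exists>\<nu>\<in>M - P. \<beta> \<nu> \<noteq> 0) \<longrightarrow> \<beta> \<nu>0 \<noteq> 0"
  proof -
    have "\<exists>\<nu>. \<nu> \<in> M - P \<and> ((\<exists>\<nu>\<in>M - P. \<beta> \<nu> \<noteq> 0) \<longrightarrow> \<beta> \<nu> \<noteq> 0)" using ne by blast
    from someI_ex[OF this] show "\<nu>0 \<in> M - P" "(\<exists>\<nu>\<in>M - P. \<beta> \<nu> \<noteq> 0) \<longrightarrow> \<beta> \<nu>0 \<noteq> 0" unfolding \<nu>0_def by blast+
  qed
  define Q where "Q = insert \<nu>0 P"
  have Q: "Q \<subseteq> M" "card Q = Suc k" using P \<nu>0 finP by (auto simp: Q_def)
  have MQ: "M - P = insert \<nu>0 (M - Q)" "\<nu>0 \<notin> M - Q" "finite (M - Q)" using \<nu>0 M by (auto simp: Q_def)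
  define d where "d \<mu> \<nu> = (if \<mu> = \<nu>0 then \<beta> \<nu> / \<beta> \<nu>0 else c \<mu> \<nu> - c \<mu> \<nu>0 * (\<beta> \<nu> / \<beta> \<nu>0))" for \<mu> \<nu>
  define w' where "w' \<mu> = mon \<mu> + (\<Sum>\<nu>\<in>M - Q. smul (d \<mu> \<nu>) (mon \<nu>))" for \<mu>
  let ?S = "mp.span (w' ` Q)"
  have w': "w' \<mu> \<in> ?S" if "\<mu> \<in> Q" for \<mu> using that by (intro mp.span_base imageI)
  have bw: "b = smul (\<beta> \<nu>0) (w' \<nu>0)"
  proof -
    have "smul (\<beta> \<nu>0) (w' \<nu>0) = smul (\<beta> \<nu>0) (mon \<nu>0) + (\<Sum>\<nu>\<in>M - Q. smul (\<beta> \<nu>0 * (\<beta> \<nu> / \<beta> \<nu>0)) (mon \<nu>))"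
      unfolding w'_def d_def by (simp only: if_True refl mp.scale_right_distrib mp.scale_sum_right mp.scale_scale simp_thms)
    also have "(\<Sum>\<nu>\<in>M - Q. smul (\<beta> \<nu>0 * (\<beta> \<nu> / \<beta> \<nu>0)) (mon \<nu>)) = (\<Sum>\<nu>\<in>M - Q. smul (\<beta> \<nu>) (mon \<nu>))"
    proof (intro sum.cong refl)
      fix \<nu> assume "\<nu> \<in> M - Q"
      hence "\<beta> \<nu>0 * (\<beta> \<nu> / \<beta> \<nu>0) = \<beta> \<nu>" using \<nu>0(2) MQ(1) by (cases "\<beta> \<nu>0 = 0") auto
      thus "smul (\<beta> \<nu>0 * (\<beta> \<nu> / \<beta> \<nu>0)) (mon \<nu>) = smul (\<beta> \<nu>) (mon \<nu>)" by (simp only:)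
    qed
    finally show ?thesis unfolding b(1) MQ(1) using MQ(2,3) by simp
  qed
  have ww: "w \<mu> = w' \<mu> + smul (c \<mu> \<nu>0) (w' \<nu>0)" if "\<mu> \<in> P" for \<mu>
  proof -
    have "\<mu> \<noteq> \<nu>0" using that \<nu>0 by auto
    hence "w' \<mu> + smul (c \<mu> \<nu>0) (w' \<nu>0) = mon \<mu> + (\<Sum>\<nu>\<in>M - Q. smul (c \<mu> \<nu> - c \<mu> \<nu>0 * (\<beta> \<nu> / \<beta> \<nu>0)) (mon \<nu>))
      + (smul (c \<mu> \<nu>0) (mon \<nu>0) + (\<Sum>\<nu>\<in>M - Q. smul (c \<mu> \<nu>0 * (\<beta> \<nu> / \<beta> \<nu>0)) (mon \<nu>)))"
      unfolding w'_def d_def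
      by (simp only: if_True if_False refl mp.scale_right_distrib mp.scale_sum_right mp.scale_scale simp_thms)
    also have "\<dots> = mon \<mu> + (smul (c \<mu> \<nu>0) (mon \<nu>0) + (\<Sum>\<nu>\<in>M - Q. smul (c \<mu> \<nu>) (mon \<nu>)))"
      by (simp only: mp.scale_left_diff_distrib sum_subtractf) simp
    also have "\<dots> = w \<mu>" unfolding w_def MQ(1) using MQ(2,3) by simp
    finally show ?thesis by simp
  qed
  have wS: "w \<mu> \<in> ?S" if "\<mu> \<in> P" for \<mu>
    unfolding ww[OF that] using that by (intro mp.span_add mp.span_scale w') (auto simp: Q_def)
  have sub: "mp.span (w ` P) \<subseteq> ?S" by (rule mp.span_minimal) (use wS mp.subspace_span in auto)
  have "A \<subseteq> ?S"
  proof
    fix x assume x: "x \<in> A"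
    show "x \<in> ?S"
    proof (cases "x = a")
      case True
      hence "a - b \<in> ?S" using b(2) x sub by blast
      moreover have "b \<in> ?S" unfolding bw by (intro mp.span_scale w') (simp add: Q_def)
      ultimately have "(a - b) + b \<in> ?S" by (rule mp.span_add)
      thus ?thesis using True by simp
    next
      case False
      hence "x \<in> A'" using x by (simp add: A'_def)
      hence "x \<in> mp.span (w ` P)" using P(3) unfolding w_def[abs_def] by blast
      thus ?thesis using sub by blast
    qed
  qed
  thus ?case using Q unfolding w'_def[abs_def] by blast
qed

text \<open>Four quadrics in echelon form with pivots \<open>P\<close> (\<open>Inl\<close>: the
entries outside the pivot columns) and a combination of their products (\<open>Inr\<close>), one for
each unordered pair in \<open>T\<close>.\<close>

definition quad_chart :: "(nat \<Rightarrow>\<^sub>0 nat) set \<Rightarrow> (nat \<Rightarrow>\<^sub>0 nat) set \<Rightarrow> ((nat \<Rightarrow>\<^sub>0 nat) \<times> (nat \<Rightarrow>\<^sub>0 nat)) set \<Rightarrow>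
    (((nat \<Rightarrow>\<^sub>0 nat) \<times> (nat \<Rightarrow>\<^sub>0 nat)) + ((nat \<Rightarrow>\<^sub>0 nat) \<times> (nat \<Rightarrow>\<^sub>0 nat)) \<Rightarrow> 'a::field) \<Rightarrow> (nat \<Rightarrow>\<^sub>0 nat) \<Rightarrow> 'a" where
  "quad_chart M P T x m = (\<Sum>t\<in>T. x (Inr t) * (\<Sum>a\<in>M. \<Sum>b\<in>M. if a + b = m then
     (if a \<in> P then if a = fst t then 1 else 0 else x (Inl (fst t, a))) *
     (if b \<in> P then if b = snd t then 1 else 0 else x (Inl (snd t, b))) else 0))"

lemma ordered_pairs:
  assumes "finite P"
  shows "\<exists>T\<subseteq>P \<times> P. card T = (card P + 1) choose 2 \<and> (\<forall>a\<in>P. \<forall>b\<in>P. (a, b) \<in> T \<or> (b, a) \<in> T)"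
  using assms
proof (induction P rule: finite_induct)
  case empty show ?case by simp
next
  case (insert x P)
  then obtain T where T: "T \<subseteq> P \<times> P" "card T = (card P + 1) choose 2" "\<forall>a\<in>P. \<forall>b\<in>P. (a, b) \<in> T \<or> (b, a) \<in> T" by blast
  have finT: "finite T" using T(1) insert.hyps finite_subset by blast
  let ?T = "T \<union> Pair x ` insert x P"
  have "card ?T = card T + card (insert x P)"
  proof -
    have "card (Pair x ` insert x P) = card (insert x P)" by (rule card_image) (rule inj_onI, simp)
    thus ?thesis using T(1) insert.hyps finT by (subst card_Un_disjoint) auto
  qed
  also have "\<dots> = (card (insert x P) + 1) choose 2"
    using T(2) insert.hyps by (simp add: numeral_2_eq_2)
  finally have "card ?T = (card (insert x P) + 1) choose 2" .
  moreover have "?T \<subseteq> insert x P \<times> insert x P" using T(1) by auto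
  moreover have "\<forall>a\<in>insert x P. \<forall>b\<in>insert x P. (a, b) \<in> ?T \<or> (b, a) \<in> ?T" using T(3) by auto
  ultimately show ?case by blast
qed

text \<open>A space of dimension 4 in the 10-dimensional space of quadrics has \<open>4 \<cdot>
6\<close> parameters, and a quadratic form on it has 10 coefficients.\<close>

lemma thin_quartic_surface:
  "thin (mons {..3} 4) (lkp ` (sums_of_products 3 4 2 (\<lambda>_. 2) :: 'a::alg_closed_field mpoly set))"
proof -
  let ?M = "mons {..3} 2"
  have finM: "finite ?M" by (simp add: finite_mons)
  have cardM: "card ?M = 10" "card (mons {..3} 4) = 35"
    by (simp_all add: card_mons eval_nat_numeral)
  let ?C = "{(P, T). P \<subseteq> ?M \<and> card P = 4 \<and> T \<subseteq> P \<times> P \<and> card T = 10}"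
  have "thin (mons {..3} 4) (\<Union>k\<in>?C. range (quad_chart ?M (fst k) (snd k) :: _ \<Rightarrow> _ \<Rightarrow> 'a))"
  proof (rule thin_UN)
    have "?C \<subseteq> Pow ?M \<times> Pow (?M \<times> ?M)" by auto
    thus "finite ?C" by (rule finite_subset) (simp add: finM)
    fix k assume "k \<in> ?C"
    then obtain P T where k: "k = (P, T)" "P \<subseteq> ?M" "card P = 4" "T \<subseteq> P \<times> P" "card T = 10" by blast
    let ?V = "Inl ` (P \<times> (?M - P)) \<union> Inr ` T"
    have fin: "finite P" "finite T" using k finM finite_subset by (blast, metis finite_SigmaI finite_subset)
    show "thin (mons {..3} 4) (range (quad_chart ?M (fst k) (snd k) :: _ \<Rightarrow> _ \<Rightarrow> 'a))"
    proof (rule thin_rational_image[where V = ?V and F = "quad_chart ?M P T" and g = "\<lambda>_. 1"])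
      show "finite ?V" using fin finM by simp
      show "finite (mons {..3} 4)" by (simp add: finite_mons)
      have "card ?V = card (P \<times> (?M - P)) + card T" using fin finM by (subst card_Un_disjoint) (auto simp: card_image)
      also have "\<dots> = 34" using k fin cardM by (simp add: card_cartesian_product card_Diff_subset)
      finally show "card ?V < card (mons {..3} 4)" using cardM by simp
      show "(\<lambda>_. 1) \<in> polyfun ?V" by (rule polyfun_const)
      fix m
      have f: "(\<lambda>x. if a \<in> P then if a = p then 1 else 0 else x (Inl (p, a)) :: 'a) \<in> polyfun ?V" if "a \<in> ?M" "p \<in> P" for a p
        using that by (cases "a \<in> P") (auto intro: polyfun_const polyfun_var)
      have "(\<lambda>x. if a + b = m then
        (if a \<in> P then if a = fst t then 1 else 0 else x (Inl (fst t, a))) *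
        (if b \<in> P then if b = snd t then 1 else 0 else x (Inl (snd t, b))) else (0::'a)) \<in> polyfun ?V"
        if t: "t \<in> T" and ab: "a \<in> ?M" "b \<in> ?M" for t a b
      proof -
        have "fst t \<in> P" "snd t \<in> P" using t k(4) by auto
        from polyfun_mult[OF f[OF ab(1) this(1)] f[OF ab(2) this(2)]] show ?thesis
          by (cases "a + b = m") (simp_all add: polyfun_const)
      qed
      thus "(\<lambda>x. quad_chart ?M P T x m :: 'a) \<in> polyfun ?V"
        unfolding quad_chart_def by (intro fun_alg_sum fun_alg_mult fun_alg_polyfun polyfun_var) auto
    qed (use k in auto)
  qed
  moreover have "lkp ` (sums_of_products 3 4 2 (\<lambda>_. 2) :: 'a mpoly set) \<subseteq>
    (\<Union>k\<in>?C. range (quad_chart ?M (fst k) (snd k)))"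
  proof
    fix y assume "y \<in> lkp ` (sums_of_products 3 4 2 (\<lambda>_. 2) :: 'a mpoly set)"
    then obtain f :: "'a mpoly" where f: "y = lkp f" "f \<in> sums_of_products 3 4 2 (\<lambda>_. 2)" by blast
    then obtain g h where gh: "f = (\<Sum>i<2::nat. g i * h i)" "\<forall>i<2. g i \<in> forms 3 2 \<and> h i \<in> forms 3 (4 - 2)"
      unfolding sums_of_products_def by blast
    let ?A = "{g 0, h 0, g 1, h 1}"
    have fl: "g 0 \<in> forms 3 2" "h 0 \<in> forms 3 2" "g 1 \<in> forms 3 2" "h 1 \<in> forms 3 2" using gh(2) by auto
    have A: "?A \<subseteq> mp.span (mon ` ?M)" using fl form_in_span by blast
    have "card ?A \<le> 4" by (auto simp: card_insert_if)
    from echelon_span[OF finM _ A this] cardM obtain P c where P: "P \<subseteq> ?M" "card P = 4"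
      "?A \<subseteq> mp.span ((\<lambda>\<mu>. mon \<mu> + (\<Sum>\<nu>\<in>?M - P. smul (c \<mu> \<nu>) (mon \<nu>))) ` P)" by auto
    define w where "w \<mu> = mon \<mu> + (\<Sum>\<nu>\<in>?M - P. smul (c \<mu> \<nu>) (mon \<nu>))" for \<mu>
    have finP: "finite P" using P finM finite_subset by blast
    obtain T where T: "T \<subseteq> P \<times> P" "card T = (card P + 1) choose 2" "\<forall>a\<in>P. \<forall>b\<in>P. (a, b) \<in> T \<or> (b, a) \<in> T"
      using ordered_pairs[OF finP] by blast
    have cT: "card T = 10" using T(2) P(2) by (simp add: eval_nat_numeral)
    have finT: "finite T" using T(1) finP finite_subset by blast
    let ?w = "\<lambda>t. w (fst t) * w (snd t)"
    have prod: "p * q \<in> mp.span (?w ` T)" if "p \<in> mp.span (w ` P)" "q \<in> mp.span (w ` P)" for p q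
    proof (rule span_mult_left[OF that(1)])
      fix a assume "a \<in> w ` P"
      then obtain \<mu> where \<mu>: "\<mu> \<in> P" "a = w \<mu>" by blast
      have "q * a \<in> mp.span (?w ` T)"
      proof (rule span_mult_left[OF that(2)])
        fix b assume "b \<in> w ` P"
        then obtain \<nu> where \<nu>: "\<nu> \<in> P" "b = w \<nu>" by blast
        have "(\<mu>, \<nu>) \<in> T \<or> (\<nu>, \<mu>) \<in> T" using T(3) \<mu> \<nu> by blast
        hence "b * a \<in> ?w ` T" using \<mu> \<nu> by (force simp: mult.commute)
        thus "b * a \<in> mp.span (?w ` T)" by (rule mp.span_base)
      qed
      thus "a * q \<in> mp.span (?w ` T)" by (simp add: mult.commute)
    qed
    have "f = g 0 * h 0 + g 1 * h 1" using gh(1) by (simp add: numeral_2_eq_2)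
    moreover have "?A \<subseteq> mp.span (w ` P)" using P(3) unfolding w_def[abs_def] .
    ultimately have "f \<in> mp.span (?w ` T)" using prod by (auto intro: mp.span_add)
    then obtain la where lam: "f = (\<Sum>t\<in>T. smul (la t) (?w t))"
      using span_family[OF finT, of f ?w] by blast
    define x where "x = case_sum (\<lambda>(\<mu>, \<nu>). c \<mu> \<nu>) la"
    have wl: "lkp (w p) a = (if a \<in> P then if a = p then 1 else 0 else x (Inl (p, a)))" if "p \<in> P" "a \<in> ?M" for p a
    proof -
      have "(\<Sum>\<nu>\<in>?M - P. c p \<nu> * lkp (mon \<nu>) a) = (\<Sum>\<nu>\<in>?M - P. if \<nu> = a then c p \<nu> else 0)"
        by (intro sum.cong refl) (simp add: lookup_single when_def)
      also have "\<dots> = (if a \<in> P then 0 else c p a)" using finM that by simp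
      finally show ?thesis using that by (auto simp: w_def lookup_add lookup_sum lookup_single when_def x_def)
    qed
    have wk: "supp (w p) \<subseteq> ?M" if "p \<in> P" for p
    proof -
      have "w p \<in> forms 3 2" unfolding w_def
        using that P(1) by (intro forms_add forms_sum cst_mult_form mon_form) auto
      thus ?thesis by (simp add: forms_iff)
    qed
    have "lkp f m = quad_chart ?M P T x m" for m
      unfolding lam lookup_sum quad_chart_def
    proof (intro sum.cong refl)
      fix t assume "t \<in> T"
      hence t: "fst t \<in> P" "snd t \<in> P" using T(1) by auto
      have "lkp (?w t) m = (\<Sum>a\<in>?M. \<Sum>b\<in>?M. if a + b = m then lkp (w (fst t)) a * lkp (w (snd t)) b else 0)"
        by (rule lookup_mult_finite[OF finM finM wk[OF t(1)] wk[OF t(2)]])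
      also have "\<dots> = (\<Sum>a\<in>?M. \<Sum>b\<in>?M. if a + b = m then
        (if a \<in> P then if a = fst t then 1 else 0 else x (Inl (fst t, a))) *
        (if b \<in> P then if b = snd t then 1 else 0 else x (Inl (snd t, b))) else 0)"
        by (intro sum.cong refl) (simp only: wl[OF t(1)] wl[OF t(2)])
      finally show "lkp (smul (la t) (?w t)) m = x (Inr t) * \<dots>" by (simp add: x_def)
    qed
    hence "y = quad_chart ?M P T x" unfolding f(1) by (intro ext)
    thus "y \<in> (\<Union>k\<in>?C. range (quad_chart ?M (fst k) (snd k)))"
      using P T(1) cT by (intro UN_I[of "(P, T)"]) auto
  qed
  ultimately show ?thesis by (rule thin_subset)
qed

text \<open>For the type \<open>(1, \<dots>, 1)\<close> this is the minimality of the generic slice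
rank. For any other type the same minimality yields \<open>r c < C(c + d - 1, d)\<close> by the
density criterion, and the parameter count applies, except for quartic surfaces and two
quadrics.\<close>

lemma product_type_thin:
  assumes d: "d \<in> {2, 3, 4, 5, 6, 7, 9}" and r: "1 \<le> r" "r < generic_slice_rank TYPE('a::alg_closed_field) n d"
    and e: "\<And>l. l < r \<Longrightarrow> 1 \<le> e l \<and> e l \<le> d div 2" and sorted: "\<And>k l. k \<le> l \<Longrightarrow> l < r \<Longrightarrow> e k \<le> e l"
  shows "thin (mons {..n} d) (lkp ` (sums_of_products n d r e :: 'a mpoly set))"
proof -
  have d1: "1 \<le> d" using d by auto
  note gsr = generic_slice_rank_eq[OF d1, where 'a = 'a and n = n]
  have rL: "r < (LEAST r. slice_dense TYPE('a) n d r)" using r(2) gsr by simp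
  have nd: "\<not> slice_dense TYPE('a) n d r" by (rule not_less_Least[OF rL])
  have rn: "r \<le> n" using rL gsr by linarith
  show ?thesis
  proof (cases "\<exists>l<r. 2 \<le> e l")
    case False
    hence "e l = 1" if "l < r" for l using e[OF that] that by force
    hence "sums_of_products n d r e = (sums_of_products n d r (\<lambda>_. 1) :: 'a mpoly set)"
      unfolding sums_of_products_def by (intro Collect_cong) (metis (no_types, lifting))
    thus ?thesis using nd unfolding slice_dense_def by simp
  next
    case True
    then obtain l where "l < r" "2 \<le> e l" by blast
    hence d4: "d \<in> {4, 5, 6, 7, 9}" using d e[of l] by auto
    define c where "c = n + 1 - r"
    have n: "n + 1 = r + c" and c1: "1 \<le> c" using rn by (auto simp: c_def)
    \<comment> \<open>otherwise forms of slice rank at most \<open>r\<close> would be dense\<close>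
    have rc: "r * c < (c + d - 1) choose d"
    proof (rule ccontr)
      assume "\<not> ?thesis"
      hence rc: "(c + d - 1) choose d \<le> r * c" by simp
      have "c * c \<le> (c + d - 1) choose d" using d4 c1 by (intro square_le_binomial) auto
      hence "c * c \<le> r * c" using rc by (rule order_trans)
      hence "c \<le> r" using c1 by simp
      hence "slice_dense TYPE('a) n d r" using rc d4 c1 n by (intro slice_dense_criterion) auto
      thus False using nd by simp
    qed
    \<comment> \<open>for \<open>c = 1\<close> the bound would read \<open>r < 1\<close>\<close>
    have c2: "2 \<le> c"
    proof (rule ccontr)
      assume "\<not> ?thesis"
      hence "c = 1" using c1 by simp
      thus False using rc r(1) by simp
    qed
    have ed: "1 \<le> e l \<and> e l \<le> d" if "l < r" for l using e[OF that] by linarith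
    have rS: "r \<le> Suc n" using rn by simp
    show ?thesis
    proof (cases "d = 4 \<and> c = 2")
      case False
      hence "start_dim d \<le> c" using c2 by (auto simp: start_dim_def)
      from codimension_ineq[OF d4 this n e rc]
      show ?thesis by (intro thin_sums_of_products[OF rS ed sorted])
    next
      case d4c2: True
      have "(5::nat) choose 4 = 5" by (simp add: eval_nat_numeral)
      hence r2: "r * 2 < 5" using rc d4c2 by simp
      show ?thesis
      proof (cases "r = 2 \<and> e 0 = 2 \<and> e 1 = 2")
        case False
        have "(\<Sum>i<r. card (std_mons n r e (e i))) < card (std_mons n r e 4)"
          by (rule codimension_ineq_quartic_surface[OF r(1) r2]) (use n d4c2 e False \<open>\<exists>l<r. 2 \<le> e l\<close> in auto)
        thus ?thesis using d4c2 by (intro thin_sums_of_products[OF rS ed sorted]) auto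
      next
        case all2: True
        hence "e l = 2" if "l < r" for l using that by (auto simp: less_2_cases_iff)
        hence "sums_of_products n d r e = (sums_of_products n d r (\<lambda>_. 2) :: 'a mpoly set)"
          unfolding sums_of_products_def by (intro Collect_cong) (metis (no_types, lifting))
        moreover have "n = 3" using n all2 d4c2 by simp
        ultimately show ?thesis using thin_quartic_surface all2 d4c2 by simp
      qed
    qed
  qed
qed

text \<open>Only the homogeneous part of degree \<open>d - e i\<close> of each cofactor contributes
to a form of degree \<open>d\<close>.\<close>

lemma form_in_ideal_is_sum:
  fixes f :: "'a::field mpoly"
  assumes f: "f \<in> forms n d" "f \<in> ideal_of n gs" and gs: "\<And>i. i < length gs \<Longrightarrow> gs ! i \<in> forms n (e i) \<and> e i \<le> d"
  shows "\<exists>h. (\<forall>i<length gs. h i \<in> forms n (d - e i)) \<and> f = (\<Sum>i<length gs. gs ! i * h i)"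
proof -
  obtain h where h: "f = (\<Sum>i<length gs. h i * gs ! i)" "\<forall>i<length gs. h i \<in> polys n"
    using f(2) unfolding ideal_of_def by blast
  define h' where "h' i = of_coords (mons {..n} (d - e i)) (lkp (h i))" for i
  have part: "lkp (h i * gs ! i) m = lkp (gs ! i * h' i) m" if i: "i < length gs" and m: "m \<in> mons {..n} d" for i m
  proof -
    let ?A = "mons {..n} (e i)" and ?H = "supp (h i) \<union> mons {..n} (d - e i)"
    have fin: "finite ?A" "finite ?H" by (simp_all add: finite_mons)
    have gA: "supp (gs ! i) \<subseteq> ?A" using gs[OF i] by (simp add: forms_iff)
    have "lkp (gs ! i * h i) m = (\<Sum>a\<in>?A. \<Sum>b\<in>?H. if a + b = m then lkp (gs ! i) a * lkp (h i) b else 0)"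
      by (rule lookup_mult_finite[OF fin gA]) simp
    also have "\<dots> = (\<Sum>a\<in>?A. \<Sum>b\<in>?H. if a + b = m then lkp (gs ! i) a * lkp (h' i) b else 0)"
    proof (intro sum.cong refl if_cong)
      fix a b assume a: "a \<in> ?A" and b: "b \<in> ?H" and ab: "a + b = m"
      have "supp b \<subseteq> {..n}"
        using b h(2) i by (auto simp: mons_def polys_def)
      moreover have "(\<Sum>j\<le>n. lkp b j) = d - e i"
      proof -
        have "(\<Sum>j\<le>n. lkp a j) + (\<Sum>j\<le>n. lkp b j) = d"
          using m unfolding ab[symmetric] by (simp add: mons_def lookup_add sum.distrib)
        thus ?thesis using a by (simp add: mons_def)
      qed
      ultimately have "b \<in> mons {..n} (d - e i)" by (simp add: mons_def)
      thus "lkp (gs ! i) a * lkp (h i) b = lkp (gs ! i) a * lkp (h' i) b"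
        by (simp add: h'_def lookup_of_coords finite_mons)
    qed
    also have "\<dots> = lkp (gs ! i * h' i) m"
      by (rule lookup_mult_finite[OF fin gA, symmetric])
        (use keys_of_coords[OF finite_mons, of "{..n}"] in \<open>auto simp: h'_def\<close>)
    finally show ?thesis by (simp add: mult.commute)
  qed
  have h'f: "h' i \<in> forms n (d - e i)" for i unfolding h'_def by (rule of_coords_forms)
  have F: "(\<Sum>i<length gs. gs ! i * h' i) \<in> forms n d"
  proof (rule forms_sum)
    fix i assume "i \<in> {..<length gs}"
    thus "gs ! i * h' i \<in> forms n d" using forms_mult[of "gs ! i" n "e i" "h' i" "d - e i"] gs[of i] h'f by simp
  qed
  have "f = (\<Sum>i<length gs. gs ! i * h' i)"
  proof (rule poly_mapping_eqI)
    fix m show "lkp f m = lkp (\<Sum>i<length gs. gs ! i * h' i) m"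
    proof (cases "m \<in> mons {..n} d")
      case True
      show ?thesis unfolding h(1) lookup_sum by (intro sum.cong refl part True) simp
    next
      case False
      hence "m \<notin> supp f" "m \<notin> supp (\<Sum>i<length gs. gs ! i * h' i)" using f(1) F by (auto simp: forms_iff)
      thus ?thesis by (simp add: in_keys_iff)
    qed
  qed
  thus ?thesis using h'f by (intro exI[of _ h']) simp
qed

text \<open>A product is symmetric in its factors, so the factor of smaller degree can be listed
first. The type is extended by 0 so that only finitely many types exist.\<close>

lemma sum_of_products_sorted_type:
  fixes g h :: "nat \<Rightarrow> 'a::field mpoly"
  assumes "f = (\<Sum>i<r. g i * h i)" "\<And>i. i < r \<Longrightarrow> g i \<in> forms n (e i) \<and> h i \<in> forms n (d - e i) \<and> 1 \<le> e i \<and> e i \<le> d - 1"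
  shows "\<exists>e'. (\<forall>l<r. 1 \<le> e' l \<and> e' l \<le> d div 2) \<and> (\<forall>k l. k \<le> l \<and> l < r \<longrightarrow> e' k \<le> e' l) \<and>
    (\<forall>l\<ge>r. e' l = 0) \<and> f \<in> sums_of_products n d r e'"
proof -
  define t where "t i = (if e i \<le> d div 2 then (e i, g i, h i) else (d - e i, h i, g i))" for i
  have t: "fst (snd (t i)) * snd (snd (t i)) = g i * h i \<and> fst (snd (t i)) \<in> forms n (fst (t i)) \<and>
      snd (snd (t i)) \<in> forms n (d - fst (t i)) \<and> 1 \<le> fst (t i) \<and> fst (t i) \<le> d div 2" if i: "i < r" for i
    using assms(2)[OF i] by (auto simp: t_def mult.commute)
  define ts where "ts = sort_key fst (map t [0..<r])"
  have len: "length ts = r" by (simp add: ts_def)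
  have set: "set ts = t ` {..<r}" by (auto simp: ts_def)
  have P: "fst (snd (ts ! l)) \<in> forms n (fst (ts ! l)) \<and>
      snd (snd (ts ! l)) \<in> forms n (d - fst (ts ! l)) \<and> 1 \<le> fst (ts ! l) \<and> fst (ts ! l) \<le> d div 2" if "l < r" for l
  proof -
    have "ts ! l \<in> t ` {..<r}" using nth_mem[of l ts] len that set by simp
    thus ?thesis using t by auto
  qed
  define e' where "e' l = (if l < r then fst (ts ! l) else 0)" for l
  have "f = (\<Sum>i<r. fst (snd (t i)) * snd (snd (t i)))" unfolding assms(1) using t by (intro sum.cong) auto
  also have "\<dots> = sum_list (map (\<lambda>x. fst (snd x) * snd (snd x)) (map t [0..<r]))"
    by (simp add: interv_sum_list_conv_sum_set_nat atLeast0LessThan comp_def)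
  also have "\<dots> = sum_mset (image_mset (\<lambda>x. fst (snd x) * snd (snd x)) (mset (map t [0..<r])))"
    unfolding mset_map[symmetric] by (rule sum_mset_sum_list[symmetric])
  also have "mset (map t [0..<r]) = mset ts" by (simp add: ts_def)
  also have "sum_mset (image_mset (\<lambda>x. fst (snd x) * snd (snd x)) (mset ts)) = sum_list (map (\<lambda>x. fst (snd x) * snd (snd x)) ts)"
    by (simp add: sum_mset_sum_list[symmetric])
  also have "\<dots> = (\<Sum>i<r. fst (snd (ts ! i)) * snd (snd (ts ! i)))"
    by (simp add: sum_list_sum_nth len atLeast0LessThan)
  finally have "f = (\<Sum>i<r. fst (snd (ts ! i)) * snd (snd (ts ! i)))" .
  hence "f \<in> sums_of_products n d r e'"
    by (rule sums_of_productsI) (use P in \<open>auto simp: e'_def\<close>)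
  moreover have "e' k \<le> e' l" if "k \<le> l" "l < r" for k l
  proof -
    have "sorted (map fst ts)" unfolding ts_def by (rule sorted_sort_key)
    hence "map fst ts ! k \<le> map fst ts ! l" using that len by (intro sorted_nth_mono) auto
    thus ?thesis using that len by (simp add: e'_def)
  qed
  ultimately show ?thesis using P by (intro exI[of _ e']) (auto simp: e'_def)
qed

theorem corollary1p6:
  fixes n d :: nat
  assumes "d \<in> {2, 3, 4, 5, 6, 7, 9}" and "n \<ge> 1"
  shows "general_form n d (\<lambda>f :: 'a::alg_closed_field mpoly.
           \<not> (\<exists>r gs. 1 \<le> r \<and> r < generic_slice_rank TYPE('a) n d \<and>
                length gs = r \<and> regular_sequence n gs \<and>
                (\<forall>g \<in> set gs. \<exists>e. 1 \<le> e \<and> e \<le> d - 1 \<and> g \<in> forms n e) \<and>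
                f \<in> ideal_of n gs))"
proof (rule general_form_thin)
  let ?R = "generic_slice_rank TYPE('a) n d"
  define types where "types r = {e :: nat \<Rightarrow> nat. (\<forall>l<r. 1 \<le> e l \<and> e l \<le> d div 2) \<and>
    (\<forall>k l. k \<le> l \<and> l < r \<longrightarrow> e k \<le> e l) \<and> (\<forall>l\<ge>r. e l = 0)}" for r
  have fin: "finite (types r)" for r
  proof (rule finite_subset)
    show "types r \<subseteq> {e. (\<forall>l\<in>{..<r}. e l \<in> {..d div 2}) \<and> (\<forall>l. l \<notin> {..<r} \<longrightarrow> e l = 0)}"
      by (auto simp: types_def)
    show "finite {e :: nat \<Rightarrow> nat. (\<forall>l\<in>{..<r}. e l \<in> {..d div 2}) \<and> (\<forall>l. l \<notin> {..<r} \<longrightarrow> e l = 0)}"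
      using finite_set_of_finite_funs[of "{..<r}" "{..d div 2}" 0] by (rule rev_finite_subset) auto
  qed
  have "thin (mons {..n} d) (\<Union>r\<in>{1..<?R}. \<Union>e\<in>types r. lkp ` (sums_of_products n d r e :: 'a mpoly set))"
  proof (intro thin_UN fin)
    fix r e assume "r \<in> {1..<?R}" "e \<in> types r"
    thus "thin (mons {..n} d) (lkp ` (sums_of_products n d r e :: 'a mpoly set))"
      by (intro product_type_thin[OF assms(1)]) (auto simp: types_def)
  qed simp
  moreover have "lkp ` {f \<in> forms n d. \<not> \<not> (\<exists>r gs. 1 \<le> r \<and> r < ?R \<and>
                length gs = r \<and> regular_sequence n gs \<and>
                (\<forall>g \<in> set gs. \<exists>e. 1 \<le> e \<and> e \<le> d - 1 \<and> g \<in> forms n e) \<and>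
                f \<in> ideal_of n gs)} \<subseteq> (\<Union>r\<in>{1..<?R}. \<Union>e\<in>types r. lkp ` (sums_of_products n d r e :: 'a mpoly set))"
  proof (rule image_subsetI)
    fix f :: "'a mpoly"
    assume "f \<in> {f \<in> forms n d. \<not> \<not> (\<exists>r gs. 1 \<le> r \<and> r < ?R \<and>
                length gs = r \<and> regular_sequence n gs \<and>
                (\<forall>g \<in> set gs. \<exists>e. 1 \<le> e \<and> e \<le> d - 1 \<and> g \<in> forms n e) \<and>
                f \<in> ideal_of n gs)}"
    then obtain gs where f: "f \<in> forms n d" "f \<in> ideal_of n gs" and r: "1 \<le> length gs" "length gs < ?R"
      and gs: "\<forall>g \<in> set gs. \<exists>e. 1 \<le> e \<and> e \<le> d - 1 \<and> g \<in> forms n e" by blast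
    have "\<forall>i\<in>{..<length gs}. \<exists>e. 1 \<le> e \<and> e \<le> d - 1 \<and> gs ! i \<in> forms n e" using gs by auto
    from bchoice[OF this] obtain e where e: "\<forall>i\<in>{..<length gs}. 1 \<le> e i \<and> e i \<le> d - 1 \<and> gs ! i \<in> forms n (e i)" ..
    obtain h where h: "\<forall>i<length gs. h i \<in> forms n (d - e i)" "f = (\<Sum>i<length gs. gs ! i * h i)"
    proof -
      have "gs ! i \<in> forms n (e i) \<and> e i \<le> d" if "i < length gs" for i
        using bspec[OF e, of i] that by auto
      from form_in_ideal_is_sum[OF f this] show ?thesis using that by blast
    qed
    obtain e' where e': "\<forall>l<length gs. 1 \<le> e' l \<and> e' l \<le> d div 2" "\<forall>k l. k \<le> l \<and> l < length gs \<longrightarrow> e' k \<le> e' l"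
      "\<forall>l\<ge>length gs. e' l = 0" "f \<in> sums_of_products n d (length gs) e'"
    proof -
      have "gs ! i \<in> forms n (e i) \<and> h i \<in> forms n (d - e i) \<and> 1 \<le> e i \<and> e i \<le> d - 1" if "i < length gs" for i
        using bspec[OF e, of i] h(1) that by auto
      from sum_of_products_sorted_type[OF h(2) this] show ?thesis using that by blast
    qed
    have "e' \<in> types (length gs)" using e' by (simp add: types_def)
    thus "lkp f \<in> (\<Union>r\<in>{1..<?R}. \<Union>e\<in>types r. lkp ` sums_of_products n d r e)"
      using r e'(4) by (intro UN_I[of "length gs"] UN_I[of e'] imageI) auto
  qed
  ultimately show "thin (mons {..n} d) (lkp ` {f \<in> (forms n d :: 'a mpoly set). \<not> \<not> (\<exists>r gs. 1 \<le> r \<and> r < ?R \<and>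
                length gs = r \<and> regular_sequence n gs \<and>
                (\<forall>g \<in> set gs. \<exists>e. 1 \<le> e \<and> e \<le> d - 1 \<and> g \<in> forms n e) \<and>
                f \<in> ideal_of n gs)})" by (rule thin_subset)
qed

end
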